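(* The following hold: (i) if $p>4-2\sqrt{3}$ is fixed, then there exists $N\in\mathbb{N}$ such that $p_{1,c}(\mathbb{Z}^2\times K_N)\leq p$; (ii) for every $n\in\mathbb{N}$, $p_{1,c}(\mathbb{Z}^2\times K_n)\geq 4-2\sqrt{3}$. In particular, $\lim_{n\to\infty}p_{1,c}(\mathbb{Z}^2\times K_n)=4-2\sqrt{3}$.
   Context: For a graph $H$, a random graph model on $H$ is a probability measure $\mu$ on subsets of $E(H)$; $\mathbf{H}_\mu$ denotes the random spanning subgraph of $H$ with edge set chosen according to $\mu$. The graph distance between edge sets $A,B$ is the length of a shortest path in $H$ from an endpoint of an edge of $A$ to an endpoint of an edge of $B$. $\mu$ is $1$-independent if for all disjoint $A,B\subseteq E(H)$ at graph distance at least $1$ (i.e. spanning disjoint vertex sets), the random variables $E(\mathbf{H}_\mu)\cap A$ and $E(\mathbf{H}_\mu)\cap B$ are independent. $\mathcal{M}_{1,\geq p}(H)$ is the set of $1$-independent measures on $H$ in which each edge is present with probability at least $p$. For an infinite connected graph $H$, $\mu$ percolates if $\mathbf{H}_\mu$ almost surely contains an infinite connected component, and $p_{1,c}(H)=\inf\{p\ge 0:\ \text{every }\mu\in\mathcal{M}_{1,\geq p}(H)\text{ percolates}\}$. $\mathbb{Z}^2$ is the square integer lattice (vertices $\mathbb{Z}^2$, edges between points at Euclidean distance 1), $K_n$ is the complete graph on $n$ vertices, and $G_1\times G_2$ denotes the Cartesian product: vertices $(v_1,v_2)$, with $(u_1,u_2)\sim(v_1,v_2)$ iff either $u_1=v_1$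 and $u_2v_2\in E(G_2)$, or $u_1v_1\in E(G_1)$ and $u_2=v_2$. *)

theory Defs
  imports "HOL-Probability.Probability"
begin

text \<open>A graph is given by a vertex set V and a set E of edges, each edge being a
two-element set of vertices. Random subsets of E carry the sigma-algebra generated
by the events "e is present".\<close>

definition edge_space :: "'v set set \<Rightarrow> 'v set set measure" where
  "edge_space E = sigma (Pow E) ((\<lambda>e. {S \<in> Pow E. e \<in> S}) ` E)"

definition random_graph_model :: "'v set set \<Rightarrow> 'v set set measure \<Rightarrow> bool" where
  "random_graph_model E \<mu> \<longleftrightarrow> prob_space \<mu> \<and> sets \<mu> = sets (edge_space E)"

text \<open>1-independence: edge sets spanning disjoint vertex sets (graph distance at least 1)
are independent.\<close>
definition one_independent :: "'v set set \<Rightarrow> 'v set set measure \<Rightarrow> bool" where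
  "one_independent E \<mu> \<longleftrightarrow>
     (\<forall>A B. A \<subseteq> E \<longrightarrow> B \<subseteq> E \<longrightarrow> \<Union>A \<inter> \<Union>B = {} \<longrightarrow>
        prob_space.indep_var \<mu> (edge_space A) (\<lambda>S. S \<inter> A) (edge_space B) (\<lambda>S. S \<inter> B))"

definition M1 :: "'v set set \<Rightarrow> real \<Rightarrow> 'v set set measure set" where
  "M1 E p = {\<mu>. random_graph_model E \<mu> \<and> one_independent E \<mu> \<and>
                (\<forall>e\<in>E. measure \<mu> {S \<in> space \<mu>. e \<in> S} \<ge> p)}"

definition has_infinite_component :: "'v set \<Rightarrow> 'v set set \<Rightarrow> bool" where
  "has_infinite_component V S \<longleftrightarrow>
     (\<exists>v\<in>V. infinite {w. (\<lambda>x y. {x, y} \<in> S)\<^sup>*\<^sup>* v w})"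

definition percolates :: "'v set \<Rightarrow> 'v set set measure \<Rightarrow> bool" where
  "percolates V \<mu> \<longleftrightarrow> (AE S in \<mu>. has_infinite_component V S)"

definition p1c :: "'v set \<Rightarrow> 'v set set \<Rightarrow> real" where
  "p1c V E = Inf {p. p \<ge> 0 \<and> (\<forall>\<mu>\<in>M1 E p. percolates V \<mu>)}"

definition Z2K_V :: "nat \<Rightarrow> ((int \<times> int) \<times> nat) set" where
  "Z2K_V n = UNIV \<times> {..<n}"

definition Z2K_E :: "nat \<Rightarrow> ((int \<times> int) \<times> nat) set set" where
  "Z2K_E n = {{(u, i), (v, j)} | u v i j. i < n \<and> j < n \<and>
      ((u = v \<and> i \<noteq> j) \<or> (i = j \<and> \<bar>fst u - fst v\<bar> + \<bar>snd u - snd v\<bar> = 1))}"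

end

theory Submission
  imports Defs "HOL-Library.Ramsey"
begin

text \<open>
Lower bound: give every vertex an independent random bit with a bias depending on its max-norm
modulo 3, and let the bits of the two endpoints decide whether an edge is open. With the biases
$(3-\sqrt3)/2$ and $2-\sqrt3$ every edge has probability at least $4-2\sqrt3$, while no component
crosses three consecutive shells.

Upper bound: in a fibre $K_n$ with edge density at least $p$ there is a giant component. If the giants of
two adjacent fibres are not connected, split all vertices into the component of one giant and the rest. If
$(x,y)$ and $(x',y')$ are the densities of the two classes in the fibres, with the larger one first,
counting edges gives $x^2+y^2\ge p$ and $x'^2+y'^2\ge p$, and the edges between the fibres give
$p\le 1-(xx'+yy')$, which is impossible for $p>4-2\sqrt3$. To make this work with high probability the
classes are described by a bounded set $P$ of sampled vertices, and densities are measured in a large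
set $Z$, chosen by Ramsey's theorem, on which the relevant pair correlations are almost constant. Hence
adjacent giants are connected with probability close to 1. Declaring a pair of neighbouring $2\times2$
blocks good if one vertex covers all its bad bonds squares the failure probability up to a constant at each
scale, and Borel-Cantelli yields an infinite component, without planar duality.
\<close>

section \<open>Ramsey-type selection and an inequality in the plane\<close>

text \<open>The number 4 - 2 sqrt 3 is the value of q at which the extremal pair of the plane
  inequality, (sqrt q, 0) and the point of the line x + y = 1 with x^2 + y^2 = q, has scalar product
  exactly 1 - q. There sqrt q = sqrt 3 - 1, and the vectors are (sqrt 3 - 1, 0) and ((3 - sqrt 3)/2,
  (sqrt 3 - 1)/2). The shell biases are read off from them: shells 2 and 1 modulo 3 realise this
  pair, and three edge types get probability exactly 4 - 2 sqrt 3. The obstacle in the upper bound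
  is that the separating classes are random, while the second moment bounds are far too weak for a
  union bound over 2^n classes; a bounded \<open>P\<close> leaves only 4^|P| pairs of traces. Inside
  one fibre, the neighbourhoods of different vertices in \<open>P\<close> share vertices and may be
  correlated, so the densities themselves need not concentrate. What survives is weaker:
  independence of the two fibres, with nearly constant pair correlations in one of them, makes the
  overlap of two traces almost at least the product of their random densities.\<close>

lemma Ramsey_pairs:
  fixes m r :: nat
  shows "\<exists>N. \<forall>(V::nat set) (col :: nat set \<Rightarrow> 'c). finite V \<and> card V \<ge> N \<and>
           finite (col ` [V]\<^bsup>2\<^esup>) \<and> card (col ` [V]\<^bsup>2\<^esup>) \<le> r \<longrightarrow>
           (\<exists>Y\<subseteq>V. card Y = m \<and> (\<exists>c. \<forall>e\<in>[Y]\<^bsup>2\<^esup>. col e = c))"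
proof -
  obtain N :: nat where N: "partn_lst {..<N} (replicate (Suc r) m) 2"
    using ramsey_full by blast
  show ?thesis
  proof (intro exI[of _ N] allI impI, elim conjE)
    fix V :: "nat set" and col :: "nat set \<Rightarrow> 'c"
    assume V: "finite V" "N \<le> card V" and C: "finite (col ` [V]\<^bsup>2\<^esup>)" "card (col ` [V]\<^bsup>2\<^esup>) \<le> r"
    obtain W where W: "W \<subseteq> V" "card W = N" "finite W"
      using V obtain_subset_with_card_n[of N V] by (metis finite_subset)
    obtain u where u: "bij_betw u {..<N} W"
      using W by (metis bij_betw_from_nat_into_finite atLeast0LessThan finite_same_card_bij finite_lessThan card_lessThan)
    \<comment> \<open>The partition theorem wants colours in an initial segment of the naturals, so
      the finitely many occurring colours are numbered by \<open>h\<close>. The type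
      \<open>'c\<close> may be infinite, which later lets a colour be a whole function.\<close>
    obtain h where h: "inj_on h (col ` [V]\<^bsup>2\<^esup>)" "h ` (col ` [V]\<^bsup>2\<^esup>) = {..<card (col ` [V]\<^bsup>2\<^esup>)}"
      using ex_bij_betw_finite_nat[OF C(1)] by (metis atLeast0LessThan bij_betw_def)
    have im: "u ` e \<in> [V]\<^bsup>2\<^esup>" if "e \<in> [{..<N}]\<^bsup>2\<^esup>" for e
      using bij_betw_nsets[OF u, of 2] that nsets_mono[OF W(1), of 2]
      by (auto simp: bij_betw_def)
    have "(\<lambda>e. h (col (u ` e))) \<in> [{..<N}]\<^bsup>2\<^esup> \<rightarrow> {..<Suc r}"
    proof
      fix e assume "e \<in> [{..<N}]\<^bsup>2\<^esup>"
      then have "h (col (u ` e)) \<in> {..<card (col ` [V]\<^bsup>2\<^esup>)}"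
        using im h(2) by blast
      then show "h (col (u ` e)) \<in> {..<Suc r}" using C(2) by auto
    qed
    then obtain i H where iH: "i < Suc r" "H \<in> [{..<N}]\<^bsup>m\<^esup>"
        "(\<lambda>e. h (col (u ` e))) ` [H]\<^bsup>2\<^esup> \<subseteq> {i}"
      by (rule partn_lstE[OF N]) (auto simp: nth_replicate simp del: replicate_Suc)
    have H: "H \<subseteq> {..<N}" "card H = m" using iH(2) by (auto simp: nsets_def)
    have "inj_on u H" using u H by (meson bij_betw_def inj_on_subset)
    have eq: "h (col e) = i" if e: "e \<in> [u ` H]\<^bsup>2\<^esup>" for e
    proof -
      obtain e' where "e' \<in> [H]\<^bsup>2\<^esup>" "e = u ` e'"
        using e \<open>inj_on u H\<close> by (rule nset_image_obtains)
      then show ?thesis using iH(3) by blast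
    qed
    have sub: "u ` H \<subseteq> V" using H(1) u W(1) by (auto simp: bij_betw_def)
    have "col e = col e'" if "e \<in> [u ` H]\<^bsup>2\<^esup>" "e' \<in> [u ` H]\<^bsup>2\<^esup>" for e e'
    proof -
      have "e \<in> [V]\<^bsup>2\<^esup>" "e' \<in> [V]\<^bsup>2\<^esup>" using that nsets_mono[OF sub] by blast+
      then show ?thesis using eq that h(1) by (metis image_eqI inj_onD)
    qed
    then have "\<exists>c. \<forall>e\<in>[u ` H]\<^bsup>2\<^esup>. col e = c" by blast
    then show "\<exists>Y\<subseteq>V. card Y = m \<and> (\<exists>c. \<forall>e\<in>[Y]\<^bsup>2\<^esup>. col e = c)"
      using sub H(2) card_image[OF \<open>inj_on u H\<close>] by metis
  qed
qed

text \<open>Energy increment. In the application \<open>q i P\<close> is the probability that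
  \<open>i\<close> has no neighbour in \<open>P\<close>, summed over two layers; its drop when
  \<open>j\<close> joins \<open>P\<close> is the probability that the edge from \<open>i\<close> to
  \<open>j\<close> is present although \<open>i\<close> misses \<open>P\<close>. If a
  Ramsey-homogeneous set has large drops in one direction, its extreme element lowers the potential
  of all its other vertices by more than \<eta>, and a potential of at most k \<eta> survives this
  at most k times. \<open>N\<close> is chosen before \<open>q\<close>.\<close>

lemma sampling_set_exists:
  fixes \<eta> :: real
  assumes "\<eta> > 0"
  shows "\<exists>N. \<forall>(V::nat set) (P0::nat set) (q :: nat \<Rightarrow> nat set \<Rightarrow> real).
           finite V \<and> card V \<ge> N \<and> V \<inter> P0 = {} \<and> finite P0 \<and> (\<forall>i P. 0 \<le> q i P) \<and>
           (\<forall>i\<in>V. q i P0 \<le> real k * \<eta>) \<longrightarrow>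
           (\<exists>P Z. P \<subseteq> P0 \<union> V \<and> Z \<subseteq> V \<and> P \<inter> Z = {} \<and> finite P \<and> card P \<le> card P0 + k \<and> card Z = m \<and>
              (\<forall>i\<in>Z. \<forall>j\<in>Z. i \<noteq> j \<longrightarrow> q i P - q i (insert j P) \<le> \<eta>))"
  (is "\<exists>N. ?Q k N")
proof (induction k)
  case 0
  show ?case
  proof (intro exI[of _ m] allI impI, elim conjE)
    fix V P0 :: "nat set" and q :: "nat \<Rightarrow> nat set \<Rightarrow> real"
    assume *: "finite V" "m \<le> card V" "V \<inter> P0 = {}" "finite P0" "\<forall>i P. 0 \<le> q i P" "\<forall>i\<in>V. q i P0 \<le> real 0 * \<eta>"
    obtain Z where Z: "Z \<subseteq> V" "card Z = m" using * obtain_subset_with_card_n by metis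
    \<comment> \<open>The budget is exhausted: q i P0 \<le> 0, and non-negativity leaves no room for
      a drop.\<close>
    have "q i P0 - q i (insert j P0) \<le> \<eta>" if "i \<in> Z" for i j
      using *(5)[rule_format, of i "insert j P0"] *(6) that Z assms by fastforce
    then show "\<exists>P Z. P \<subseteq> P0 \<union> V \<and> Z \<subseteq> V \<and> P \<inter> Z = {} \<and> finite P \<and> card P \<le> card P0 + 0 \<and> card Z = m \<and>
              (\<forall>i\<in>Z. \<forall>j\<in>Z. i \<noteq> j \<longrightarrow> q i P - q i (insert j P) \<le> \<eta>)"
      using Z * by (intro exI[of _ P0] exI[of _ Z]) auto
  qed
next
  case (Suc k)
  then obtain N where N: "?Q k N" by blast
  obtain R where R: "\<forall>(V::nat set) (col :: nat set \<Rightarrow> bool \<times> bool). finite V \<and> card V \<ge> R \<and>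
           finite (col ` [V]\<^bsup>2\<^esup>) \<and> card (col ` [V]\<^bsup>2\<^esup>) \<le> 4 \<longrightarrow>
           (\<exists>Y\<subseteq>V. card Y = Suc N + m \<and> (\<exists>c. \<forall>e\<in>[Y]\<^bsup>2\<^esup>. col e = c))"
    using Ramsey_pairs[where m = "Suc N + m" and r = 4 and 'c = "bool \<times> bool"] ..
  show ?case
  proof (intro exI[of _ R] allI impI, elim conjE)
    fix V P0 :: "nat set" and q :: "nat \<Rightarrow> nat set \<Rightarrow> real"
    assume V: "finite V" "R \<le> card V" "V \<inter> P0 = {}" "finite P0" and q0: "\<forall>i P. 0 \<le> q i P"
      and q: "\<forall>i\<in>V. q i P0 \<le> real (Suc k) * \<eta>"
    define d where "d i j = (q i P0 - q i (insert j P0) \<le> \<eta>)" for i j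
    \<comment> \<open>The drop is not symmetric in \<open>i\<close> and \<open>j\<close>, so the
      colour stores both directions, told apart by the order of the two numbers.\<close>
    define col where "col e = (d (Min e) (Max e), d (Max e) (Min e))" for e
    have "card (col ` [V]\<^bsup>2\<^esup>) \<le> card (UNIV :: (bool \<times> bool) set)"
      by (intro card_mono) auto
    also have "\<dots> = 4" by (simp add: UNIV_Times_UNIV[symmetric] card_cartesian_product del: UNIV_Times_UNIV)
    finally have "card (col ` [V]\<^bsup>2\<^esup>) \<le> 4" .
    moreover have "finite (col ` [V]\<^bsup>2\<^esup>)" using V finite_imp_finite_nsets by blast
    ultimately obtain Y c where Y: "Y \<subseteq> V" "card Y = Suc N + m" and c: "\<forall>e\<in>[Y]\<^bsup>2\<^esup>. col e = c"
      using R[rule_format, of V col] V by blast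
    have finY: "finite Y" "Y \<noteq> {}" using Y V finite_subset by auto
    have dd: "d i j = fst c \<and> d j i = snd c" if "i \<in> Y" "j \<in> Y" "i < j" for i j
    proof -
      have "{i,j} \<in> [Y]\<^bsup>2\<^esup>" using that by auto
      then have "col {i,j} = c" using c by blast
      moreover have "Min {i,j} = i" "Max {i,j} = j" using that by auto
      ultimately show ?thesis by (auto simp: col_def)
    qed
    let ?G = "\<exists>P Z. P \<subseteq> P0 \<union> V \<and> Z \<subseteq> V \<and> P \<inter> Z = {} \<and> finite P \<and> card P \<le> card P0 + Suc k \<and> card Z = m \<and>
              (\<forall>i\<in>Z. \<forall>j\<in>Z. i \<noteq> j \<longrightarrow> q i P - q i (insert j P) \<le> \<eta>)"
    have shrink: ?G if j: "j \<in> Y" and nd: "\<forall>i\<in>Y - {j}. \<not> d i j" for j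
    proof -
      have "q i (insert j P0) \<le> real k * \<eta>" if "i \<in> Y - {j}" for i
      proof -
        have "q i P0 \<le> real (Suc k) * \<eta>" using q that Y by blast
        moreover have "q i P0 - q i (insert j P0) > \<eta>" using nd that unfolding d_def by (meson not_le)
        ultimately show ?thesis by (simp add: algebra_simps)
      qed
      moreover have "finite (Y - {j})" "N \<le> card (Y - {j})" "(Y - {j}) \<inter> insert j P0 = {}"
          "finite (insert j P0)"
        using finY Y V j by (auto simp: card_Diff_singleton)
      ultimately obtain P Z where PZ: "P \<subseteq> insert j P0 \<union> (Y - {j})" "Z \<subseteq> Y - {j}" "P \<inter> Z = {}" "finite P"
          "card P \<le> card (insert j P0) + k" "card Z = m"
          "\<forall>i\<in>Z. \<forall>j\<in>Z. i \<noteq> j \<longrightarrow> q i P - q i (insert j P) \<le> \<eta>"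
        using N[rule_format, of "Y - {j}" "insert j P0" q] q0 by blast
      have "card (insert j P0) \<le> Suc (card P0)" using V by (simp add: card_insert_if)
      then have "card P \<le> card P0 + Suc k" using PZ(5) by simp
      then show ?thesis using PZ Y j by (intro exI[of _ P] exI[of _ Z]) auto
    qed
    show ?G
    proof (cases "fst c \<and> snd c")
      case True
      obtain Z where Z: "Z \<subseteq> Y" "card Z = m" using Y obtain_subset_with_card_n by (metis le_add2)
      have "d i j" if "i \<in> Z" "j \<in> Z" "i \<noteq> j" for i j
        using dd[of i j] dd[of j i] that Z True by (metis nat_neq_iff subsetD)
      then show ?thesis using Z Y V unfolding d_def
        by (intro exI[of _ P0] exI[of _ Z]) auto
    next
      case False
      then consider "\<not> fst c" | "\<not> snd c" by blast
      then show ?thesis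
      proof cases
        case 1
        \<comment> \<open>Every pair i < j of \<open>Y\<close> has a large drop of the potential of
          \<open>i\<close> when \<open>j\<close> is added, so the largest element works against all
          others. In the mirrored case it is the smallest.\<close>
        have "\<forall>i\<in>Y - {Max Y}. \<not> d i (Max Y)"
          using dd 1 finY by (metis Diff_iff Max_ge Max_in insertI1 le_neq_implies_less singletonD singletonI)
        then show ?thesis using shrink[of "Max Y"] finY Max_in by blast
      next
        case 2
        have "\<forall>i\<in>Y - {Min Y}. \<not> d i (Min Y)"
          using dd 2 finY by (metis Diff_iff Min_le Min_in insertI1 le_neq_implies_less singletonD singletonI)
        then show ?thesis using shrink[of "Min Y"] finY Min_in by blast
      qed
    qed
  qed
qed

text \<open>A colour is the whole table of rounded values for \<open>T\<close> ranging over the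
  subsets of \<open>A\<close>, hence at most (L + 1)^(2^k) colours, and a single application of
  Ramsey serves all \<open>T\<close>. Rounding to multiples of 1 / L costs at most 1 / L \<le>
  \<eta>.\<close>

lemma gram_homogeneous_subset:
  fixes \<eta> :: real
  assumes "\<eta> > 0"
  shows "\<exists>N. \<forall>(V::nat set) (A :: nat set) (\<alpha> :: nat set \<Rightarrow> nat \<Rightarrow> nat \<Rightarrow> real).
           finite V \<and> card V \<ge> N \<and> finite A \<and> card A \<le> k \<and>
           (\<forall>T i j. 0 \<le> \<alpha> T i j \<and> \<alpha> T i j \<le> 1) \<and> (\<forall>T i j. \<alpha> T i j = \<alpha> T j i) \<longrightarrow>
           (\<exists>Z\<subseteq>V. card Z = m \<and> (\<exists>c. \<forall>T\<subseteq>A. \<forall>i\<in>Z. \<forall>j\<in>Z. i \<noteq> j \<longrightarrow> \<bar>\<alpha> T i j - c T\<bar> \<le> \<eta>))"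
proof -
  define L where "L = nat \<lceil>1 / \<eta>\<rceil>"
  have L: "real L * \<eta> \<ge> 1" "L > 0"
  proof -
    have "real L \<ge> 1 / \<eta>" unfolding L_def by linarith
    then show "real L * \<eta> \<ge> 1" using assms by (simp add: field_simps)
    then show "L > 0" by (cases L) auto
  qed
  obtain N where N: "\<forall>(V::nat set) (col :: nat set \<Rightarrow> (nat set \<Rightarrow> nat)). finite V \<and> card V \<ge> N \<and>
           finite (col ` [V]\<^bsup>2\<^esup>) \<and> card (col ` [V]\<^bsup>2\<^esup>) \<le> (Suc L) ^ (2 ^ k) \<longrightarrow>
           (\<exists>Y\<subseteq>V. card Y = m \<and> (\<exists>c. \<forall>e\<in>[Y]\<^bsup>2\<^esup>. col e = c))"
    using Ramsey_pairs[where m = m and r = "(Suc L) ^ (2 ^ k)" and 'c = "nat set \<Rightarrow> nat"] ..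
  show ?thesis
  proof (intro exI[of _ N] allI impI, elim conjE)
    fix V A :: "nat set" and \<alpha> :: "nat set \<Rightarrow> nat \<Rightarrow> nat \<Rightarrow> real"
    assume V: "finite V" "N \<le> card V" "finite A" "card A \<le> k"
      and \<alpha>: "\<forall>T i j. 0 \<le> \<alpha> T i j \<and> \<alpha> T i j \<le> 1" and sym: "\<forall>T i j. \<alpha> T i j = \<alpha> T j i"
    define col where "col e = (\<lambda>T\<in>Pow A. nat \<lfloor>real L * \<alpha> T (Min e) (Max e)\<rfloor>)" for e
    have rng: "col e \<in> Pow A \<rightarrow>\<^sub>E {..L}" for e
    proof -
      have "nat \<lfloor>real L * \<alpha> T (Min e) (Max e)\<rfloor> \<le> L" for T
      proof -
        have "real L * \<alpha> T (Min e) (Max e) \<le> real L * 1" using \<alpha> by (intro mult_left_mono) auto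
        then show ?thesis by linarith
      qed
      then show ?thesis by (auto simp: col_def)
    qed
    have fin: "finite (Pow A \<rightarrow>\<^sub>E {..L})" using V by (intro finite_PiE) auto
    have "card (col ` [V]\<^bsup>2\<^esup>) \<le> card (Pow A \<rightarrow>\<^sub>E {..L})" using rng fin by (intro card_mono) auto
    also have "\<dots> = (Suc L) ^ (2 ^ card A)" using V by (simp add: card_PiE card_Pow)
    also have "\<dots> \<le> (Suc L) ^ (2 ^ k)" using V by (intro power_increasing) auto
    finally obtain Y c where Y: "Y \<subseteq> V" "card Y = m" and c: "\<forall>e\<in>[Y]\<^bsup>2\<^esup>. col e = c"
      using N[rule_format, of V col] V finite_imp_finite_nsets by blast
    have *: "\<bar>\<alpha> T i j - real (c T) / real L\<bar> \<le> \<eta>" if "T \<subseteq> A" "i \<in> Y" "j \<in> Y" "i < j" for T i j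
    proof -
      have "{i,j} \<in> [Y]\<^bsup>2\<^esup>" using that by auto
      then have "col {i,j} = c" using c by blast
      moreover have "Min {i,j} = i" "Max {i,j} = j" using that by auto
      ultimately have "c T = nat \<lfloor>real L * \<alpha> T i j\<rfloor>" using that by (auto simp: col_def)
      moreover have "0 \<le> real L * \<alpha> T i j" using \<alpha> by simp
      ultimately have 1: "real (c T) \<le> real L * \<alpha> T i j" "real L * \<alpha> T i j \<le> real (c T) + 1"
        by linarith+
      have "\<bar>\<alpha> T i j - real (c T) / real L\<bar> \<le> 1 / real L"
        using 1 L(2) by (simp add: abs_le_iff divide_simps mult.commute)
      also have "\<dots> \<le> \<eta>" using L by (simp add: field_simps)
      finally show ?thesis .
    qed
    have "\<bar>\<alpha> T i j - real (c T) / real L\<bar> \<le> \<eta>" if "T \<subseteq> A" "i \<in> Y" "j \<in> Y" "i \<noteq> j" for T i j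
      using *[of T i j] *[of T j i] that sym by (cases "i < j") auto
    then show "\<exists>Z\<subseteq>V. card Z = m \<and> (\<exists>c. \<forall>T\<subseteq>A. \<forall>i\<in>Z. \<forall>j\<in>Z. i \<noteq> j \<longrightarrow> \<bar>\<alpha> T i j - c T\<bar> \<le> \<eta>)"
      using Y by (intro exI[of _ Y] conjI exI[of _ "\<lambda>T. real (c T) / real L"]) auto
  qed
qed

text \<open>The region is a sliver along the x-axis between the circle of radius sqrt q and the line
  x + y = 1. If the first vector is the one closer to the axis, the angle between the two is at most
  the angle of the second with the axis, so the scalar product is at least the norm of the first
  times the first coordinate of the second. These factors are at least sqrt 3 - 1 and (3 - sqrt 3) /
  2, with product 2 sqrt 3 - 3; strictness enters when this is compared with 1 - q.\<close>

lemma region_dot: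
  fixes x y x' y' q :: real
  assumes q: "q > 4 - 2 * sqrt 3"
    and u: "0 \<le> y" "y \<le> x" "x + y \<le> 1" "x\<^sup>2 + y\<^sup>2 \<ge> q"
    and v: "0 \<le> y'" "y' \<le> x'" "x' + y' \<le> 1" "x'\<^sup>2 + y'\<^sup>2 \<ge> q"
  shows "x * x' + y * y' > 1 - q"
proof -
  define s :: real where "s = sqrt 3"
  have s2: "s * s = 3" and s0: "0 \<le> s" by (simp_all add: s_def)
  have s: "1.7 < s" "s < 1.75"
  proof -
    show "1.7 < s" unfolding s_def by (rule real_less_rsqrt) (simp add: power2_eq_square)
    show "s < 1.75" unfolding s_def by (rule real_less_lsqrt) (simp_all add: power2_eq_square)
  qed
  have main: "a * a' + b * b' > 1 - q"
    if u: "0 \<le> b" "b \<le> a" "a + b \<le> 1" "a\<^sup>2 + b\<^sup>2 \<ge> q"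
    and v: "0 \<le> b'" "b' \<le> a'" "a' + b' \<le> 1" "a'\<^sup>2 + b'\<^sup>2 \<ge> q"
    and cr: "b * a' \<le> a * b'" for a b a' b'
  proof -
    have a0: "0 \<le> a" "0 \<le> a'" using u v by linarith+
    \<comment> \<open>4 - 2 sqrt 3 is the square of sqrt 3 - 1.\<close>
    have n: "(s - 1)\<^sup>2 \<le> a\<^sup>2 + b\<^sup>2"
      using u q s2 by (simp add: power2_eq_square algebra_simps s_def)
    have "a'\<^sup>2 + b'\<^sup>2 \<le> a' * (a' + b')"
      using v a0 mult_right_mono[of b' a' b'] by (simp add: power2_eq_square algebra_simps)
    also have "\<dots> \<le> a' * 1" using v a0 by (intro mult_left_mono) auto
    finally have "a' \<ge> q" using v by linarith
    then have half: "a' > 1/2" using q s by (simp add: s_def)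
    have "b'\<^sup>2 \<le> (1 - a')\<^sup>2" using v by (intro power_mono) auto
    \<comment> \<open>Replacing b' by its bound 1 - a' gives 2 q - 1 \<le> (2 a' - 1)^2, and 7 - 4
      sqrt 3 is the square of 2 - sqrt 3. The fact \<open>half\<close> then selects the positive
      root.\<close>
    then have "(2 * a' - 1)\<^sup>2 \<ge> (2 - s)\<^sup>2"
      using v q s2 by (simp add: power2_eq_square algebra_simps s_def)
    then have t: "2 * a' - 1 \<ge> 2 - s"
      using half power2_le_imp_le[of "2 - s" "2 * a' - 1"] by simp
    \<comment> \<open>The comparison of angles in squared form: the bracket is non-negative because
      \<open>cr\<close> says that the first vector has the smaller slope.\<close>
    have sq: "(a * a' + b * b')\<^sup>2 - ((a\<^sup>2 + b\<^sup>2) * a'\<^sup>2) = b * (2 * (a * b') * a' + b * b' * b' - b * a' * a')"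
      by (simp add: power2_eq_square algebra_simps)
    have "b * a' * a' \<le> a * b' * a'" using cr a0 by (intro mult_right_mono) auto
    moreover have "0 \<le> a * b' * a'" "0 \<le> b * b' * b'" using u v a0 by auto
    ultimately have "0 \<le> 2 * (a * b') * a' + b * b' * b' - b * a' * a'" by linarith
    then have "0 \<le> b * (2 * (a * b') * a' + b * b' * b' - b * a' * a')" using u(1) by simp
    with sq have "(a * a' + b * b')\<^sup>2 \<ge> (a\<^sup>2 + b\<^sup>2) * a'\<^sup>2" by linarith
    moreover have "(a\<^sup>2 + b\<^sup>2) * a'\<^sup>2 \<ge> ((s - 1) * a')\<^sup>2"
      using n by (simp add: power_mult_distrib mult_right_mono)
    ultimately have "((s - 1) * a')\<^sup>2 \<le> (a * a' + b * b')\<^sup>2" by linarith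
    moreover have "0 \<le> a * a' + b * b'" using u(1) v(1) a0 by simp
    ultimately have "a * a' + b * b' \<ge> (s - 1) * a'" by (rule power2_le_imp_le)
    moreover have "(s - 1) * a' \<ge> (s - 1) * ((3 - s) / 2)"
      using s t by (intro mult_left_mono) auto
    moreover have "(s - 1) * ((3 - s) / 2) = 2 * s - 3" using s2 by (simp add: field_simps)
    moreover have "q > 4 - 2 * s" using q by (simp add: s_def)
    ultimately show ?thesis by linarith
  qed
  show ?thesis
  proof (cases "y * x' \<le> x * y'")
    case True then show ?thesis using main u v by blast
  next
    case False
    then have "y' * x \<le> x' * y" by (simp add: mult.commute)
    then have "x' * x + y' * y > 1 - q" using main u v by blast
    then show ?thesis by (simp add: mult.commute)
  qed
qed

section \<open>Components and densities of a single layer\<close>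

definition comp_in :: "nat \<Rightarrow> (nat \<Rightarrow> nat \<Rightarrow> bool) \<Rightarrow> nat \<Rightarrow> nat set" where
  "comp_in n g i = {j. (\<lambda>a b. a < n \<and> b < n \<and> g a b)\<^sup>*\<^sup>* i j}"

text \<open>A property of vertices. Demanding more than half of the layer makes the component
  unique, so all giant vertices are interchangeable.\<close>

definition giant :: "nat \<Rightarrow> (nat \<Rightarrow> nat \<Rightarrow> bool) \<Rightarrow> nat \<Rightarrow> bool" where
  "giant n g i \<longleftrightarrow> i < n \<and> n < 2 * card (comp_in n g i)"

definition edge_constant :: "nat \<Rightarrow> (nat \<Rightarrow> nat \<Rightarrow> bool) \<Rightarrow> (nat \<Rightarrow> bool) \<Rightarrow> bool" where
  "edge_constant n g c \<longleftrightarrow> (\<forall>i<n. \<forall>j<n. g i j \<longrightarrow> c i = c j)"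

text \<open>Connection of the giants is stated dually, through two-colourings that are constant
  along layer edges and along \<open>h\<close>. This spares paths in the union of the layers: a
  failure hands over the very classes that the density argument needs, and a success is exploited by
  plugging in the colouring "reachable from a given vertex". Existence of both giants is included so
  that the universal part cannot hold vacuously.\<close>

definition linked :: "nat \<Rightarrow> (nat \<Rightarrow> nat \<Rightarrow> bool) \<Rightarrow> (nat \<Rightarrow> nat \<Rightarrow> bool) \<Rightarrow> (nat \<Rightarrow> bool) \<Rightarrow> bool" where
  "linked n g0 g1 h \<longleftrightarrow> (\<exists>i. giant n g0 i) \<and> (\<exists>j. giant n g1 j) \<and>
     (\<forall>c0 c1 i j. edge_constant n g0 c0 \<and> edge_constant n g1 c1 \<and> (\<forall>k<n. h k \<longrightarrow> c0 k = c1 k) \<and>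
        giant n g0 i \<and> giant n g1 j \<longrightarrow> c0 i = c1 j)"

lemma comp_in_subset: "i < n \<Longrightarrow> comp_in n g i \<subseteq> {..<n}"
proof
  fix j assume "i < n" "j \<in> comp_in n g i"
  then have "(\<lambda>a b. a < n \<and> b < n \<and> g a b)\<^sup>*\<^sup>* i j" by (simp add: comp_in_def)
  then show "j \<in> {..<n}" using \<open>i < n\<close> by (induction rule: rtranclp_induct) auto
qed

lemma comp_in_self: "i \<in> comp_in n g i"
  by (simp add: comp_in_def)

lemma comp_in_eq:
  assumes "symp g" "j \<in> comp_in n g i"
  shows "comp_in n g j = comp_in n g i"
proof -
  have "symp (\<lambda>a b. a < n \<and> b < n \<and> g a b)" using assms(1) by (auto simp: symp_def)
  then have "symp (\<lambda>a b. a < n \<and> b < n \<and> g a b)\<^sup>*\<^sup>*" by (rule symp_rtranclp)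
  then show ?thesis using assms(2) unfolding comp_in_def
    by (auto dest: sympD intro: rtranclp_trans)
qed

lemma comp_in_edge_constant:
  assumes "edge_constant n g c" "j \<in> comp_in n g i"
  shows "c j = c i"
proof -
  have "(\<lambda>a b. a < n \<and> b < n \<and> g a b)\<^sup>*\<^sup>* i j" using assms by (simp add: comp_in_def)
  then show ?thesis using assms(1) by (induction rule: rtranclp_induct) (auto simp: edge_constant_def)
qed

lemma giant_comp_in_eq:
  assumes "symp g" "giant n g i" "giant n g j"
  shows "comp_in n g i = comp_in n g j"
proof -
  have sub: "comp_in n g i \<subseteq> {..<n}" "comp_in n g j \<subseteq> {..<n}"
    using assms comp_in_subset by (auto simp: giant_def)
  have "comp_in n g i \<inter> comp_in n g j \<noteq> {}"
  proof
    assume "comp_in n g i \<inter> comp_in n g j = {}"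
    then have "card (comp_in n g i) + card (comp_in n g j) = card (comp_in n g i \<union> comp_in n g j)"
      using sub by (subst card_Un_disjoint) (auto intro: finite_subset)
    also have "\<dots> \<le> card {..<n}" using sub by (intro card_mono) auto
    finally show False using assms by (auto simp: giant_def)
  qed
  then show ?thesis using comp_in_eq[OF assms(1)] by blast
qed

lemma card_pairs:
  assumes "finite A" "finite B"
  shows "card {(i, j) \<in> A \<times> B. R i j} = (\<Sum>i\<in>A. card {j\<in>B. R i j})"
proof -
  have "{(i, j) \<in> A \<times> B. R i j} = Sigma A (\<lambda>i. {j\<in>B. R i j})" by auto
  then show ?thesis using assms by simp
qed

text \<open>The number of ordered edge pairs is at most the sum over all vertices of the size of
  their component. So some component has density a \<ge> q; all others live in the remaining
  fraction 1 - a, which bounds that sum by (a^2 + (1 - a)^2) n^2.\<close>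

lemma giant_exists:
  fixes q :: real
  assumes sym: "symp g" and n: "n > 0" and q: "q > 1/2"
    and edges: "real (card {(i, j) \<in> {..<n} \<times> {..<n}. g i j}) \<ge> q * (real n)\<^sup>2"
  shows "\<exists>i. giant n g i \<and> (let a = card (comp_in n g i) / n in 1/2 \<le> a \<and> q \<le> a\<^sup>2 + (1 - a)\<^sup>2)"
proof -
  let ?C = "comp_in n g"
  have deg: "{j\<in>{..<n}. g i j} \<subseteq> ?C i" if "i < n" for i
    using that by (auto simp: comp_in_def)
  have fin: "finite (?C i)" "card (?C i) \<le> n" if "i < n" for i
    using comp_in_subset[OF that, of g] by (auto intro: finite_subset dest: card_mono[rotated])
  have "q * (real n)\<^sup>2 \<le> real (\<Sum>i<n. card {j\<in>{..<n}. g i j})"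
    using edges by (subst card_pairs[symmetric]) auto
  also have "\<dots> \<le> real (\<Sum>i<n. card (?C i))"
    using deg fin by (intro of_nat_mono sum_mono card_mono) auto
  finally have sumC: "q * (real n)\<^sup>2 \<le> (\<Sum>i<n. real (card (?C i)))" by simp
  have "\<exists>i<n. real (card (?C i)) \<ge> q * n"
  proof (rule ccontr)
    assume "\<not> ?thesis"
    then have "(\<Sum>i<n. real (card (?C i))) < (\<Sum>i<n. q * n)" using n by (intro sum_strict_mono) auto
    then show False using sumC by (simp add: power2_eq_square mult_ac)
  qed
  then obtain i where i: "i < n" "real (card (?C i)) \<ge> q * n" by blast
  define a where "a = card (?C i) / n"
  have an: "real (card (?C i)) = a * n" using n by (simp add: a_def)
  have a: "q \<le> a" using i n by (simp add: a_def field_simps)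
  have other: "real (card (?C j)) \<le> (1 - a) * n" if "j < n" "j \<notin> ?C i" for j
  proof -
    have "?C j \<inter> ?C i = {}"
    proof (rule ccontr)
      assume "?C j \<inter> ?C i \<noteq> {}"
      then have "?C j = ?C i" using comp_in_eq[OF sym] by blast
      then show False using comp_in_self that(2) by blast
    qed
    then have "?C j \<subseteq> {..<n} - ?C i" using comp_in_subset[OF that(1), of g] by blast
    then have "card (?C j) \<le> card ({..<n} - ?C i)" by (intro card_mono) auto
    also have "\<dots> = n - card (?C i)"
      using comp_in_subset[OF i(1), of g] fin[OF i(1)] by (subst card_Diff_subset) auto
    finally have "card (?C j) \<le> n - card (?C i)" .
    then have "real (card (?C j)) \<le> real n - real (card (?C i))" using fin[OF i(1)] by linarith
    then show ?thesis using an by (simp add: algebra_simps)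
  qed
  have split: "{..<n} = ?C i \<union> ({..<n} - ?C i)" using comp_in_subset[OF i(1), of g] by blast
  have "(\<Sum>j<n. real (card (?C j))) = (\<Sum>j\<in>?C i. real (card (?C j))) + (\<Sum>j\<in>{..<n} - ?C i. real (card (?C j)))"
    by (subst split, subst sum.union_disjoint) (use fin i in auto)
  also have "(\<Sum>j\<in>?C i. real (card (?C j))) = (\<Sum>j\<in>?C i. a * n)"
    using comp_in_eq[OF sym, where n = n and i = i] an by (intro sum.cong) auto
  also have "\<dots> = (a * n) * (a * n)" using an by simp
  also have "(\<Sum>j\<in>{..<n} - ?C i. real (card (?C j))) \<le> (\<Sum>j\<in>{..<n} - ?C i. (1 - a) * n)"
    using other by (intro sum_mono) auto
  also have "\<dots> = real (card ({..<n} - ?C i)) * ((1 - a) * n)" by simp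
  also have "real (card ({..<n} - ?C i)) = (1 - a) * n"
    using comp_in_subset[OF i(1), of g] fin[OF i(1)] an
    by (subst card_Diff_subset) (auto simp: algebra_simps of_nat_diff)
  finally have "q * (real n)\<^sup>2 \<le> (a\<^sup>2 + (1 - a)\<^sup>2) * (real n)\<^sup>2"
    using sumC by (simp add: power2_eq_square algebra_simps)
  then have "q \<le> a\<^sup>2 + (1 - a)\<^sup>2" using n by (simp add: mult_le_cancel_right)
  moreover have "giant n g i"
  proof -
    have "a * n > 1/2 * n" using a q n by (intro mult_strict_right_mono) auto
    then have "2 * real (card (?C i)) > n" using an by simp
    then show ?thesis using i by (auto simp: giant_def)
  qed
  moreover have "1/2 \<le> a" using a q by linarith
  ultimately show ?thesis unfolding Let_def a_def by blast
qed

text \<open>\<open>Z\<close> is split into the vertices with a neighbour of class \<open>c\<close>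
  in \<open>P\<close>, those with a neighbour of the other class, and those missing
  \<open>P\<close>. Up to the few missed pairs, edges inside \<open>Z\<close> stay within one of the
  first two parts, which gives q \<le> x^2 + y^2. The edges from \<open>Z\<close> to the whole layer
  give y \<le> x: they force the majority seen in the sample to be the majority of the
  layer.\<close>

lemma layer_region:
  fixes q \<delta> :: real
  assumes q: "q > 4 - 2 * sqrt 3"
    and sym: "symp g" and c: "edge_constant n g c"
    and Z: "Z \<subseteq> {..<n}" "Z \<noteq> {}" and P: "P \<subseteq> {..<n}"
    and edges: "real (card {(i, j) \<in> Z \<times> Z. g i j}) \<ge> (q + 2 * \<delta>) * (real (card Z))\<^sup>2"
    and missed: "real (card {(i, j) \<in> Z \<times> Z. g i j \<and> (\<forall>t\<in>P. \<not> g i t)}) \<le> \<delta> * (real (card Z))\<^sup>2"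
    and cross: "real (card {(i, j) \<in> Z \<times> {..<n}. g i j}) \<ge> q * real (card Z) * real n"
    and a: "real (card {i. i < n \<and> c i}) = a * n" "1/2 \<le> a" "q \<le> a\<^sup>2 + (1 - a)\<^sup>2"
    and x: "real (card {i\<in>Z. \<exists>t\<in>P. c t \<and> g i t}) = x * real (card Z)"
    and y: "real (card {i\<in>Z. \<exists>t\<in>P. \<not> c t \<and> g i t}) = y * real (card Z)"
  shows "0 \<le> y \<and> y \<le> x \<and> x + y \<le> 1 \<and> q \<le> x\<^sup>2 + y\<^sup>2"
proof -
  define X where "X = {i\<in>Z. \<exists>t\<in>P. c t \<and> g i t}"
  define Y where "Y = {i\<in>Z. \<exists>t\<in>P. \<not> c t \<and> g i t}"
  define U where "U = {i\<in>Z. \<forall>t\<in>P. \<not> g i t}"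
  define m where "m = real (card Z)"
  have finZ: "finite Z" using Z finite_subset by blast
  then have m: "m > 0" using Z by (simp add: m_def card_gt_0_iff)
  have n: "n > 0" using Z by auto
  have cX: "c i" if iX: "i \<in> X" for i
  proof -
    obtain t where "t \<in> P" "c t" "g i t" "i \<in> Z" using iX by (auto simp: X_def)
    then show ?thesis using c P Z unfolding edge_constant_def by (metis lessThan_iff subsetD)
  qed
  have cY: "\<not> c i" if iY: "i \<in> Y" for i
  proof -
    obtain t where "t \<in> P" "\<not> c t" "g i t" "i \<in> Z" using iY by (auto simp: Y_def)
    then show ?thesis using c P Z unfolding edge_constant_def by (metis lessThan_iff subsetD)
  qed
  have part: "Z = X \<union> Y \<union> U" "X \<inter> Y = {}" "(X \<union> Y) \<inter> U = {}"
    subgoal unfolding X_def Y_def U_def by blast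
    subgoal using cX cY by blast
    subgoal unfolding X_def Y_def U_def by blast
    done
  have fin: "finite X" "finite Y" "finite U" using finZ by (auto simp: X_def Y_def U_def)
  have xm: "real (card X) = x * m" and ym: "real (card Y) = y * m"
    using x y unfolding X_def Y_def m_def by blast+
  have "0 \<le> x * m" "0 \<le> y * m" unfolding xm[symmetric] ym[symmetric] by simp_all
  then have x0: "0 \<le> x" "0 \<le> y" using m by (simp_all add: zero_le_mult_iff)
  have "card (X \<union> Y \<union> U) = card (X \<union> Y) + card U" using part fin by (intro card_Un_disjoint) auto
  also have "card (X \<union> Y) = card X + card Y" using part fin by (intro card_Un_disjoint) auto
  finally have "card Z = card X + card Y + card U" using part(1) by simp
  then have "m = real (card X) + real (card Y) + real (card U)" by (simp add: m_def)
  then have um: "real (card U) = (1 - x - y) * m" unfolding xm ym by (simp add: left_diff_distrib)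
  then have "0 \<le> (1 - x - y) * m" by (metis of_nat_0_le_iff)
  then have xy1: "x + y \<le> 1" using m by (simp add: zero_le_mult_iff)
  \<comment> \<open>A missed pair is recorded by its first endpoint only, so the reflected set is
    added; this is the factor 2 in the margin q + 2 \<delta>.\<close>
  have "{(i, j) \<in> Z \<times> Z. g i j} \<subseteq> (X \<times> X \<union> Y \<times> Y) \<union>
      ({(i, j) \<in> Z \<times> Z. g i j \<and> (\<forall>t\<in>P. \<not> g i t)} \<union>
       prod.swap ` {(i, j) \<in> Z \<times> Z. g i j \<and> (\<forall>t\<in>P. \<not> g i t)})" (is "?L \<subseteq> ?A \<union> (?B \<union> ?B')")
  proof
    fix e assume "e \<in> ?L"
    then obtain i j where e: "e = (i, j)" "i \<in> Z" "j \<in> Z" "g i j" by auto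
    then have "c i = c j" using c Z by (auto simp: edge_constant_def)
    show "e \<in> ?A \<union> (?B \<union> ?B')"
    proof (cases "i \<in> U \<or> j \<in> U")
      case True
      have "g j i" using e sym by (meson sympD)
      then have "(j, i) \<in> ?B \<or> (i, j) \<in> ?B" using True e unfolding U_def by blast
      moreover have "e \<in> ?B'" if "(j, i) \<in> ?B" using imageI[OF that, of prod.swap] e(1) by simp
      ultimately show ?thesis using e(1) by blast
    next
      case False
      then have "i \<in> X \<union> Y" "j \<in> X \<union> Y" using e part(1) by blast+
      then show ?thesis using \<open>c i = c j\<close> cX cY unfolding e(1) by blast
    qed
  qed
  moreover have finB: "finite ?B" by (rule finite_subset[of _ "Z \<times> Z"]) (use finZ in auto)
  ultimately have "card ?L \<le> card (?A \<union> (?B \<union> ?B'))"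
    using fin by (intro card_mono) auto
  also have "\<dots> \<le> card (X \<times> X) + card (Y \<times> Y) + (card ?B + card ?B)"
    using card_Un_le[of ?A "?B \<union> ?B'"] card_Un_le[of ?B ?B'] card_Un_le[of "X \<times> X" "Y \<times> Y"]
      card_image_le[OF finB, of prod.swap] by linarith
  finally have "real (card ?L) \<le> real (card X) * real (card X) + real (card Y) * real (card Y) + 2 * real (card ?B)"
    by (simp add: card_cartesian_product flip: of_nat_mult of_nat_add)
  then have "real (card ?L) \<le> (x * m) * (x * m) + (y * m) * (y * m) + 2 * real (card ?B)"
    by (simp only: xm ym)
  also have "\<dots> \<le> (x * m) * (x * m) + (y * m) * (y * m) + 2 * (\<delta> * m\<^sup>2)"
    unfolding m_def by (intro add_left_mono mult_left_mono missed) simp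
  also have "\<dots> = (x\<^sup>2 + y\<^sup>2 + 2 * \<delta>) * m\<^sup>2" by (simp add: power2_eq_square ring_distribs)
  finally have "real (card ?L) \<le> (x\<^sup>2 + y\<^sup>2 + 2 * \<delta>) * m\<^sup>2" .
  with edges have "(q + 2 * \<delta>) * m\<^sup>2 \<le> (x\<^sup>2 + y\<^sup>2 + 2 * \<delta>) * m\<^sup>2"
    unfolding m_def by (rule order_trans)
  then have "q + 2 * \<delta> \<le> x\<^sup>2 + y\<^sup>2 + 2 * \<delta>"
    by (rule mult_right_le_imp_le) (use m in simp)
  then have norm: "q \<le> x\<^sup>2 + y\<^sup>2" by simp
  have "y \<le> x"
  proof (rule ccontr)
    assume "\<not> y \<le> x"
    have a1: "a \<le> 1"
    proof -
      have "card {i. i < n \<and> c i} \<le> card {..<n}" by (rule card_mono) auto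
      then have "real (card {i. i < n \<and> c i}) \<le> real n" by simp
      then have "a * real n \<le> 1 * real n" unfolding a(1) by simp
      then show ?thesis by (rule mult_right_le_imp_le) (use n in simp)
    qed
    have nc: "real (card {i. i < n \<and> \<not> c i}) = (1 - a) * n"
    proof -
      have "{i. i < n \<and> \<not> c i} = {..<n} - {i. i < n \<and> c i}" unfolding lessThan_def by blast
      moreover have "{i. i < n \<and> c i} \<subseteq> {..<n}" by auto
      ultimately have "card {i. i < n \<and> \<not> c i} = n - card {i. i < n \<and> c i}"
        using card_Diff_subset[of "{i. i < n \<and> c i}" "{..<n}"] by simp
      moreover have "card {i. i < n \<and> c i} \<le> card {..<n}" by (rule card_mono) auto
      ultimately have "real (card {i. i < n \<and> \<not> c i}) = real n - real (card {i. i < n \<and> c i})"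
        by (simp add: of_nat_diff)
      also have "\<dots> = (1 - a) * n" unfolding a(1) by (simp add: left_diff_distrib)
      finally show ?thesis .
    qed
    have "{(i, j) \<in> Z \<times> {..<n}. g i j} \<subseteq> X \<times> {i. i < n \<and> c i} \<union> Y \<times> {i. i < n \<and> \<not> c i} \<union> U \<times> {..<n}"
      (is "?K \<subseteq> ?R")
    proof
      fix e assume "e \<in> ?K"
      then obtain i j where e: "e = (i, j)" "i \<in> Z" "j < n" "g i j" by auto
      then have "c i = c j" using c Z by (auto simp: edge_constant_def)
      then show "e \<in> ?R" using e part cX cY by auto
    qed
    then have "card ?K \<le> card ?R" using fin by (intro card_mono) auto
    also have "\<dots> \<le> card (X \<times> {i. i < n \<and> c i}) + card (Y \<times> {i. i < n \<and> \<not> c i}) + card (U \<times> {..<n})"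
      using card_Un_le[of "X \<times> {i. i < n \<and> c i} \<union> Y \<times> {i. i < n \<and> \<not> c i}" "U \<times> {..<n}"]
        card_Un_le[of "X \<times> {i. i < n \<and> c i}" "Y \<times> {i. i < n \<and> \<not> c i}"] by linarith
    finally have "real (card ?K) \<le> real (card X) * real (card {i. i < n \<and> c i}) +
        real (card Y) * real (card {i. i < n \<and> \<not> c i}) + real (card U) * real n"
      by (simp add: card_cartesian_product flip: of_nat_mult of_nat_add)
    also have "\<dots> = (x * m) * (a * n) + (y * m) * ((1 - a) * n) + (1 - x - y) * m * n"
      by (simp only: xm ym um nc a(1))
    finally have "q * m * n \<le> \<dots>" using cross unfolding m_def by (rule order_trans[rotated])
    also have "\<dots> = (1 - (y * a + x * (1 - a))) * (m * n)"
      by (simp add: ring_distribs)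
    finally have "q * (m * n) \<le> (1 - (y * a + x * (1 - a))) * (m * n)" by (simp only: mult.assoc)
    then have "q \<le> 1 - (y * a + x * (1 - a))" using m n by (simp add: mult_le_cancel_right)
    \<comment> \<open>If y > x, then (y, x) and (a, 1 - a) both lie in the region, and their scalar
      product is too large for the bound just obtained from the cross edges.\<close>
    moreover have "y * a + x * (1 - a) > 1 - q"
    proof (rule region_dot[OF q])
      show "q \<le> y\<^sup>2 + x\<^sup>2" using norm by simp
    qed (use xy1 x0 a(2,3) a1 \<open>\<not> y \<le> x\<close> in linarith)+
    ultimately show False by linarith
  qed
  with norm xy1 x0 show ?thesis by (intro conjI)
qed

section \<open>Second moment bounds\<close>

context prob_space begin

text \<open>Chebyshev with a sparse dependency graph: a covariance is at most 1 and vanishes for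
  pairs that factorise, so the variance is at most |F| D. The pair (f, f) is normally among those
  counted by \<open>D\<close>.\<close>

lemma deviation_bound:
  fixes X :: "'i \<Rightarrow> 'a set" and p \<delta> D :: real
  assumes F: "finite F" "F \<noteq> {}" and X: "\<And>f. f \<in> F \<Longrightarrow> X f \<in> events"
    and p: "\<And>f. f \<in> F \<Longrightarrow> p \<le> prob (X f)" and \<delta>: "\<delta> > 0"
    and dep: "\<And>f. f \<in> F \<Longrightarrow> real (card {f' \<in> F. prob (X f \<inter> X f') \<noteq> prob (X f) * prob (X f')}) \<le> D"
  shows "prob {x \<in> space M. real (card {f \<in> F. x \<in> X f}) < (p - \<delta>) * real (card F)} \<le> D / (\<delta>\<^sup>2 * real (card F))"
proof -
  define Y where "Y x = (\<Sum>f\<in>F. indicator (X f) x :: real)" for x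
  have intX: "integrable M (\<lambda>x. indicator A x :: real)" if "A \<in> events" for A
    using that by (simp add: integrable_real_indicator emeasure_eq_measure)
  have cardY: "Y x = real (card {f \<in> F. x \<in> X f})" for x
  proof -
    have "Y x = (\<Sum>f\<in>F. if x \<in> X f then 1 else 0)" unfolding Y_def by (intro sum.cong) (auto simp: indicator_def)
    also have "\<dots> = real (card {f \<in> F. x \<in> X f})" using F by (simp add: sum.If_cases Int_def)
    finally show ?thesis .
  qed
  have intY: "integrable M Y" unfolding Y_def by (intro Bochner_Integration.integrable_sum intX X)
  have EY: "expectation Y = (\<Sum>f\<in>F. prob (X f))"
    unfolding Y_def using X by (subst Bochner_Integration.integral_sum) (auto intro: intX)
  have Y2: "(Y x)\<^sup>2 = (\<Sum>f\<in>F. \<Sum>f'\<in>F. indicator (X f \<inter> X f') x)" for x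
    unfolding Y_def power2_eq_square sum_product by (simp add: indicator_inter_arith)
  have intY2: "integrable M (\<lambda>x. (Y x)\<^sup>2)" unfolding Y2
    by (intro Bochner_Integration.integrable_sum intX) (use X in auto)
  have EY2: "expectation (\<lambda>x. (Y x)\<^sup>2) = (\<Sum>f\<in>F. \<Sum>f'\<in>F. prob (X f \<inter> X f'))"
  proof -
    have ev: "X f \<inter> X f' \<in> events" if "f \<in> F" "f' \<in> F" for f f' using X that by blast
    have "expectation (\<lambda>x. (Y x)\<^sup>2) = expectation (\<lambda>x. \<Sum>f\<in>F. \<Sum>f'\<in>F. indicator (X f \<inter> X f') x)"
      by (simp only: Y2)
    also have "\<dots> = (\<Sum>f\<in>F. expectation (\<lambda>x. \<Sum>f'\<in>F. indicator (X f \<inter> X f') x))"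
      by (rule Bochner_Integration.integral_sum) (intro Bochner_Integration.integrable_sum intX ev)
    also have "\<dots> = (\<Sum>f\<in>F. \<Sum>f'\<in>F. expectation (\<lambda>x. indicator (X f \<inter> X f') x))"
      by (rule sum.cong[OF refl], rule Bochner_Integration.integral_sum) (intro intX ev)
    also have "\<dots> = (\<Sum>f\<in>F. \<Sum>f'\<in>F. prob (X f \<inter> X f'))"
      by (intro sum.cong refl) (simp add: ev emeasure_eq_measure)
    finally show ?thesis .
  qed
  have "expectation (\<lambda>x. (Y x - expectation Y)\<^sup>2) = expectation (\<lambda>x. (Y x)\<^sup>2) - (expectation Y)\<^sup>2"
    by (rule variance_eq[OF intY intY2])
  also have "\<dots> = (\<Sum>f\<in>F. \<Sum>f'\<in>F. prob (X f \<inter> X f') - prob (X f) * prob (X f'))"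
  proof -
    have "(expectation Y)\<^sup>2 = (\<Sum>f\<in>F. \<Sum>f'\<in>F. prob (X f) * prob (X f'))"
      unfolding EY power2_eq_square sum_product ..
    then show ?thesis unfolding EY2 by (simp add: sum_subtractf)
  qed
  also have "\<dots> \<le> (\<Sum>f\<in>F. \<Sum>f'\<in>F. if prob (X f \<inter> X f') \<noteq> prob (X f) * prob (X f') then 1 else 0)"
  proof (intro sum_mono)
    fix f f'
    have "prob (X f \<inter> X f') - prob (X f) * prob (X f') \<le> 1"
      using prob_le_1[of "X f \<inter> X f'"] mult_nonneg_nonneg[OF measure_nonneg measure_nonneg, of M "X f" M "X f'"]
      by linarith
    then show "prob (X f \<inter> X f') - prob (X f) * prob (X f')
        \<le> (if prob (X f \<inter> X f') \<noteq> prob (X f) * prob (X f') then 1 else 0)" by simp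
  qed
  also have "\<dots> = (\<Sum>f\<in>F. real (card {f' \<in> F. prob (X f \<inter> X f') \<noteq> prob (X f) * prob (X f')}))"
    using F by (intro sum.cong refl) (simp add: sum.If_cases Int_def)
  also have "\<dots> \<le> real (card F) * D" using sum_bounded_above[of F _ D] dep by simp
  finally have var: "expectation (\<lambda>x. (Y x - expectation Y)\<^sup>2) \<le> real (card F) * D" .
  have n: "real (card F) > 0" using F by (simp add: card_gt_0_iff)
  have EYp: "p * real (card F) \<le> expectation Y"
    unfolding EY using sum_bounded_below[of F p] p by (simp add: mult.commute)
  have mY: "Y \<in> borel_measurable M" using intY by simp
  have "{x \<in> space M. real (card {f \<in> F. x \<in> X f}) < (p - \<delta>) * real (card F)}
      \<subseteq> {x \<in> space M. \<delta> * real (card F) \<le> \<bar>Y x - expectation Y\<bar>}"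
  proof
    fix x assume "x \<in> {x \<in> space M. real (card {f \<in> F. x \<in> X f}) < (p - \<delta>) * real (card F)}"
    then have "x \<in> space M" "Y x < p * real (card F) - \<delta> * real (card F)"
      by (simp_all add: cardY left_diff_distrib)
    then show "x \<in> {x \<in> space M. \<delta> * real (card F) \<le> \<bar>Y x - expectation Y\<bar>}"
      using EYp by simp
  qed
  moreover have "{x \<in> space M. \<delta> * real (card F) \<le> \<bar>Y x - expectation Y\<bar>} \<in> events"
    using mY by measurable
  ultimately have "prob {x \<in> space M. real (card {f \<in> F. x \<in> X f}) < (p - \<delta>) * real (card F)}
      \<le> prob {x \<in> space M. \<delta> * real (card F) \<le> \<bar>Y x - expectation Y\<bar>}"
    by (rule finite_measure_mono)
  also have "\<dots> \<le> expectation (\<lambda>x. (Y x - expectation Y)\<^sup>2) / (\<delta> * real (card F))\<^sup>2"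
    using n \<delta> by (intro Chebyshev_inequality mY intY2) simp
  also have "\<dots> \<le> (real (card F) * D) / (\<delta> * real (card F))\<^sup>2"
    using var by (rule divide_right_mono) simp
  also have "\<dots> = D / (\<delta>\<^sup>2 * real (card F))"
    using n \<delta> by (simp add: power2_eq_square field_simps)
  finally show ?thesis .
qed

text \<open>Centring the indicators of the \<open>A i\<close> at their random empirical mean
  \<open>S\<close> makes \<open>W\<close> the normalised difference between the overlap and the
  product of the two random densities. Its second moment is the average of G i j * h i j, where
  \<open>G\<close> is the doubly centred matrix of the pair probabilities of \<open>A\<close>.
  Double centring kills a constant matrix, so \<open>G\<close> is small off the diagonal, and 0
  \<le> h \<le> 1. Independence of the \<open>A i\<close> among themselves is never assumed.\<close>

lemma overlap_bound:
  fixes A B :: "nat \<Rightarrow> 'a set" and c \<eta> \<delta> :: real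
  assumes Z: "finite Z" "Z \<noteq> {}" and A: "\<And>i. i \<in> Z \<Longrightarrow> A i \<in> events" and B: "\<And>i. i \<in> Z \<Longrightarrow> B i \<in> events"
    and ind: "\<And>i j k l. i \<in> Z \<Longrightarrow> j \<in> Z \<Longrightarrow> k \<in> Z \<Longrightarrow> l \<in> Z \<Longrightarrow>
      prob ((A i \<inter> A j) \<inter> (B k \<inter> B l)) = prob (A i \<inter> A j) * prob (B k \<inter> B l)"
    and gram: "\<And>i j. i \<in> Z \<Longrightarrow> j \<in> Z \<Longrightarrow> i \<noteq> j \<Longrightarrow> \<bar>prob (A i \<inter> A j) - c\<bar> \<le> \<eta>"
    and \<eta>: "\<eta> \<ge> 0" and c: "0 \<le> c" "c \<le> 1" and \<delta>: "\<delta> > 0"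
  shows "prob {x \<in> space M. real (card {i \<in> Z. x \<in> A i \<inter> B i}) * real (card Z) <
      real (card {i \<in> Z. x \<in> A i}) * real (card {i \<in> Z. x \<in> B i}) - \<delta> * (real (card Z))\<^sup>2} \<le>
      (4 * \<eta> + 8 / real (card Z)) / \<delta>\<^sup>2"
proof -
  define m where "m = real (card Z)"
  have m: "m > 0" using Z by (simp add: m_def card_gt_0_iff)
  define a where "a i x = (indicator (A i) x :: real)" for i x
  define b where "b i x = (indicator (B i) x :: real)" for i x
  define S where "S x = (\<Sum>i\<in>Z. a i x) / m" for x
  define W where "W x = (\<Sum>i\<in>Z. (a i x - S x) * b i x) / m" for x
  define g where "g i j = prob (A i \<inter> A j)" for i j
  define h where "h i j = prob (B i \<inter> B j)" for i j
  have Sm: "m * S x = (\<Sum>i\<in>Z. a i x)" for x using m by (simp add: S_def)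
  have ev: "A i \<inter> A j \<in> events" "B i \<inter> B j \<in> events" if "i \<in> Z" "j \<in> Z" for i j
    using A B that by auto
  have E4: "integrable M (\<lambda>x. a i x * a j x * (b k x * b l x)) \<and>
      expectation (\<lambda>x. a i x * a j x * (b k x * b l x)) = g i j * h k l"
    if "i \<in> Z" "j \<in> Z" "k \<in> Z" "l \<in> Z" for i j k l
  proof -
    have "(\<lambda>x. a i x * a j x * (b k x * b l x)) = (\<lambda>x. indicator ((A i \<inter> A j) \<inter> (B k \<inter> B l)) x)"
      by (auto simp: a_def b_def indicator_def)
    moreover have "(A i \<inter> A j) \<inter> (B k \<inter> B l) \<in> events" using ev that by auto
    ultimately show ?thesis using ind[OF that]
      by (simp add: g_def h_def emeasure_eq_measure)
  qed
  define G where "G i j = g i j - (\<Sum>k\<in>Z. g k j) / m - (\<Sum>k\<in>Z. g i k) / m + (\<Sum>k\<in>Z. \<Sum>l\<in>Z. g k l) / m\<^sup>2" for i j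
  have expand: "(a i x - S x) * b i x * ((a j x - S x) * b j x) =
      a i x * a j x * (b i x * b j x) - (\<Sum>k\<in>Z. a k x * a j x * (b i x * b j x)) / m
      - (\<Sum>k\<in>Z. a i x * a k x * (b i x * b j x)) / m
      + (\<Sum>k\<in>Z. \<Sum>l\<in>Z. a k x * a l x * (b i x * b j x)) / m\<^sup>2" for i j x
  proof -
    have "(\<Sum>k\<in>Z. a k x * a j x * (b i x * b j x)) / m = S x * a j x * (b i x * b j x)"
      by (simp add: S_def sum_distrib_right)
    moreover have "(\<Sum>k\<in>Z. a i x * a k x * (b i x * b j x)) / m = a i x * S x * (b i x * b j x)"
      by (simp add: S_def sum_distrib_right sum_distrib_left)
    moreover have "(\<Sum>k\<in>Z. \<Sum>l\<in>Z. a k x * a l x * (b i x * b j x)) =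
        (\<Sum>k\<in>Z. a k x) * (\<Sum>l\<in>Z. a l x) * (b i x * b j x)"
      by (subst sum_product) (simp only: sum_distrib_right)
    then have "(\<Sum>k\<in>Z. \<Sum>l\<in>Z. a k x * a l x * (b i x * b j x)) / m\<^sup>2 = S x * S x * (b i x * b j x)"
      by (simp add: S_def power2_eq_square)
    moreover have "(a i x - S x) * b i x * ((a j x - S x) * b j x) =
        a i x * a j x * (b i x * b j x) - S x * a j x * (b i x * b j x)
        - a i x * S x * (b i x * b j x) + S x * S x * (b i x * b j x)"
      by (simp add: algebra_simps)
    ultimately show ?thesis by (simp only:)
  qed
  have E: "integrable M (\<lambda>x. (a i x - S x) * b i x * ((a j x - S x) * b j x)) \<and>
      expectation (\<lambda>x. (a i x - S x) * b i x * ((a j x - S x) * b j x)) = G i j * h i j"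
    if ij: "i \<in> Z" "j \<in> Z" for i j
  proof -
    have I: "integrable M (\<lambda>x. a k x * a l x * (b i x * b j x))"
      and V: "expectation (\<lambda>x. a k x * a l x * (b i x * b j x)) = g k l * h i j"
      if "k \<in> Z" "l \<in> Z" for k l using E4[OF that ij] by auto
    have I1: "integrable M (\<lambda>x. (\<Sum>k\<in>Z. a k x * a j x * (b i x * b j x)) / m)"
      "integrable M (\<lambda>x. (\<Sum>k\<in>Z. a i x * a k x * (b i x * b j x)) / m)"
      "integrable M (\<lambda>x. (\<Sum>k\<in>Z. \<Sum>l\<in>Z. a k x * a l x * (b i x * b j x)) / m\<^sup>2)"
      by (intro integrable_divide Bochner_Integration.integrable_sum I ij; assumption)+
    have V1: "expectation (\<lambda>x. (\<Sum>k\<in>Z. a k x * a j x * (b i x * b j x)) / m) = (\<Sum>k\<in>Z. g k j) / m * h i j"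
      using ij by (simp add: Bochner_Integration.integral_sum I V sum_distrib_right)
    have V2: "expectation (\<lambda>x. (\<Sum>k\<in>Z. a i x * a k x * (b i x * b j x)) / m) = (\<Sum>k\<in>Z. g i k) / m * h i j"
      using ij by (simp add: Bochner_Integration.integral_sum I V sum_distrib_right)
    have V3: "expectation (\<lambda>x. (\<Sum>k\<in>Z. \<Sum>l\<in>Z. a k x * a l x * (b i x * b j x)) / m\<^sup>2)
        = (\<Sum>k\<in>Z. \<Sum>l\<in>Z. g k l) / m\<^sup>2 * h i j"
      using ij by (simp add: Bochner_Integration.integral_sum I V sum_distrib_right)
    have lin: "integrable M (\<lambda>x. F1 x - F2 x - F3 x + F4 x) \<and>
        expectation (\<lambda>x. F1 x - F2 x - F3 x + F4 x) = e1 - e2 - e3 + e4"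
      if "integrable M F1" "integrable M F2" "integrable M F3" "integrable M F4"
        "expectation F1 = e1" "expectation F2 = e2" "expectation F3 = e3" "expectation F4 = e4"
      for F1 F2 F3 F4 :: "'a \<Rightarrow> real" and e1 e2 e3 e4
      using that by simp
    have "G i j * h i j = g i j * h i j - (\<Sum>k\<in>Z. g k j) / m * h i j - (\<Sum>k\<in>Z. g i k) / m * h i j
        + (\<Sum>k\<in>Z. \<Sum>l\<in>Z. g k l) / m\<^sup>2 * h i j"
      unfolding G_def by (simp only: ring_distribs)
    then show ?thesis unfolding expand using lin[OF I[OF ij] I1 V[OF ij] V1 V2 V3] by (simp only: simp_thms)
  qed
  have W2: "(W x)\<^sup>2 = (\<Sum>i\<in>Z. \<Sum>j\<in>Z. (a i x - S x) * b i x * ((a j x - S x) * b j x)) / m\<^sup>2" for x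
    by (simp add: W_def power2_eq_square sum_product)
  have intW2: "integrable M (\<lambda>x. (W x)\<^sup>2)" unfolding W2
    using E by (intro integrable_divide Bochner_Integration.integrable_sum) auto
  have EW2: "expectation (\<lambda>x. (W x)\<^sup>2) = (\<Sum>i\<in>Z. \<Sum>j\<in>Z. G i j * h i j) / m\<^sup>2"
    unfolding W2 using E by (simp add: Bochner_Integration.integral_sum)
  have g01: "0 \<le> g i j" "g i j \<le> 1" and h01: "0 \<le> h i j" "h i j \<le> 1" for i j
    by (simp_all add: g_def h_def)
  \<comment> \<open>A row average contains one diagonal term, of which only membership in [0, 1] is
    known; it accounts for the summand 1 / m.\<close>
  have row: "\<bar>(\<Sum>k\<in>Z. f k) / m - c\<bar> \<le> \<eta> + 1 / m"
    if f: "\<And>k. 0 \<le> f k" "\<And>k. f k \<le> 1" "\<And>k. k \<in> Z \<Longrightarrow> k \<noteq> j \<Longrightarrow> \<bar>f k - c\<bar> \<le> \<eta>" and j: "j \<in> Z"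
    for f :: "nat \<Rightarrow> real" and j
  proof -
    have "(\<Sum>k\<in>Z. f k) / m - c = (\<Sum>k\<in>Z. f k - c) / m"
      using m by (simp add: sum_subtractf diff_divide_distrib flip: m_def)
    also have "(\<Sum>k\<in>Z. f k - c) = (f j - c) + (\<Sum>k\<in>Z - {j}. f k - c)" by (rule sum.remove[OF Z(1) j])
    finally have "\<bar>(\<Sum>k\<in>Z. f k) / m - c\<bar> = \<bar>(f j - c) + (\<Sum>k\<in>Z - {j}. f k - c)\<bar> / m"
      using m by simp
    also have "\<dots> \<le> (1 + m * \<eta>) / m"
    proof (rule divide_right_mono)
      have "\<bar>\<Sum>k\<in>Z - {j}. f k - c\<bar> \<le> (\<Sum>k\<in>Z - {j}. \<bar>f k - c\<bar>)" by (rule sum_abs)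
      also have "\<dots> \<le> (\<Sum>k\<in>Z - {j}. \<eta>)" using f by (intro sum_mono) auto
      also have "\<dots> \<le> (\<Sum>k\<in>Z. \<eta>)" using Z \<eta> by (intro sum_mono2) auto
      finally have "\<bar>\<Sum>k\<in>Z - {j}. f k - c\<bar> \<le> m * \<eta>" by (simp add: m_def)
      moreover have "\<bar>f j - c\<bar> \<le> 1" using f(1,2)[of j] c by linarith
      ultimately show "\<bar>(f j - c) + (\<Sum>k\<in>Z - {j}. f k - c)\<bar> \<le> 1 + m * \<eta>" by linarith
    qed (use m in simp)
    also have "\<dots> = \<eta> + 1 / m" using m by (simp add: field_simps)
    finally show ?thesis .
  qed
  have r1: "\<bar>(\<Sum>k\<in>Z. g k j) / m - c\<bar> \<le> \<eta> + 1 / m" "\<bar>(\<Sum>k\<in>Z. g j k) / m - c\<bar> \<le> \<eta> + 1 / m" if "j \<in> Z" for j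
    using gram that by (intro row[OF g01]; simp add: g_def)+
  have r2: "\<bar>(\<Sum>k\<in>Z. \<Sum>l\<in>Z. g k l) / m\<^sup>2 - c\<bar> \<le> \<eta> + 1 / m"
  proof -
    have "(\<Sum>k\<in>Z. \<Sum>l\<in>Z. g k l) / m\<^sup>2 - c = (\<Sum>k\<in>Z. (\<Sum>l\<in>Z. g k l) / m - c) / m"
      using m by (simp add: sum_subtractf diff_divide_distrib sum_divide_distrib power2_eq_square flip: m_def)
    then have "\<bar>(\<Sum>k\<in>Z. \<Sum>l\<in>Z. g k l) / m\<^sup>2 - c\<bar> = \<bar>\<Sum>k\<in>Z. (\<Sum>l\<in>Z. g k l) / m - c\<bar> / m" using m by simp
    also have "\<dots> \<le> (\<Sum>k\<in>Z. \<bar>(\<Sum>l\<in>Z. g k l) / m - c\<bar>) / m" using m by (intro divide_right_mono sum_abs) simp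
    also have "\<dots> \<le> (\<Sum>k\<in>Z. \<eta> + 1 / m) / m" using m r1 by (intro divide_right_mono sum_mono) auto
    also have "\<dots> = \<eta> + 1 / m" using m by (simp flip: m_def)
    finally show ?thesis .
  qed
  have Gbound: "G i j \<le> (if i = j then 4 else 0) + 4 * (\<eta> + 1 / m)" if "i \<in> Z" "j \<in> Z" for i j
  proof -
    have "g i j \<le> c + \<eta> + (if i = j then 1 else 0)"
    proof (cases "i = j")
      case True then show ?thesis using g01[of i j] c \<eta> by simp
    next
      case False then show ?thesis using gram[OF that False] by (simp add: g_def)
    qed
    moreover have "0 \<le> 1 / m" using m by simp
    moreover have "G' - s1 - s2 + s3 \<le> d + 4 * \<eta> + 4 * t"
      if "G' \<le> c + \<eta> + d" "0 \<le> t" "\<bar>s1 - c\<bar> \<le> \<eta> + t" "\<bar>s2 - c\<bar> \<le> \<eta> + t" "\<bar>s3 - c\<bar> \<le> \<eta> + t"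
      for G' s1 s2 s3 t d :: real
      using that(1,2) abs_le_D2[OF that(3)] abs_le_D2[OF that(4)] abs_le_D1[OF that(5)] by argo
    ultimately have "G i j \<le> (if i = j then 1 else 0) + 4 * \<eta> + 4 * (1 / m)"
      unfolding G_def using r1(1)[OF that(2)] r1(2)[OF that(1)] r2 by blast
    also have "\<dots> \<le> (if i = j then 4 else 0) + 4 * (\<eta> + 1 / m)" by (simp add: distrib_left)
    finally show ?thesis .
  qed
  have "(\<Sum>i\<in>Z. \<Sum>j\<in>Z. G i j * h i j) \<le> (\<Sum>i\<in>Z. \<Sum>j\<in>Z. (if i = j then 4 else 0) + 4 * (\<eta> + 1 / m))"
  proof (intro sum_mono)
    fix i j assume "i \<in> Z" "j \<in> Z"
    define u :: real where "u = (if i = j then 4 else 0) + 4 * (\<eta> + 1 / m)"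
    have "0 \<le> u" using \<eta> m by (auto simp: u_def)
    have "G i j * h i j \<le> u * h i j"
      using Gbound[OF \<open>i \<in> Z\<close> \<open>j \<in> Z\<close>] h01 unfolding u_def by (intro mult_right_mono) auto
    also have "\<dots> \<le> u * 1" using \<open>0 \<le> u\<close> h01 by (intro mult_left_mono) auto
    finally show "G i j * h i j \<le> (if i = j then 4 else 0) + 4 * (\<eta> + 1 / m)" by (simp add: u_def)
  qed
  \<comment> \<open>The 8 / m of the final bound has two equal sources: m diagonal terms of size 4
    among m^2, and the 4 / m from the averages.\<close>
  also have "\<dots> = 4 * m + m * m * (4 * (\<eta> + 1 / m))"
    using Z(1) by (simp add: sum.distrib sum.delta distrib_left mult.assoc flip: m_def)
  also have "\<dots> = (4 * \<eta> + 8 / m) * m\<^sup>2" using m by (simp add: field_simps power2_eq_square)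
  finally have EW2b: "expectation (\<lambda>x. (W x)\<^sup>2) \<le> 4 * \<eta> + 8 / m"
    unfolding EW2 using m by (simp add: divide_le_eq)
  have cnt: "(\<Sum>i\<in>Z. indicator (C i) x) = real (card {i \<in> Z. x \<in> C i})" for C :: "nat \<Rightarrow> 'a set" and x
    using Z(1) by (simp add: indicator_def sum.If_cases Int_def)
  have Wm: "W x * m\<^sup>2 = real (card {i \<in> Z. x \<in> A i \<inter> B i}) * m - real (card {i \<in> Z. x \<in> A i}) * real (card {i \<in> Z. x \<in> B i})" for x
  proof -
    have "W x * m\<^sup>2 = (\<Sum>i\<in>Z. (a i x - S x) * b i x) * m" using m by (simp add: W_def power2_eq_square)
    also have "\<dots> = (\<Sum>i\<in>Z. a i x * b i x) * m - (m * S x) * (\<Sum>i\<in>Z. b i x)"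
      by (simp add: left_diff_distrib sum_subtractf sum_distrib_left algebra_simps)
    also have "(\<Sum>i\<in>Z. a i x * b i x) = (\<Sum>i\<in>Z. indicator (A i \<inter> B i) x)"
      by (simp add: a_def b_def indicator_inter_arith)
    also have "m * S x = (\<Sum>i\<in>Z. indicator (A i) x)" by (simp add: Sm a_def)
    also have "(\<Sum>i\<in>Z. b i x) = (\<Sum>i\<in>Z. indicator (B i) x)" by (simp add: b_def)
    finally show ?thesis unfolding cnt .
  qed
  have "{x \<in> space M. real (card {i \<in> Z. x \<in> A i \<inter> B i}) * m <
      real (card {i \<in> Z. x \<in> A i}) * real (card {i \<in> Z. x \<in> B i}) - \<delta> * m\<^sup>2} \<subseteq> {x \<in> space M. \<delta>\<^sup>2 \<le> (W x)\<^sup>2}"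
  proof
    fix x assume x: "x \<in> {x \<in> space M. real (card {i \<in> Z. x \<in> A i \<inter> B i}) * m <
      real (card {i \<in> Z. x \<in> A i}) * real (card {i \<in> Z. x \<in> B i}) - \<delta> * m\<^sup>2}"
    then have "W x * m\<^sup>2 < (- \<delta>) * m\<^sup>2" using Wm[of x] by simp
    then have "W x < - \<delta>" by (rule mult_right_less_imp_less) simp
    then have "\<delta> \<le> \<bar>W x\<bar>" by simp
    then have "\<delta>\<^sup>2 \<le> \<bar>W x\<bar>\<^sup>2" using \<delta> by (intro power_mono) auto
    then show "x \<in> {x \<in> space M. \<delta>\<^sup>2 \<le> (W x)\<^sup>2}" using x by simp
  qed
  moreover have "{x \<in> space M. \<delta>\<^sup>2 \<le> (W x)\<^sup>2} \<in> events"
    using borel_measurable_integrable[OF intW2] by measurable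
  ultimately have "prob {x \<in> space M. real (card {i \<in> Z. x \<in> A i \<inter> B i}) * m <
      real (card {i \<in> Z. x \<in> A i}) * real (card {i \<in> Z. x \<in> B i}) - \<delta> * m\<^sup>2} \<le> prob {x \<in> space M. \<delta>\<^sup>2 \<le> (W x)\<^sup>2}"
    by (rule finite_measure_mono)
  also have "\<dots> \<le> expectation (\<lambda>x. (W x)\<^sup>2) / \<delta>\<^sup>2"
    using \<delta> by (intro integral_Markov_inequality_measure[OF intW2, where A = "{}"]) auto
  also have "\<dots> \<le> (4 * \<eta> + 8 / m) / \<delta>\<^sup>2" using EW2b by (rule divide_right_mono) simp
  finally show ?thesis by (simp add: m_def)
qed

end

section \<open>Deterministic criterion for linked layers\<close>

lemma class_majority:
  fixes q :: real
  assumes sym: "symp g" and n: "n > 0" and q: "q > 1/2" and c: "edge_constant n g c"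
    and edges: "real (card {(i, j) \<in> {..<n} \<times> {..<n}. g i j}) \<ge> q * (real n)\<^sup>2"
    and i: "giant n g i" "c i"
  shows "\<exists>a. real (card {k. k < n \<and> c k}) = a * n \<and> 1/2 \<le> a \<and> q \<le> a\<^sup>2 + (1 - a)\<^sup>2"
proof -
  obtain i0 where i0: "giant n g i0" and
    s: "let a = card (comp_in n g i0) / n in 1/2 \<le> a \<and> q \<le> a\<^sup>2 + (1 - a)\<^sup>2"
    using giant_exists[OF sym n q edges] by blast
  define s where "s = real (card (comp_in n g i0)) / n"
  define a where "a = real (card {k. k < n \<and> c k}) / n"
  have s1: "1/2 \<le> s" and s2: "q \<le> s\<^sup>2 + (1 - s)\<^sup>2" using s unfolding Let_def s_def by blast+
  have "comp_in n g i0 = comp_in n g i" by (rule giant_comp_in_eq[OF sym i0 i(1)])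
  moreover have "comp_in n g i \<subseteq> {k. k < n \<and> c k}"
  proof
    fix k assume k: "k \<in> comp_in n g i"
    then have "c k" using comp_in_edge_constant[OF c k] i(2) by simp
    moreover have "k < n" using comp_in_subset[of i n g] k i(1) by (auto simp: giant_def)
    ultimately show "k \<in> {k. k < n \<and> c k}" by simp
  qed
  ultimately have "card (comp_in n g i0) \<le> card {k. k < n \<and> c k}" by (simp add: card_mono)
  then have "s \<le> a" unfolding s_def a_def by (intro divide_right_mono) auto
  \<comment> \<open>t^2 + (1 - t)^2 is increasing for t \<ge> 1/2, so the bound passes from the
    giant component to the class containing it.\<close>
  then have "0 \<le> (a - s) * (2 * (a + s - 1))" using s1 by (intro mult_nonneg_nonneg) auto
  also have "\<dots> = a\<^sup>2 + (1 - a)\<^sup>2 - (s\<^sup>2 + (1 - s)\<^sup>2)" by (simp add: power2_eq_square algebra_simps)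
  finally have "q \<le> a\<^sup>2 + (1 - a)\<^sup>2" using s2 by linarith
  moreover have "real (card {k. k < n \<and> c k}) = a * n" using n by (simp add: a_def)
  moreover have "1/2 \<le> a" using \<open>s \<le> a\<close> s1 by linarith
  ultimately show ?thesis by blast
qed

definition typical_layer :: "real \<Rightarrow> real \<Rightarrow> nat \<Rightarrow> nat set \<Rightarrow> nat set \<Rightarrow> (nat \<Rightarrow> nat \<Rightarrow> bool) \<Rightarrow> bool" where
  "typical_layer q \<delta> n Z P g \<longleftrightarrow> symp g \<and>
     real (card {(i, j) \<in> {..<n} \<times> {..<n}. g i j}) \<ge> q * (real n)\<^sup>2 \<and>
     real (card {(i, j) \<in> Z \<times> Z. g i j}) \<ge> (q + 2 * \<delta>) * (real (card Z))\<^sup>2 \<and>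
     real (card {(i, j) \<in> Z \<times> Z. g i j \<and> (\<forall>t\<in>P. \<not> g i t)}) \<le> \<delta> * (real (card Z))\<^sup>2 \<and>
     real (card {(i, j) \<in> Z \<times> {..<n}. g i j}) \<ge> q * real (card Z) * real n"

text \<open>At the positions of \<open>S1\<close> and \<open>S2\<close> the two colourings differ in
  opposite ways, and along \<open>H\<close> they agree, so the three sets are disjoint in
  \<open>Z\<close>. Their densities are at least x0 x1 - \<delta>, y0 y1 - \<delta> and q + 3
  \<delta>; since x0 x1 + y0 y1 > 1 - q, the sum exceeds 1. The 3 \<delta> pays for the two overlap
  losses.\<close>

lemma opposite_classes_contradiction:
  fixes q \<delta> :: real
  assumes q: "q > 4 - 2 * sqrt 3" and \<delta>: "\<delta> > 0" and n: "n > 0"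
    and Z: "Z \<subseteq> {..<n}" "Z \<noteq> {}" and P: "P \<subseteq> {..<n}"
    and tl: "typical_layer q \<delta> n Z P g0" "typical_layer q \<delta> n Z P g1"
    and matching: "real (card {i \<in> Z. h i}) \<ge> (q + 3 * \<delta>) * real (card Z)"
    and overlap: "\<forall>T\<subseteq>P. \<forall>T'\<subseteq>P.
      real (card {i \<in> Z. (\<exists>t\<in>T. g0 i t) \<and> (\<exists>t\<in>T'. g1 i t)}) * real (card Z) \<ge>
      real (card {i \<in> Z. \<exists>t\<in>T. g0 i t}) * real (card {i \<in> Z. \<exists>t\<in>T'. g1 i t}) - \<delta> * (real (card Z))\<^sup>2"
    and c: "edge_constant n g0 c0" "edge_constant n g1 c1" "\<And>k. k < n \<Longrightarrow> h k \<Longrightarrow> c0 k = c1 k"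
    and ij: "giant n g0 i" "giant n g1 j" "c0 i" "\<not> c1 j"
  shows False
proof -
  define m where "m = real (card Z)"
  have finZ: "finite Z" using Z finite_subset by blast
  then have m: "m > 0" using Z by (simp add: m_def card_gt_0_iff)
  have q2: "q > 1/2"
  proof -
    have "sqrt 3 < 7/4" by (rule real_less_lsqrt) (simp_all add: power2_eq_square)
    then show ?thesis using q by linarith
  qed
  note typ0 = tl(1)[unfolded typical_layer_def] and typ1 = tl(2)[unfolded typical_layer_def]
  have sym: "symp g0" "symp g1" and edges: "q * (real n)\<^sup>2 \<le> real (card {(i, j) \<in> {..<n} \<times> {..<n}. g0 i j})"
      "q * (real n)\<^sup>2 \<le> real (card {(i, j) \<in> {..<n} \<times> {..<n}. g1 i j})"
    using typ0 typ1 by blast+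
  have c1': "edge_constant n g1 (\<lambda>k. \<not> c1 k)" using c(2) unfolding edge_constant_def by blast
  define x0 where "x0 = real (card {i\<in>Z. \<exists>t\<in>P. c0 t \<and> g0 i t}) / m"
  define y0 where "y0 = real (card {i\<in>Z. \<exists>t\<in>P. \<not> c0 t \<and> g0 i t}) / m"
  define x1 where "x1 = real (card {i\<in>Z. \<exists>t\<in>P. \<not> c1 t \<and> g1 i t}) / m"
  \<comment> \<open>\<open>layer_region\<close> is applied to the complement of \<open>c1\<close>,
    which is the colouring that is true on the giant; its second density then appears with a double
    negation.\<close>
  define y1 where "y1 = real (card {i\<in>Z. \<exists>t\<in>P. \<not> \<not> c1 t \<and> g1 i t}) / m"
  obtain a0 :: real where a0: "real (card {k. k < n \<and> c0 k}) = a0 * n" "1/2 \<le> a0" "q \<le> a0\<^sup>2 + (1 - a0)\<^sup>2"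
    using class_majority[OF sym(1) n q2 c(1) edges(1) ij(1,3)] by blast
  obtain a1 :: real where a1: "real (card {k. k < n \<and> \<not> c1 k}) = a1 * n" "1/2 \<le> a1" "q \<le> a1\<^sup>2 + (1 - a1)\<^sup>2"
    using class_majority[OF sym(2) n q2 c1' edges(2) ij(2,4)] by blast
  have r0: "0 \<le> y0 \<and> y0 \<le> x0 \<and> x0 + y0 \<le> 1 \<and> q \<le> x0\<^sup>2 + y0\<^sup>2"
    by (rule layer_region[OF q sym(1) c(1) Z P _ _ _ a0, where \<delta> = \<delta>])
       (use typ0 m in \<open>blast, blast, blast, simp_all add: x0_def y0_def m_def\<close>)
  have r1: "0 \<le> y1 \<and> y1 \<le> x1 \<and> x1 + y1 \<le> 1 \<and> q \<le> x1\<^sup>2 + y1\<^sup>2"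
    by (rule layer_region[OF q sym(2) c1' Z P _ _ _ a1, where \<delta> = \<delta>])
       (use typ1 m in \<open>blast, blast, blast, simp_all add: x1_def y1_def m_def\<close>)
  define S1 where "S1 = {i \<in> Z. (\<exists>t\<in>{t\<in>P. c0 t}. g0 i t) \<and> (\<exists>t\<in>{t\<in>P. \<not> c1 t}. g1 i t)}"
  define S2 where "S2 = {i \<in> Z. (\<exists>t\<in>{t\<in>P. \<not> c0 t}. g0 i t) \<and> (\<exists>t\<in>{t\<in>P. c1 t}. g1 i t)}"
  define H where "H = {i \<in> Z. h i}"
  have lt: "i < n" if "i \<in> Z \<or> i \<in> P" for i using that Z P by blast
  have in1: "c0 i \<and> \<not> c1 i" if iS: "i \<in> S1" for i
  proof -
    obtain t t' where "t \<in> P" "c0 t" "g0 i t" "t' \<in> P" "\<not> c1 t'" "g1 i t'" "i \<in> Z"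
      using iS unfolding S1_def by blast
    then show ?thesis using c(1,2) lt unfolding edge_constant_def by metis
  qed
  have in2: "\<not> c0 i \<and> c1 i" if iS: "i \<in> S2" for i
  proof -
    obtain t t' where "t \<in> P" "\<not> c0 t" "g0 i t" "t' \<in> P" "c1 t'" "g1 i t'" "i \<in> Z"
      using iS unfolding S2_def by blast
    then show ?thesis using c(1,2) lt unfolding edge_constant_def by metis
  qed
  have inH: "c0 i = c1 i" if "i \<in> H" for i using that c(3) lt unfolding H_def by blast
  have sub: "S1 \<subseteq> Z" "S2 \<subseteq> Z" "H \<subseteq> Z" unfolding S1_def S2_def H_def by blast+
  then have fin: "finite S1" "finite S2" "finite H" using finite_subset[OF _ finZ] by simp_all
  have disj: "S1 \<inter> S2 = {}" "(S1 \<union> S2) \<inter> H = {}" using in1 in2 inH by blast+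
  have "card S1 + card S2 + card H = card (S1 \<union> S2 \<union> H)"
    using fin disj by (simp add: card_Un_disjoint)
  also have "\<dots> \<le> card Z" using sub finZ by (intro card_mono) auto
  finally have "card S1 + card S2 + card H \<le> card Z" .
  then have total: "real (card S1) + real (card S2) + real (card H) \<le> m" unfolding m_def by linarith
  have s1: "real (card S1) \<ge> (x0 * x1 - \<delta>) * m"
  proof -
    have eq: "{i \<in> Z. \<exists>t\<in>{t\<in>P. c0 t}. g0 i t} = {i\<in>Z. \<exists>t\<in>P. c0 t \<and> g0 i t}"
      "{i \<in> Z. \<exists>t\<in>{t\<in>P. \<not> c1 t}. g1 i t} = {i\<in>Z. \<exists>t\<in>P. \<not> c1 t \<and> g1 i t}" by blast+
    have "(x0 * x1 - \<delta>) * m * m = (x0 * m) * (x1 * m) - \<delta> * m\<^sup>2"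
      by (simp add: power2_eq_square algebra_simps)
    also have "\<dots> = real (card {i\<in>Z. \<exists>t\<in>P. c0 t \<and> g0 i t}) * real (card {i\<in>Z. \<exists>t\<in>P. \<not> c1 t \<and> g1 i t}) - \<delta> * m\<^sup>2"
      using m by (simp add: x0_def x1_def)
    also have "\<dots> \<le> real (card S1) * m"
      using overlap[rule_format, of "{t\<in>P. c0 t}" "{t\<in>P. \<not> c1 t}"] unfolding eq S1_def m_def by blast
    finally show ?thesis by (rule mult_right_le_imp_le) (rule m)
  qed
  have s2: "real (card S2) \<ge> (y0 * y1 - \<delta>) * m"
  proof -
    have eq: "{i \<in> Z. \<exists>t\<in>{t\<in>P. \<not> c0 t}. g0 i t} = {i\<in>Z. \<exists>t\<in>P. \<not> c0 t \<and> g0 i t}"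
      "{i \<in> Z. \<exists>t\<in>{t\<in>P. c1 t}. g1 i t} = {i\<in>Z. \<exists>t\<in>P. \<not> \<not> c1 t \<and> g1 i t}" by blast+
    have "(y0 * y1 - \<delta>) * m * m = (y0 * m) * (y1 * m) - \<delta> * m\<^sup>2"
      by (simp add: power2_eq_square algebra_simps)
    also have "\<dots> = real (card {i\<in>Z. \<exists>t\<in>P. \<not> c0 t \<and> g0 i t}) * real (card {i\<in>Z. \<exists>t\<in>P. \<not> \<not> c1 t \<and> g1 i t}) - \<delta> * m\<^sup>2"
      using m by (simp add: y0_def y1_def)
    also have "\<dots> \<le> real (card S2) * m"
      using overlap[rule_format, of "{t\<in>P. \<not> c0 t}" "{t\<in>P. c1 t}"] unfolding eq S2_def m_def by blast
    finally show ?thesis by (rule mult_right_le_imp_le) (rule m)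
  qed
  have "(q + 3 * \<delta>) * m \<le> real (card H)" using matching unfolding H_def m_def .
  with total s1 s2 have "(x0 * x1 - \<delta>) * m + (y0 * y1 - \<delta>) * m + (q + 3 * \<delta>) * m \<le> 1 * m" by linarith
  then have "(x0 * x1 - \<delta> + (y0 * y1 - \<delta>) + (q + 3 * \<delta>)) * m \<le> 1 * m" by (simp only: distrib_right)
  then have "x0 * x1 - \<delta> + (y0 * y1 - \<delta>) + (q + 3 * \<delta>) \<le> 1" by (rule mult_right_le_imp_le) (rule m)
  moreover have "x0 * x1 + y0 * y1 > 1 - q" using r0 r1 by (intro region_dot[OF q]) blast+
  ultimately show False using \<delta> by linarith
qed

lemma linked_criterion:
  fixes q \<delta> :: real
  assumes q: "q > 4 - 2 * sqrt 3" and \<delta>: "\<delta> > 0" and n: "n > 0"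
    and Z: "Z \<subseteq> {..<n}" "Z \<noteq> {}" and P: "P \<subseteq> {..<n}"
    and tl: "typical_layer q \<delta> n Z P g0" "typical_layer q \<delta> n Z P g1"
    and matching: "real (card {i \<in> Z. h i}) \<ge> (q + 3 * \<delta>) * real (card Z)"
    and overlap: "\<forall>T\<subseteq>P. \<forall>T'\<subseteq>P.
      real (card {i \<in> Z. (\<exists>t\<in>T. g0 i t) \<and> (\<exists>t\<in>T'. g1 i t)}) * real (card Z) \<ge>
      real (card {i \<in> Z. \<exists>t\<in>T. g0 i t}) * real (card {i \<in> Z. \<exists>t\<in>T'. g1 i t}) - \<delta> * (real (card Z))\<^sup>2"
  shows "linked n g0 g1 h"
  unfolding linked_def
proof (intro conjI allI impI, goal_cases)
  have "sqrt 3 < 7/4" by (rule real_less_lsqrt) (simp_all add: power2_eq_square)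
  then have q2: "q > 1/2" using q by linarith
  {
    case 1
    show ?case using giant_exists[OF _ n q2, of g0] tl(1)[unfolded typical_layer_def] by blast
  next
    case 2
    show ?case using giant_exists[OF _ n q2, of g1] tl(2)[unfolded typical_layer_def] by blast
  }
next
  case (3 c0 c1 i j)
  then have c: "edge_constant n g0 c0" "edge_constant n g1 c1" "\<And>k. k < n \<Longrightarrow> h k \<Longrightarrow> c0 k = c1 k"
    and ij: "giant n g0 i" "giant n g1 j" by blast+
  note contra = opposite_classes_contradiction[OF q \<delta> n Z P tl matching overlap _ _ _ ij]
  \<comment> \<open>Complementing both colourings turns the remaining case into the first.\<close>
  have c': "edge_constant n g0 (\<lambda>k. \<not> c0 k)" "edge_constant n g1 (\<lambda>k. \<not> c1 k)"
    using c(1,2) unfolding edge_constant_def by blast+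
  show "c0 i = c1 j"
  proof (rule ccontr)
    assume "c0 i \<noteq> c1 j"
    then consider "c0 i" "\<not> c1 j" | "\<not> c0 i" "\<not> \<not> c1 j" by blast
    then show False
    proof cases
      case 1
      then show False by (intro contra[OF c])
    next
      case 2
      then show False by (intro contra[OF c']) (simp_all add: c(3))
    qed
  qed
qed

section \<open>One random layer: typicality with high probability\<close>

locale random_layer = prob_space M for M :: "'a measure" +
  fixes n :: nat and p :: real and E :: "'a \<Rightarrow> nat \<Rightarrow> nat \<Rightarrow> bool"
  assumes sym: "symp (E x)" and irrefl: "\<not> E x i i"
    and edge_event: "{x \<in> space M. E x i j} \<in> events"
    and edge_prob: "i < n \<Longrightarrow> j < n \<Longrightarrow> i \<noteq> j \<Longrightarrow> p \<le> prob {x \<in> space M. E x i j}"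
    and edge_indep: "\<lbrakk>i < n; j < n; k < n; l < n; {i, j} \<inter> {k, l} = {}\<rbrakk> \<Longrightarrow>
      prob ({x \<in> space M. E x i j} \<inter> {x \<in> space M. E x k l}) =
      prob {x \<in> space M. E x i j} * prob {x \<in> space M. E x k l}"
begin

definition hit :: "nat set \<Rightarrow> nat \<Rightarrow> 'a set" where
  "hit T i = {x \<in> space M. \<exists>t\<in>T. E x i t}"

lemma hit_event: "finite T \<Longrightarrow> hit T i \<in> events"
  unfolding hit_def using edge_event by (intro sets.sets_Collect_finite_Ex) auto

text \<open>Disjoint edges are independent, so an ordered pair fails to factorise with at most 2 |W|
  + 2 |U| \<le> 4 |W| pairs. There are |U| (|W| - 1) pairs off the diagonal, and |W| \<le> 2 (|W| -
  1) turns the quotient into 8 / |U|.\<close>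

lemma edge_count_bound:
  assumes UW: "U \<subseteq> W" "W \<subseteq> {..<n}" and U: "U \<noteq> {}" and W: "2 \<le> card W" and \<delta>: "\<delta> > 0"
  shows "prob {x \<in> space M. real (card {(i, j) \<in> U \<times> W. E x i j}) < (p - \<delta>) * (real (card U) * (real (card W) - 1))}
    \<le> 8 / (\<delta>\<^sup>2 * real (card U))"
proof -
  let ?F = "{(i, j) \<in> U \<times> W. i \<noteq> j}"
  let ?X = "\<lambda>(i, j). {x \<in> space M. E x i j}"
  have "finite W" by (rule finite_subset[OF UW(2)]) simp
  then have fin: "finite U" "finite W" using finite_subset[OF UW(1)] by simp_all
  have u: "real (card U) > 0" using fin U by (simp add: card_gt_0_iff)
  have cardF: "card ?F = card U * (card W - 1)"
  proof -
    have "card ?F = (\<Sum>i\<in>U. card {j\<in>W. i \<noteq> j})" using fin by (rule card_pairs)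
    also have "\<dots> = (\<Sum>i\<in>U. card W - 1)"
    proof (rule sum.cong[OF refl])
      fix i assume "i \<in> U"
      have "{j\<in>W. i \<noteq> j} = W - {i}" by blast
      moreover have "i \<in> W" using \<open>i \<in> U\<close> UW(1) by blast
      ultimately show "card {j\<in>W. i \<noteq> j} = card W - 1" by simp
    qed
    finally show ?thesis by simp
  qed
  have rF: "real (card ?F) = real (card U) * (real (card W) - 1)"
  proof -
    have "real (card W - 1) = real (card W) - 1" using W by linarith
    then show ?thesis by (simp only: cardF of_nat_mult)
  qed
  have finF: "finite ?F" by (rule finite_subset[of _ "U \<times> W"]) (use fin in auto)
  have neF: "?F \<noteq> {}"
  proof
    assume "?F = {}"
    then have "card U * (card W - 1) = 0" using cardF by (metis card.empty)
    then show False using u W by simp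
  qed
  have dep: "real (card {f' \<in> ?F. prob (?X f \<inter> ?X f') \<noteq> prob (?X f) * prob (?X f')}) \<le> 4 * real (card W)"
    if f: "f \<in> ?F" for f
  proof -
    obtain i j where ij: "f = (i, j)" "i \<in> U" "j \<in> W" using f by blast
    have lt: "k < n" if "k \<in> W" for k using that UW by blast
    have "{f' \<in> ?F. prob (?X f \<inter> ?X f') \<noteq> prob (?X f) * prob (?X f')} \<subseteq> {i, j} \<times> W \<union> U \<times> {i, j}"
    proof
      fix f' assume f': "f' \<in> {f' \<in> ?F. prob (?X f \<inter> ?X f') \<noteq> prob (?X f) * prob (?X f')}"
      then obtain k l where kl: "f' = (k, l)" "k \<in> U" "l \<in> W" by blast
      have "{i, j} \<inter> {k, l} \<noteq> {}"
      proof
        assume "{i, j} \<inter> {k, l} = {}"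
        moreover have "i < n" "j < n" "k < n" "l < n" using ij kl lt UW(1) by blast+
        ultimately have "prob (?X f \<inter> ?X f') = prob (?X f) * prob (?X f')"
          unfolding ij(1) kl(1) prod.case by (intro edge_indep)
        then show False using f' by blast
      qed
      then show "f' \<in> {i, j} \<times> W \<union> U \<times> {i, j}" using kl by blast
    qed
    then have "card {f' \<in> ?F. prob (?X f \<inter> ?X f') \<noteq> prob (?X f) * prob (?X f')} \<le> card ({i, j} \<times> W \<union> U \<times> {i, j})"
      by (rule card_mono[rotated]) (simp add: fin)
    also have "\<dots> \<le> card ({i, j} \<times> W) + card (U \<times> {i, j})" by (rule card_Un_le)
    also have "\<dots> = card {i, j} * card W + card U * card {i, j}" by (simp only: card_cartesian_product)
    also have "\<dots> \<le> 2 * card W + card W * 2"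
    proof (intro add_mono mult_le_mono card_mono fin UW(1))
      show "card {i, j} \<le> 2" by (simp add: card_insert_if)
      then show "card {i, j} \<le> 2" .
    qed simp
    finally show ?thesis by linarith
  qed
  have bnd: "prob {x \<in> space M. real (card {f \<in> ?F. x \<in> ?X f}) < (p - \<delta>) * real (card ?F)}
      \<le> 4 * real (card W) / (\<delta>\<^sup>2 * real (card ?F))"
  proof (rule deviation_bound[OF finF neF _ _ \<delta> dep])
    show "?X f \<in> events" for f using edge_event by (cases f) simp
    show "p \<le> prob (?X f)" if fF: "f \<in> ?F" for f
    proof -
      obtain i j where "f = (i, j)" "i \<in> U" "j \<in> W" "i \<noteq> j" using fF by blast
      moreover have "i < n" "j < n" using \<open>i \<in> U\<close> \<open>j \<in> W\<close> UW by blast+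
      ultimately show ?thesis using edge_prob[of i j] by simp
    qed
  qed
  have eq: "{f \<in> ?F. x \<in> ?X f} = {(i, j) \<in> U \<times> W. E x i j}" if "x \<in> space M" for x
  proof (rule set_eqI)
    fix e :: "nat \<times> nat"
    obtain i j where e: "e = (i, j)" by (cases e)
    show "e \<in> {f \<in> ?F. x \<in> ?X f} \<longleftrightarrow> e \<in> {(i, j) \<in> U \<times> W. E x i j}"
      using that irrefl[of x i] unfolding e by (cases "i = j") simp_all
  qed
  have "{x \<in> space M. real (card {(i, j) \<in> U \<times> W. E x i j}) < (p - \<delta>) * real (card ?F)}
      = {x \<in> space M. real (card {f \<in> ?F. x \<in> ?X f}) < (p - \<delta>) * real (card ?F)}"
    by (rule Collect_cong, rule conj_cong[OF refl]) (simp only: eq)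
  with bnd have bnd': "prob {x \<in> space M. real (card {(i, j) \<in> U \<times> W. E x i j}) < (p - \<delta>) * real (card ?F)}
      \<le> 4 * real (card W) / (\<delta>\<^sup>2 * real (card ?F))" by (simp only:)
  have "4 * real (card W) / (\<delta>\<^sup>2 * (real (card U) * (real (card W) - 1)))
      \<le> 8 * (real (card W) - 1) / (\<delta>\<^sup>2 * (real (card U) * (real (card W) - 1)))"
    using W by (intro divide_right_mono mult_nonneg_nonneg) auto
  also have "\<dots> = 8 * (real (card W) - 1) / ((\<delta>\<^sup>2 * real (card U)) * (real (card W) - 1))"
    by (simp only: mult.assoc)
  also have "\<dots> = 8 / (\<delta>\<^sup>2 * real (card U))"
    by (rule nonzero_mult_divide_mult_cancel_right) (use W in linarith)
  finally show ?thesis using bnd' unfolding rF by (rule order_trans[rotated])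
qed

text \<open>A first moment suffices: each off-diagonal pair is missed with probability at most
  \<eta>, a diagonal pair never, and Markov's inequality does the rest.\<close>

lemma missed_bound:
  assumes fin: "finite Z" "finite P" and \<delta>: "\<delta> > 0" and Z: "Z \<noteq> {}"
    and \<eta>: "\<eta> \<ge> 0" "\<And>i j. i \<in> Z \<Longrightarrow> j \<in> Z \<Longrightarrow> i \<noteq> j \<Longrightarrow> prob {x \<in> space M. E x i j \<and> (\<forall>t\<in>P. \<not> E x i t)} \<le> \<eta>"
  shows "prob {x \<in> space M. \<delta> * (real (card Z))\<^sup>2 < real (card {(i, j) \<in> Z \<times> Z. E x i j \<and> (\<forall>t\<in>P. \<not> E x i t)})} \<le> \<eta> / \<delta>"
proof -
  let ?X = "\<lambda>(i, j). {x \<in> space M. E x i j \<and> (\<forall>t\<in>P. \<not> E x i t)}"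
  define Y where "Y x = (\<Sum>f\<in>Z \<times> Z. indicator (?X f) x :: real)" for x
  have m: "real (card Z) > 0" using fin Z by (simp add: card_gt_0_iff)
  have ev: "?X f \<in> events" for f
  proof -
    obtain i j where f: "f = (i, j)" by (cases f)
    have "?X f = {x \<in> space M. E x i j} - hit P i" unfolding f hit_def prod.case by blast
    then show ?thesis using edge_event hit_event[OF fin(2)] by simp
  qed
  have intX: "integrable M (\<lambda>x. indicator (?X f) x :: real)" for f
    using ev by (simp add: integrable_real_indicator emeasure_eq_measure)
  have intY: "integrable M Y" unfolding Y_def by (intro Bochner_Integration.integrable_sum intX)
  have "expectation Y = (\<Sum>f\<in>Z \<times> Z. expectation (\<lambda>x. indicator (?X f) x))"
    unfolding Y_def by (rule Bochner_Integration.integral_sum) (rule intX)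
  also have "\<dots> = (\<Sum>f\<in>Z \<times> Z. prob (?X f))"
    by (intro sum.cong refl) (simp add: ev emeasure_eq_measure)
  also have "\<dots> \<le> (\<Sum>f\<in>Z \<times> Z. \<eta>)"
  proof (rule sum_mono)
    fix f assume f: "f \<in> Z \<times> Z"
    then obtain i j where ij: "f = (i, j)" "i \<in> Z" "j \<in> Z" by blast
    show "prob (?X f) \<le> \<eta>"
    proof (cases "i = j")
      case True
      then have "?X f = {}" using irrefl ij by simp
      then show ?thesis using \<eta>(1) by simp
    next
      case False
      then show ?thesis using \<eta>(2)[OF ij(2,3)] ij(1) by simp
    qed
  qed
  also have "\<dots> = \<eta> * (real (card Z))\<^sup>2" by (simp add: card_cartesian_product power2_eq_square)
  finally have EY: "expectation Y \<le> \<eta> * (real (card Z))\<^sup>2" .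
  have cnt: "Y x = real (card {(i, j) \<in> Z \<times> Z. E x i j \<and> (\<forall>t\<in>P. \<not> E x i t)})" if "x \<in> space M" for x
  proof -
    have "Y x = (\<Sum>f\<in>Z \<times> Z. if x \<in> ?X f then 1 else 0)" unfolding Y_def indicator_def by (simp add: of_bool_def)
    also have "\<dots> = real (card {f \<in> Z \<times> Z. x \<in> ?X f})" using fin by (simp add: sum.If_cases Int_def)
    also have "{f \<in> Z \<times> Z. x \<in> ?X f} = {(i, j) \<in> Z \<times> Z. E x i j \<and> (\<forall>t\<in>P. \<not> E x i t)}"
      using that by (intro set_eqI) (simp add: split_beta mem_Times_iff conj_assoc)
    finally show ?thesis .
  qed
  have "{x \<in> space M. \<delta> * (real (card Z))\<^sup>2 < real (card {(i, j) \<in> Z \<times> Z. E x i j \<and> (\<forall>t\<in>P. \<not> E x i t)})}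
      \<subseteq> {x \<in> space M. \<delta> * (real (card Z))\<^sup>2 \<le> Y x}"
  proof
    fix x assume x: "x \<in> {x \<in> space M. \<delta> * (real (card Z))\<^sup>2 < real (card {(i, j) \<in> Z \<times> Z. E x i j \<and> (\<forall>t\<in>P. \<not> E x i t)})}"
    then have "x \<in> space M" by blast
    moreover have "\<delta> * (real (card Z))\<^sup>2 < Y x" using x unfolding cnt[OF \<open>x \<in> space M\<close>] by blast
    ultimately show "x \<in> {x \<in> space M. \<delta> * (real (card Z))\<^sup>2 \<le> Y x}" by simp
  qed
  moreover have "{x \<in> space M. \<delta> * (real (card Z))\<^sup>2 \<le> Y x} \<in> events"
    using borel_measurable_integrable[OF intY] by measurable
  ultimately have "prob {x \<in> space M. \<delta> * (real (card Z))\<^sup>2 < real (card {(i, j) \<in> Z \<times> Z. E x i j \<and> (\<forall>t\<in>P. \<not> E x i t)})}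
      \<le> prob {x \<in> space M. \<delta> * (real (card Z))\<^sup>2 \<le> Y x}" by (rule finite_measure_mono)
  also have "\<dots> \<le> expectation Y / (\<delta> * (real (card Z))\<^sup>2)"
  proof (rule integral_Markov_inequality_measure[OF intY, where A = "{}"])
    show "AE x in M. 0 \<le> Y x" by (simp add: Y_def sum_nonneg)
    show "0 < \<delta> * (real (card Z))\<^sup>2" using \<delta> m by simp
  qed simp
  also have "\<dots> \<le> \<eta> * (real (card Z))\<^sup>2 / (\<delta> * (real (card Z))\<^sup>2)"
    using EY \<delta> by (intro divide_right_mono) auto
  also have "\<dots> = \<eta> / \<delta>" using m by simp
  finally show ?thesis .
qed

end

section \<open>Two adjacent layers\<close>

text \<open>A property of a finite random set is a finite union of events that fix the whole set.
  This yields the measurability of conditions on cardinalities.\<close>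

lemma (in prob_space) finite_pattern_event:
  assumes "finite F" "\<And>f. f \<in> F \<Longrightarrow> {x \<in> space M. R x f} \<in> events"
  shows "{x \<in> space M. Q {f \<in> F. R x f}} \<in> events"
proof -
  have "{x \<in> space M. Q {f \<in> F. R x f}} = (\<Union>G\<in>{G \<in> Pow F. Q G}. {x \<in> space M. \<forall>f\<in>F. R x f \<longleftrightarrow> f \<in> G})"
  proof (rule set_eqI, rule iffI)
    fix x assume "x \<in> {x \<in> space M. Q {f \<in> F. R x f}}"
    then show "x \<in> (\<Union>G\<in>{G \<in> Pow F. Q G}. {x \<in> space M. \<forall>f\<in>F. R x f \<longleftrightarrow> f \<in> G})"
      by (intro UN_I[of "{f \<in> F. R x f}"]) simp_all
  next
    fix x assume "x \<in> (\<Union>G\<in>{G \<in> Pow F. Q G}. {x \<in> space M. \<forall>f\<in>F. R x f \<longleftrightarrow> f \<in> G})"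
    then obtain G where G: "G \<subseteq> F" "Q G" "x \<in> space M" "\<forall>f\<in>F. R x f \<longleftrightarrow> f \<in> G" by blast
    then have "{f \<in> F. R x f} = G" by blast
    then show "x \<in> {x \<in> space M. Q {f \<in> F. R x f}}" using G by simp
  qed
  also have "\<dots> \<in> events"
  proof (rule sets.finite_UN)
    show "finite {G \<in> Pow F. Q G}" using assms(1) by simp
    fix G
    have "{x \<in> space M. R x f \<longleftrightarrow> f \<in> G} \<in> events" if "f \<in> F" for f
    proof (cases "f \<in> G")
      case True
      then show ?thesis using assms(2)[OF that] by simp
    next
      case False
      have "{x \<in> space M. R x f \<longleftrightarrow> f \<in> G} = space M - {x \<in> space M. R x f}" using False by blast
      then show ?thesis using assms(2)[OF that] by simp
    qed
    then show "{x \<in> space M. \<forall>f\<in>F. R x f \<longleftrightarrow> f \<in> G} \<in> events"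
      using assms(1) by (rule sets.sets_Collect_finite_All)
  qed
  finally show ?thesis .
qed

lemma Collect_pairs: "{(i, j) \<in> A. R i j} = {f \<in> A. R (fst f) (snd f)}"
  by auto

context random_layer begin

lemma edge_count_event:
  assumes "finite U" "finite W"
  shows "{x \<in> space M. real (card {(i, j) \<in> U \<times> W. E x i j}) < b} \<in> events"
  unfolding Collect_pairs
  by (rule finite_pattern_event[where Q = "\<lambda>G. real (card G) < b"]) (use assms edge_event in auto)

lemma missed_event:
  assumes "finite Z" "finite P"
  shows "{x \<in> space M. b < real (card {(i, j) \<in> Z \<times> Z. E x i j \<and> (\<forall>t\<in>P. \<not> E x i t)})} \<in> events"
  unfolding Collect_pairs
proof (rule finite_pattern_event[where Q = "\<lambda>G. b < real (card G)"])
  fix f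
  have "{x \<in> space M. E x (fst f) (snd f) \<and> (\<forall>t\<in>P. \<not> E x (fst f) t)} =
      {x \<in> space M. E x (fst f) (snd f)} - hit P (fst f)" unfolding hit_def by blast
  then show "{x \<in> space M. E x (fst f) (snd f) \<and> (\<forall>t\<in>P. \<not> E x (fst f) t)} \<in> events"
    using edge_event hit_event[OF assms(2)] by simp
qed (use assms in simp)

text \<open>The slack 4 \<delta> is spent as \<delta> for the deviation of the counts, \<delta> for
  replacing |W| - 1 by |W|, and 2 \<delta> for the margin that \<open>typical_layer\<close> asks for
  inside \<open>Z\<close>. Three edge counts contribute 24 = 3 * 8, the missed pairs \<eta> /
  \<delta>.\<close>

lemma typical_layer_failure:
  assumes \<delta>: "\<delta> > 0" and Z: "Z \<subseteq> {..<n}" "2 \<le> card Z" "1 / \<delta> \<le> real (card Z)" and P: "P \<subseteq> {..<n}"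
    and \<eta>: "0 \<le> \<eta>" "\<And>i j. i \<in> Z \<Longrightarrow> j \<in> Z \<Longrightarrow> i \<noteq> j \<Longrightarrow> prob {x \<in> space M. E x i j \<and> (\<forall>t\<in>P. \<not> E x i t)} \<le> \<eta>"
  shows "\<exists>B\<in>events. prob B \<le> 24 / (\<delta>\<^sup>2 * real (card Z)) + \<eta> / \<delta> \<and>
    (\<forall>x\<in>space M - B. typical_layer (p - 4 * \<delta>) \<delta> n Z P (E x))"
proof -
  define m where "m = real (card Z)"
  have finZ: "finite Z" and finP: "finite P" using Z(1) P finite_subset[of _ "{..<n}"] by simp_all
  have Zne: "Z \<noteq> {}" using Z(2) by auto
  have m: "m > 0" "m \<ge> 1 / \<delta>" using Z by (simp_all add: m_def)
  have cardZn: "card Z \<le> n" using card_mono[OF _ Z(1)] by simp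
  then have n: "2 \<le> n" "m \<le> real n" using Z(2) by (simp_all add: m_def)
  have p1: "p \<le> 1"
  proof -
    have "p \<le> prob {x \<in> space M. E x 0 1}" using n by (intro edge_prob) auto
    also have "\<dots> \<le> 1" by simp
    finally show ?thesis .
  qed
  let ?B = "\<lambda>U W. {x \<in> space M. real (card {(i, j) \<in> U \<times> W. E x i j}) < (p - \<delta>) * (real (card U) * (real (card W) - 1))}"
  let ?C = "{x \<in> space M. \<delta> * (real (card Z))\<^sup>2 < real (card {(i, j) \<in> Z \<times> Z. E x i j \<and> (\<forall>t\<in>P. \<not> E x i t)})}"
  let ?N = "{..<n}"
  have B1: "prob (?B ?N ?N) \<le> 8 / (\<delta>\<^sup>2 * m)"
  proof -
    have "prob (?B ?N ?N) \<le> 8 / (\<delta>\<^sup>2 * real (card ?N))"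
      by (rule edge_count_bound) (use n \<delta> in \<open>auto simp: lessThan_empty_iff\<close>)
    also have "\<dots> \<le> 8 / (\<delta>\<^sup>2 * m)" using n m \<delta> by (intro divide_left_mono mult_left_mono mult_pos_pos) auto
    finally show ?thesis .
  qed
  have B2: "prob (?B Z Z) \<le> 8 / (\<delta>\<^sup>2 * m)"
    unfolding m_def by (rule edge_count_bound) (use Z Zne \<delta> in auto)
  have B3: "prob (?B Z ?N) \<le> 8 / (\<delta>\<^sup>2 * m)"
    unfolding m_def by (rule edge_count_bound) (use Z Zne \<delta> n in auto)
  have B4: "prob ?C \<le> \<eta> / \<delta>" by (rule missed_bound[OF finZ finP \<delta> Zne \<eta>])
  have ev: "?B ?N ?N \<in> events" "?B Z Z \<in> events" "?B Z ?N \<in> events" "?C \<in> events"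
    using finZ finP by (simp_all only: edge_count_event missed_event finite_lessThan)
  let ?A = "(?B ?N ?N \<union> ?B Z Z) \<union> (?B Z ?N \<union> ?C)"
  have "prob ?A \<le> (prob (?B ?N ?N) + prob (?B Z Z)) + (prob (?B Z ?N) + prob ?C)"
    using ev by (intro order_trans[OF measure_Un_le] add_mono measure_Un_le sets.Un)
  also have "\<dots> \<le> 24 / (\<delta>\<^sup>2 * m) + \<eta> / \<delta>" using B1 B2 B3 B4 by simp
  finally have PA: "prob ?A \<le> 24 / (\<delta>\<^sup>2 * m) + \<eta> / \<delta>" .
  \<comment> \<open>The absent diagonal leaves w - 1 in place of w; as \<delta> w \<ge> 1 and p
    \<le> 1, this costs at most one further \<delta>.\<close>
  have ar: "(p - 2 * \<delta>) * (u * w) \<le> (p - \<delta>) * (u * (w - 1))" if "0 \<le> u" "1 / \<delta> \<le> w" for u w :: real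
  proof -
    have "1 \<le> \<delta> * w" using that(2) \<delta> by (simp add: field_simps)
    then have "(p - 2 * \<delta>) * w \<le> (p - \<delta>) * (w - 1)" using p1 \<delta> by (simp add: algebra_simps)
    then have "u * ((p - 2 * \<delta>) * w) \<le> u * ((p - \<delta>) * (w - 1))" using that(1) by (rule mult_left_mono)
    then show ?thesis by (simp add: mult_ac)
  qed
  have "typical_layer (p - 4 * \<delta>) \<delta> n Z P (E x)" if x: "x \<in> space M - ?A" for x
    unfolding typical_layer_def
  proof (intro conjI sym)
    have n1: "1 / \<delta> \<le> real n" using m n by linarith
    have "(p - 4 * \<delta>) * (real n)\<^sup>2 \<le> (p - 2 * \<delta>) * (real n * real n)"
      unfolding power2_eq_square using \<delta> by (intro mult_right_mono) auto
    also have "\<dots> \<le> (p - \<delta>) * (real n * (real n - 1))" by (rule ar[OF _ n1]) simp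
    also have "\<dots> \<le> real (card {(i, j) \<in> ?N \<times> ?N. E x i j})" using x by (simp add: not_less)
    finally show "(p - 4 * \<delta>) * (real n)\<^sup>2 \<le> real (card {(i, j) \<in> ?N \<times> ?N. E x i j})" .
    have "(p - 4 * \<delta> + 2 * \<delta>) * (real (card Z))\<^sup>2 = (p - 2 * \<delta>) * (m * m)"
      by (simp add: m_def power2_eq_square)
    also have "\<dots> \<le> (p - \<delta>) * (m * (m - 1))" by (rule ar) (use m in auto)
    also have "\<dots> \<le> real (card {(i, j) \<in> Z \<times> Z. E x i j})" using x unfolding m_def by (simp add: not_less)
    finally show "(p - 4 * \<delta> + 2 * \<delta>) * (real (card Z))\<^sup>2 \<le> real (card {(i, j) \<in> Z \<times> Z. E x i j})" .
    show "real (card {(i, j) \<in> Z \<times> Z. E x i j \<and> (\<forall>t\<in>P. \<not> E x i t)}) \<le> \<delta> * (real (card Z))\<^sup>2"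
      using x by (simp add: not_less)
    have "(p - 4 * \<delta>) * real (card Z) * real n \<le> (p - 2 * \<delta>) * (m * real n)"
      unfolding m_def mult.assoc using \<delta> by (intro mult_right_mono) auto
    also have "\<dots> \<le> (p - \<delta>) * (m * (real n - 1))" by (rule ar[OF _ n1]) (use m in simp)
    also have "\<dots> \<le> real (card {(i, j) \<in> Z \<times> ?N. E x i j})" using x unfolding m_def by (simp add: not_less)
    finally show "(p - 4 * \<delta>) * real (card Z) * real n \<le> real (card {(i, j) \<in> Z \<times> ?N. E x i j})" .
  qed
  moreover have "?A \<in> events" using ev by (intro sets.Un)
  ultimately show ?thesis using PA unfolding m_def by blast
qed

text \<open>Identifies the probability of a missed edge with the drop of the potential that
  \<open>sampling_set_exists\<close> controls.\<close>

lemma missed_prob_eq: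
  assumes "finite P"
  shows "prob {x \<in> space M. E x i j \<and> (\<forall>t\<in>P. \<not> E x i t)} =
    prob {x \<in> space M. \<forall>t\<in>P. \<not> E x i t} - prob {x \<in> space M. \<forall>t\<in>insert j P. \<not> E x i t}"
proof -
  have ev: "{x \<in> space M. \<forall>t\<in>T. \<not> E x i t} \<in> events" if "finite T" for T
  proof -
    have "{x \<in> space M. \<forall>t\<in>T. \<not> E x i t} = space M - hit T i" unfolding hit_def by blast
    then show ?thesis using hit_event[OF that] by simp
  qed
  have "{x \<in> space M. E x i j \<and> (\<forall>t\<in>P. \<not> E x i t)} =
      {x \<in> space M. \<forall>t\<in>P. \<not> E x i t} - {x \<in> space M. \<forall>t\<in>insert j P. \<not> E x i t}" by blast
  also have "prob \<dots> = prob {x \<in> space M. \<forall>t\<in>P. \<not> E x i t} - prob {x \<in> space M. \<forall>t\<in>insert j P. \<not> E x i t}"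
    using assms by (intro finite_measure_Diff ev) auto
  finally show ?thesis .
qed

end

text \<open>No relation between \<open>H\<close> and the layers is assumed: a rung meets both fibres
  and may be correlated with them, so it enters only through its count. \<open>layers_indep\<close>
  states the independence of the two layers for exactly the fourfold intersections that the second
  moment of an overlap produces.\<close>

locale layer_pair = L0: random_layer M n p E0 + L1: random_layer M n p E1
  for M :: "'a measure" and n p E0 E1 +
  fixes H :: "'a \<Rightarrow> nat \<Rightarrow> bool"
  assumes matching_event: "{x \<in> space M. H x i} \<in> sets M"
    and matching_prob: "i < n \<Longrightarrow> p \<le> measure M {x \<in> space M. H x i}"
    and matching_indep: "i < n \<Longrightarrow> j < n \<Longrightarrow> i \<noteq> j \<Longrightarrow>
      measure M ({x \<in> space M. H x i} \<inter> {x \<in> space M. H x j}) =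
      measure M {x \<in> space M. H x i} * measure M {x \<in> space M. H x j}"
    and layers_indep: "\<lbrakk>T \<subseteq> {..<n}; T' \<subseteq> {..<n}; i < n; j < n; k < n; l < n\<rbrakk> \<Longrightarrow>
      measure M (({x \<in> space M. \<exists>t\<in>T. E0 x i t} \<inter> {x \<in> space M. \<exists>t\<in>T. E0 x j t}) \<inter>
        ({x \<in> space M. \<exists>t\<in>T'. E1 x k t} \<inter> {x \<in> space M. \<exists>t\<in>T'. E1 x l t})) =
      measure M ({x \<in> space M. \<exists>t\<in>T. E0 x i t} \<inter> {x \<in> space M. \<exists>t\<in>T. E0 x j t}) *
      measure M ({x \<in> space M. \<exists>t\<in>T'. E1 x k t} \<inter> {x \<in> space M. \<exists>t\<in>T'. E1 x l t})"
begin

lemma matching_failure: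
  assumes \<delta>: "\<delta> > 0" and Z: "Z \<subseteq> {..<n}" "Z \<noteq> {}"
  shows "\<exists>B\<in>sets M. measure M B \<le> 1 / (\<delta>\<^sup>2 * real (card Z)) \<and>
    (\<forall>x\<in>space M - B. (p - \<delta>) * real (card Z) \<le> real (card {i \<in> Z. H x i}))"
proof -
  have finZ: "finite Z" by (rule finite_subset[OF Z(1)]) simp
  let ?X = "\<lambda>i. {x \<in> space M. H x i}"
  let ?B = "{x \<in> space M. real (card {i \<in> Z. x \<in> ?X i}) < (p - \<delta>) * real (card Z)}"
  have lt: "i < n" if "i \<in> Z" for i using that Z by blast
  have "measure M ?B \<le> 1 / (\<delta>\<^sup>2 * real (card Z))"
  proof (rule L0.deviation_bound[OF finZ Z(2) matching_event _ \<delta>])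
    show "p \<le> measure M (?X i)" if "i \<in> Z" for i using matching_prob lt that by blast
    fix i assume i: "i \<in> Z"
    have "{j \<in> Z. measure M (?X i \<inter> ?X j) \<noteq> measure M (?X i) * measure M (?X j)} \<subseteq> {i}"
      using matching_indep[OF lt[OF i] lt] by blast
    then have "card {j \<in> Z. measure M (?X i \<inter> ?X j) \<noteq> measure M (?X i) * measure M (?X j)} \<le> card {i}"
      by (rule card_mono[rotated]) simp
    then show "real (card {j \<in> Z. measure M (?X i \<inter> ?X j) \<noteq> measure M (?X i) * measure M (?X j)}) \<le> 1" by simp
  qed
  moreover have "?B \<in> sets M"
    by (rule L0.finite_pattern_event[OF finZ, where Q = "\<lambda>G. real (card G) < (p - \<delta>) * real (card Z)"])
       (use matching_event in simp)
  moreover have "(p - \<delta>) * real (card Z) \<le> real (card {i \<in> Z. H x i})" if "x \<in> space M - ?B" for x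
    using that by (simp add: not_less)
  ultimately show ?thesis by blast
qed

lemma overlap_failure:
  assumes \<delta>: "\<delta> > 0" and Z: "Z \<subseteq> {..<n}" "Z \<noteq> {}" and T: "T \<subseteq> {..<n}" "T' \<subseteq> {..<n}"
    and \<eta>: "0 \<le> \<eta>" "\<And>i j. i \<in> Z \<Longrightarrow> j \<in> Z \<Longrightarrow> i \<noteq> j \<Longrightarrow> \<bar>measure M (L0.hit T i \<inter> L0.hit T j) - c\<bar> \<le> \<eta>"
  shows "\<exists>B\<in>sets M. measure M B \<le> (4 * \<eta> + 8 / real (card Z)) / \<delta>\<^sup>2 \<and>
    (\<forall>x\<in>space M - B. real (card {i \<in> Z. \<exists>t\<in>T. E0 x i t}) * real (card {i \<in> Z. \<exists>t\<in>T'. E1 x i t}) -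
      \<delta> * (real (card Z))\<^sup>2 \<le> real (card {i \<in> Z. (\<exists>t\<in>T. E0 x i t) \<and> (\<exists>t\<in>T'. E1 x i t)}) * real (card Z))"
proof -
  have finZ: "finite Z" by (rule finite_subset[OF Z(1)]) simp
  have finT: "finite T" "finite T'" using T finite_subset[of _ "{..<n}"] by simp_all
  have lt: "i < n" if "i \<in> Z" for i using that Z by blast
  \<comment> \<open>\<open>overlap_bound\<close> wants a constant in [0, 1]; clamping moves it no
    farther from any probability.\<close>
  let ?c = "max 0 (min 1 c)"
  let ?B = "{x \<in> space M. real (card {i \<in> Z. x \<in> L0.hit T i \<inter> L1.hit T' i}) * real (card Z) <
      real (card {i \<in> Z. x \<in> L0.hit T i}) * real (card {i \<in> Z. x \<in> L1.hit T' i}) - \<delta> * (real (card Z))\<^sup>2}"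
  have "measure M ?B \<le> (4 * \<eta> + 8 / real (card Z)) / \<delta>\<^sup>2"
  proof (rule L0.overlap_bound[OF finZ Z(2) _ _ _ _ \<eta>(1) _ _ \<delta>, where c = ?c])
    show "L0.hit T i \<in> L0.events" "L1.hit T' i \<in> L0.events" for i
      using L0.hit_event L1.hit_event finT by blast+
    show "measure M (L0.hit T i \<inter> L0.hit T j \<inter> (L1.hit T' k \<inter> L1.hit T' l)) =
        measure M (L0.hit T i \<inter> L0.hit T j) * measure M (L1.hit T' k \<inter> L1.hit T' l)"
      if "i \<in> Z" "j \<in> Z" "k \<in> Z" "l \<in> Z" for i j k l
      unfolding L0.hit_def L1.hit_def by (rule layers_indep[OF T]) (use that lt in blast)+
    show "\<bar>measure M (L0.hit T i \<inter> L0.hit T j) - ?c\<bar> \<le> \<eta>" if "i \<in> Z" "j \<in> Z" "i \<noteq> j" for i j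
    proof -
      have "\<bar>y - ?c\<bar> \<le> \<bar>y - c\<bar>" if "0 \<le> y" "y \<le> 1" for y :: real using that by linarith
      from this[OF measure_nonneg L0.prob_le_1] show ?thesis using \<eta>(2)[OF that] by (rule order_trans)
    qed
  qed simp_all
  moreover have "?B \<in> sets M"
  proof -
    \<comment> \<open>Both families of events are coded as one random subset of \<open>Z\<close>
      times \<open>bool\<close>, so that a condition on three cardinalities becomes a property of a
      single finite set.\<close>
    let ?R = "\<lambda>x (i, b). x \<in> (if b then L0.hit T i else L1.hit T' i)"
    let ?Q = "\<lambda>G. real (card {i \<in> Z. (i, True) \<in> G \<and> (i, False) \<in> G}) * real (card Z) <
      real (card {i \<in> Z. (i, True) \<in> G}) * real (card {i \<in> Z. (i, False) \<in> G}) - \<delta> * (real (card Z))\<^sup>2"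
    have "{x \<in> space M. ?Q {f \<in> Z \<times> UNIV. ?R x f}} \<in> sets M"
    proof (rule L0.finite_pattern_event)
      show "finite (Z \<times> (UNIV :: bool set))" using finZ by simp
      fix f :: "nat \<times> bool"
      obtain i b where f: "f = (i, b)" by (cases f)
      have "{x \<in> space M. ?R x f} = (if b then L0.hit T i else L1.hit T' i)"
        unfolding f L0.hit_def L1.hit_def by auto
      then show "{x \<in> space M. ?R x f} \<in> sets M" using L0.hit_event L1.hit_event finT by simp
    qed
    moreover have "{x \<in> space M. ?Q {f \<in> Z \<times> UNIV. ?R x f}} = ?B"
    proof (rule Collect_cong, rule conj_cong[OF refl])
      fix x
      have "{i \<in> Z. (i, True) \<in> {f \<in> Z \<times> UNIV. ?R x f} \<and> (i, False) \<in> {f \<in> Z \<times> UNIV. ?R x f}} =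
          {i \<in> Z. x \<in> L0.hit T i \<inter> L1.hit T' i}"
        "{i \<in> Z. (i, True) \<in> {f \<in> Z \<times> UNIV. ?R x f}} = {i \<in> Z. x \<in> L0.hit T i}"
        "{i \<in> Z. (i, False) \<in> {f \<in> Z \<times> UNIV. ?R x f}} = {i \<in> Z. x \<in> L1.hit T' i}" by auto
      then show "?Q {f \<in> Z \<times> UNIV. ?R x f} \<longleftrightarrow>
          real (card {i \<in> Z. x \<in> L0.hit T i \<inter> L1.hit T' i}) * real (card Z) <
          real (card {i \<in> Z. x \<in> L0.hit T i}) * real (card {i \<in> Z. x \<in> L1.hit T' i}) - \<delta> * (real (card Z))\<^sup>2"
        by (simp only:)
    qed
    ultimately show ?thesis by simp
  qed
  moreover have "real (card {i \<in> Z. \<exists>t\<in>T. E0 x i t}) * real (card {i \<in> Z. \<exists>t\<in>T'. E1 x i t}) -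
      \<delta> * (real (card Z))\<^sup>2 \<le> real (card {i \<in> Z. (\<exists>t\<in>T. E0 x i t) \<and> (\<exists>t\<in>T'. E1 x i t)}) * real (card Z)"
    if "x \<in> space M - ?B" for x
  proof -
    have x: "x \<in> space M" using that by blast
    have ge: "\<not> real (card {i \<in> Z. x \<in> L0.hit T i \<inter> L1.hit T' i}) * real (card Z) <
      real (card {i \<in> Z. x \<in> L0.hit T i}) * real (card {i \<in> Z. x \<in> L1.hit T' i}) - \<delta> * (real (card Z))\<^sup>2"
      using that by blast
    have eqs: "{i \<in> Z. x \<in> L0.hit T i \<inter> L1.hit T' i} = {i \<in> Z. (\<exists>t\<in>T. E0 x i t) \<and> (\<exists>t\<in>T'. E1 x i t)}"
      "{i \<in> Z. x \<in> L0.hit T i} = {i \<in> Z. \<exists>t\<in>T. E0 x i t}"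
      "{i \<in> Z. x \<in> L1.hit T' i} = {i \<in> Z. \<exists>t\<in>T'. E1 x i t}"
      using x unfolding L0.hit_def L1.hit_def by auto
    from ge show ?thesis unfolding eqs not_less .
  qed
  ultimately show ?thesis by blast
qed

text \<open>Union bound over two untypical layers, a deficient matching and the bad overlaps. The
  classes enter only through their traces on \<open>P\<close>, so 4^|P| pairs (T, T') have to be
  controlled instead of all pairs of colourings; 49 = 24 + 24 + 1.\<close>

lemma linked_failure:
  assumes \<delta>: "\<delta> > 0" and p: "p - 4 * \<delta> > 4 - 2 * sqrt 3"
    and Z: "Z \<subseteq> {..<n}" "2 \<le> card Z" "1 / \<delta> \<le> real (card Z)" and P: "P \<subseteq> {..<n}"
    and \<eta>: "0 \<le> \<eta>"
      "\<And>i j. i \<in> Z \<Longrightarrow> j \<in> Z \<Longrightarrow> i \<noteq> j \<Longrightarrow> measure M {x \<in> space M. E0 x i j \<and> (\<forall>t\<in>P. \<not> E0 x i t)} \<le> \<eta>"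
      "\<And>i j. i \<in> Z \<Longrightarrow> j \<in> Z \<Longrightarrow> i \<noteq> j \<Longrightarrow> measure M {x \<in> space M. E1 x i j \<and> (\<forall>t\<in>P. \<not> E1 x i t)} \<le> \<eta>"
    and \<theta>: "0 \<le> \<theta>" "\<And>T i j. T \<subseteq> P \<Longrightarrow> i \<in> Z \<Longrightarrow> j \<in> Z \<Longrightarrow> i \<noteq> j \<Longrightarrow>
      \<bar>measure M (L0.hit T i \<inter> L0.hit T j) - c T\<bar> \<le> \<theta>"
  shows "\<exists>B\<in>sets M. measure M B \<le> 2 * \<eta> / \<delta> + 49 / (\<delta>\<^sup>2 * real (card Z)) +
      4 ^ card P * ((4 * \<theta> + 8 / real (card Z)) / \<delta>\<^sup>2) \<and>
    (\<forall>x\<in>space M - B. linked n (E0 x) (E1 x) (H x))"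
proof -
  define m where "m = real (card Z)"
  define \<rho> where "\<rho> = (4 * \<theta> + 8 / m) / \<delta>\<^sup>2"
  have finP: "finite P" using P finite_subset[of _ "{..<n}"] by simp
  have Zne: "Z \<noteq> {}" using Z(2) by auto
  have "card Z \<le> n" using card_mono[OF _ Z(1)] by simp
  then have n: "n > 0" using Z(2) by simp
  obtain B0 where B0: "B0 \<in> sets M" "measure M B0 \<le> 24 / (\<delta>\<^sup>2 * m) + \<eta> / \<delta>"
      "\<forall>x\<in>space M - B0. typical_layer (p - 4 * \<delta>) \<delta> n Z P (E0 x)"
    using L0.typical_layer_failure[OF \<delta> Z P \<eta>(1,2)] unfolding m_def by blast
  obtain B1 where B1: "B1 \<in> sets M" "measure M B1 \<le> 24 / (\<delta>\<^sup>2 * m) + \<eta> / \<delta>"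
      "\<forall>x\<in>space M - B1. typical_layer (p - 4 * \<delta>) \<delta> n Z P (E1 x)"
    using L1.typical_layer_failure[OF \<delta> Z P \<eta>(1,3)] unfolding m_def by blast
  obtain B2 where B2: "B2 \<in> sets M" "measure M B2 \<le> 1 / (\<delta>\<^sup>2 * m)"
      "\<forall>x\<in>space M - B2. (p - \<delta>) * real (card Z) \<le> real (card {i \<in> Z. H x i})"
    using matching_failure[OF \<delta> Z(1) Zne] unfolding m_def by blast
  define separated where "separated T T' B \<longleftrightarrow> B \<in> sets M \<and> measure M B \<le> \<rho> \<and> (\<forall>x\<in>space M - B.
      real (card {i \<in> Z. \<exists>t\<in>T. E0 x i t}) * real (card {i \<in> Z. \<exists>t\<in>T'. E1 x i t}) - \<delta> * (real (card Z))\<^sup>2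
      \<le> real (card {i \<in> Z. (\<exists>t\<in>T. E0 x i t) \<and> (\<exists>t\<in>T'. E1 x i t)}) * real (card Z))" for T T' B
  define C where "C T T' = (SOME B. separated T T' B)" for T T'
  have sep: "separated T T' (C T T')" if T: "T \<subseteq> P" "T' \<subseteq> P" for T T'
  proof -
    have "\<exists>B\<in>sets M. measure M B \<le> \<rho> \<and> (\<forall>x\<in>space M - B.
        real (card {i \<in> Z. \<exists>t\<in>T. E0 x i t}) * real (card {i \<in> Z. \<exists>t\<in>T'. E1 x i t}) - \<delta> * (real (card Z))\<^sup>2
        \<le> real (card {i \<in> Z. (\<exists>t\<in>T. E0 x i t) \<and> (\<exists>t\<in>T'. E1 x i t)}) * real (card Z))"
      unfolding \<rho>_def m_def
    proof (rule overlap_failure[OF \<delta> Z(1) Zne _ _ \<theta>(1), where c = "c T"])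
      show "T \<subseteq> {..<n}" by (rule subset_trans[OF T(1) P])
      show "T' \<subseteq> {..<n}" by (rule subset_trans[OF T(2) P])
    qed (rule \<theta>(2)[OF T(1)])
    then have "\<exists>B. separated T T' B" unfolding separated_def by blast
    then show ?thesis unfolding C_def by (rule someI_ex)
  qed
  have Cm: "C T T' \<in> sets M" "measure M (C T T') \<le> \<rho>" if "T \<subseteq> P" "T' \<subseteq> P" for T T'
    using sep[OF that] unfolding separated_def by blast+
  define D where "D = (\<Union>(T, T')\<in>Pow P \<times> Pow P. C T T')"
  have D: "D \<in> sets M" unfolding D_def using finP Cm(1) by (intro sets.finite_UN) auto
  have "measure M D \<le> (\<Sum>(T, T')\<in>Pow P \<times> Pow P. measure M (C T T'))"
    unfolding D_def split_beta using finP Cm(1) by (intro L0.finite_measure_subadditive_finite) auto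
  also have "\<dots> \<le> (\<Sum>(T, T')\<in>Pow P \<times> Pow P. \<rho>)" using Cm(2) by (intro sum_mono) auto
  also have "\<dots> = 4 ^ card P * \<rho>"
    using finP by (simp add: card_cartesian_product card_Pow split_beta power_mult_distrib[symmetric])
  finally have PD: "measure M D \<le> 4 ^ card P * \<rho>" .
  let ?B = "(B0 \<union> B1) \<union> (B2 \<union> D)"
  have "measure M ?B \<le> (measure M B0 + measure M B1) + (measure M B2 + measure M D)"
    using B0(1) B1(1) B2(1) D
    by (intro order_trans[OF measure_Un_le] add_mono measure_Un_le sets.Un)
  also have "\<dots> \<le> 2 * \<eta> / \<delta> + 49 / (\<delta>\<^sup>2 * m) + 4 ^ card P * \<rho>"
    using B0(2) B1(2) B2(2) PD by (simp add: add_divide_distrib)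
  finally have PB: "measure M ?B \<le> 2 * \<eta> / \<delta> + 49 / (\<delta>\<^sup>2 * m) + 4 ^ card P * \<rho>" .
  have "linked n (E0 x) (E1 x) (H x)" if x: "x \<in> space M - ?B" for x
  proof (rule linked_criterion[OF p \<delta> n Z(1) Zne P])
    show "typical_layer (p - 4 * \<delta>) \<delta> n Z P (E0 x)" "typical_layer (p - 4 * \<delta>) \<delta> n Z P (E1 x)"
      using B0(3) B1(3) x by blast+
    have "p - 4 * \<delta> + 3 * \<delta> = p - \<delta>" by simp
    then show "(p - 4 * \<delta> + 3 * \<delta>) * real (card Z) \<le> real (card {i \<in> Z. H x i})"
      using B2(3) x by (simp only:) blast
    show "\<forall>T\<subseteq>P. \<forall>T'\<subseteq>P.
      real (card {i \<in> Z. \<exists>t\<in>T. E0 x i t}) * real (card {i \<in> Z. \<exists>t\<in>T'. E1 x i t}) - \<delta> * (real (card Z))\<^sup>2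
      \<le> real (card {i \<in> Z. (\<exists>t\<in>T. E0 x i t) \<and> (\<exists>t\<in>T'. E1 x i t)}) * real (card Z)"
    proof (intro allI impI)
      fix T T' assume T: "T \<subseteq> P" "T' \<subseteq> P"
      then have "x \<in> space M - C T T'" using x unfolding D_def by blast
      then show "real (card {i \<in> Z. \<exists>t\<in>T. E0 x i t}) * real (card {i \<in> Z. \<exists>t\<in>T'. E1 x i t}) - \<delta> * (real (card Z))\<^sup>2
        \<le> real (card {i \<in> Z. (\<exists>t\<in>T. E0 x i t) \<and> (\<exists>t\<in>T'. E1 x i t)}) * real (card Z)"
        using sep[OF T] unfolding separated_def by blast
    qed
  qed
  moreover have "?B \<in> sets M" using B0(1) B1(1) B2(1) D by (intro sets.Un)
  ultimately show ?thesis using PB unfolding \<rho>_def m_def by blast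
qed

end

text \<open>The order of the constants matters: \<delta> and \<eta> come from the gap and
  \<epsilon>, then the bound \<open>K\<close> on |P|, then \<theta> against the factor 4^K, then m.
  \<open>Z\<close> is found last, inside the set left by the sampling step, because the colours of
  the second Ramsey step are indexed by the subsets of \<open>P\<close>. Both steps have thresholds
  independent of the measure, so one \<open>N\<close> serves all models.\<close>

theorem layer_pair_linked:
  fixes p \<epsilon> :: real
  assumes p: "p > 4 - 2 * sqrt 3" and \<epsilon>: "\<epsilon> > 0"
  shows "\<exists>N. \<forall>n\<ge>N. \<forall>(M::'a measure) E0 E1 H. layer_pair M n p E0 E1 H \<longrightarrow>
    (\<exists>B\<in>sets M. measure M B \<le> \<epsilon> \<and> (\<forall>x\<in>space M - B. linked n (E0 x) (E1 x) (H x)))"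
proof -
  \<comment> \<open>Half of the gap is spent as 4 \<delta>, the other half keeps the inequality
    strict.\<close>
  define \<delta> where "\<delta> = (p - (4 - 2 * sqrt 3)) / 8"
  have \<delta>: "\<delta> > 0" "p - 4 * \<delta> > 4 - 2 * sqrt 3" using p by (simp_all add: \<delta>_def field_simps)
  define \<eta> where "\<eta> = \<epsilon> * \<delta> / 8"
  have \<eta>: "\<eta> > 0" using \<epsilon> \<delta> by (simp add: \<eta>_def)
  \<comment> \<open>The potential is a sum of two probabilities, so it starts at no more than 2 and
    affords at most 2 / \<eta> increments; this bounds |P| by \<open>K\<close>.\<close>
  obtain K :: nat where K: "2 \<le> real K * \<eta>" using reals_Archimedean3[OF \<eta>] by (meson less_imp_le)
  define Q :: real where "Q = 4 ^ K"
  have Q: "Q \<ge> 1" by (simp add: Q_def)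
  define \<theta> where "\<theta> = \<epsilon> * \<delta>\<^sup>2 / (16 * Q)"
  have \<theta>: "\<theta> > 0" using \<epsilon> \<delta> Q by (simp add: \<theta>_def)
  \<comment> \<open>196 = 4 * 49 and 32 = 4 * 8: each of the two error terms decaying in m is pushed
    below \<epsilon> / 4.\<close>
  obtain m :: nat where m: "real m \<ge> 2 + 1 / \<delta> + 196 / (\<epsilon> * \<delta>\<^sup>2) + 32 * Q / (\<epsilon> * \<delta>\<^sup>2)"
    using real_arch_simple by blast
  have mpos: "0 \<le> 1 / \<delta>" "0 \<le> 196 / (\<epsilon> * \<delta>\<^sup>2)" "0 \<le> 32 * Q / (\<epsilon> * \<delta>\<^sup>2)" using \<delta> \<epsilon> Q by simp_all
  then have m2: "2 \<le> m" "1 / \<delta> \<le> real m" "196 / (\<epsilon> * \<delta>\<^sup>2) \<le> real m" "32 * Q / (\<epsilon> * \<delta>\<^sup>2) \<le> real m"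
    using m by linarith+
  obtain N1 where N1: "\<forall>(V::nat set) (A :: nat set) (\<alpha> :: nat set \<Rightarrow> nat \<Rightarrow> nat \<Rightarrow> real).
           finite V \<and> card V \<ge> N1 \<and> finite A \<and> card A \<le> K \<and>
           (\<forall>T i j. 0 \<le> \<alpha> T i j \<and> \<alpha> T i j \<le> 1) \<and> (\<forall>T i j. \<alpha> T i j = \<alpha> T j i) \<longrightarrow>
           (\<exists>Z\<subseteq>V. card Z = m \<and> (\<exists>c. \<forall>T\<subseteq>A. \<forall>i\<in>Z. \<forall>j\<in>Z. i \<noteq> j \<longrightarrow> \<bar>\<alpha> T i j - c T\<bar> \<le> \<theta>))"
    using gram_homogeneous_subset[OF \<theta>, where k = K and m = m] ..
  obtain N where N: "\<forall>(V::nat set) (P0::nat set) (q :: nat \<Rightarrow> nat set \<Rightarrow> real).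
           finite V \<and> card V \<ge> N \<and> V \<inter> P0 = {} \<and> finite P0 \<and> (\<forall>i P. 0 \<le> q i P) \<and>
           (\<forall>i\<in>V. q i P0 \<le> real K * \<eta>) \<longrightarrow>
           (\<exists>P Z. P \<subseteq> P0 \<union> V \<and> Z \<subseteq> V \<and> P \<inter> Z = {} \<and> finite P \<and> card P \<le> card P0 + K \<and> card Z = N1 \<and>
              (\<forall>i\<in>Z. \<forall>j\<in>Z. i \<noteq> j \<longrightarrow> q i P - q i (insert j P) \<le> \<eta>))"
    using sampling_set_exists[OF \<eta>, where k = K and m = N1] ..
  show ?thesis
  proof (intro exI[of _ N] allI impI)
    fix n and M :: "'a measure" and E0 E1 H
    assume n: "N \<le> n" and "layer_pair M n p E0 E1 H"
    then interpret layer_pair M n p E0 E1 H by blast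
    \<comment> \<open>Adding the two layers lets one set \<open>P\<close> serve both: each drop is
      non-negative, so a bound on the sum bounds either one.\<close>
    define q where "q i T = measure M {x \<in> space M. \<forall>t\<in>T. \<not> E0 x i t} + measure M {x \<in> space M. \<forall>t\<in>T. \<not> E1 x i t}" for i T
    have "q i {} \<le> real K * \<eta>" for i
    proof -
      have "q i {} \<le> 1 + 1" unfolding q_def by (intro add_mono L0.prob_le_1)
      then show ?thesis using K by linarith
    qed
    moreover have "0 \<le> q i T" for i T by (simp add: q_def)
    ultimately obtain P V where PV: "P \<subseteq> {} \<union> {..<n}" "V \<subseteq> {..<n}" "finite P" "card P \<le> card ({}::nat set) + K"
        "card V = N1" "\<forall>i\<in>V. \<forall>j\<in>V. i \<noteq> j \<longrightarrow> q i P - q i (insert j P) \<le> \<eta>"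
      using N[rule_format, of "{..<n}" "{}" q] n by auto
    have finV: "finite V" by (rule finite_subset[OF PV(2)]) simp
    obtain Z c where Zc: "Z \<subseteq> V" "card Z = m"
        "\<forall>T\<subseteq>P. \<forall>i\<in>Z. \<forall>j\<in>Z. i \<noteq> j \<longrightarrow> \<bar>measure M (L0.hit T i \<inter> L0.hit T j) - c T\<bar> \<le> \<theta>"
      using N1[rule_format, of V P "\<lambda>T i j. measure M (L0.hit T i \<inter> L0.hit T j)"] finV PV(3-5)
      by (auto simp: Int_commute)
    have miss: "measure M {x \<in> space M. E0 x i j \<and> (\<forall>t\<in>P. \<not> E0 x i t)} \<le> \<eta>"
        "measure M {x \<in> space M. E1 x i j \<and> (\<forall>t\<in>P. \<not> E1 x i t)} \<le> \<eta>"
      if "i \<in> Z" "j \<in> Z" "i \<noteq> j" for i j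
    proof -
      have "q i P - q i (insert j P) \<le> \<eta>" using PV(6) that Zc(1) by blast
      then have "measure M {x \<in> space M. E0 x i j \<and> (\<forall>t\<in>P. \<not> E0 x i t)} +
          measure M {x \<in> space M. E1 x i j \<and> (\<forall>t\<in>P. \<not> E1 x i t)} \<le> \<eta>"
        unfolding q_def L0.missed_prob_eq[OF PV(3)] L1.missed_prob_eq[OF PV(3)] by linarith
      then show "measure M {x \<in> space M. E0 x i j \<and> (\<forall>t\<in>P. \<not> E0 x i t)} \<le> \<eta>"
          "measure M {x \<in> space M. E1 x i j \<and> (\<forall>t\<in>P. \<not> E1 x i t)} \<le> \<eta>"
        using measure_nonneg[of M "{x \<in> space M. E0 x i j \<and> (\<forall>t\<in>P. \<not> E0 x i t)}"]
          measure_nonneg[of M "{x \<in> space M. E1 x i j \<and> (\<forall>t\<in>P. \<not> E1 x i t)}"] by linarith+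
    qed
    have "\<exists>B\<in>sets M. measure M B \<le> 2 * \<eta> / \<delta> + 49 / (\<delta>\<^sup>2 * real (card Z)) +
        4 ^ card P * ((4 * \<theta> + 8 / real (card Z)) / \<delta>\<^sup>2) \<and> (\<forall>x\<in>space M - B. linked n (E0 x) (E1 x) (H x))"
    proof (rule linked_failure[OF \<delta>])
      show "Z \<subseteq> {..<n}" using Zc(1) PV(2) by blast
      show "2 \<le> card Z" "1 / \<delta> \<le> real (card Z)" using Zc(2) m2 by simp_all
      show "P \<subseteq> {..<n}" using PV(1) by simp
      show "0 \<le> \<eta>" "0 \<le> \<theta>" using \<eta> \<theta> by simp_all
      show "\<bar>measure M (L0.hit T i \<inter> L0.hit T j) - c T\<bar> \<le> \<theta>"
        if "T \<subseteq> P" "i \<in> Z" "j \<in> Z" "i \<noteq> j" for T i j using Zc(3) that by blast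
    qed (fact miss)+
    then obtain B where B: "B \<in> sets M" "\<forall>x\<in>space M - B. linked n (E0 x) (E1 x) (H x)"
      "measure M B \<le> 2 * \<eta> / \<delta> + 49 / (\<delta>\<^sup>2 * real m) + 4 ^ card P * ((4 * \<theta> + 8 / real m) / \<delta>\<^sup>2)"
      using Zc(2) by blast
    have "2 * \<eta> / \<delta> = \<epsilon> / 4" using \<delta> by (simp add: \<eta>_def)
    moreover have "49 / (\<delta>\<^sup>2 * real m) \<le> \<epsilon> / 4"
      using m2(1,3) \<delta>(1) \<epsilon> by (simp add: field_simps)
    moreover have "4 ^ card P * ((4 * \<theta> + 8 / real m) / \<delta>\<^sup>2) \<le> \<epsilon> / 2"
    proof -
      have "(4::real) ^ card P \<le> Q" unfolding Q_def using PV(4) by (intro power_increasing) auto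
      moreover have "0 \<le> (4 * \<theta> + 8 / real m) / \<delta>\<^sup>2" using \<theta> by (intro divide_nonneg_nonneg) auto
      ultimately have "4 ^ card P * ((4 * \<theta> + 8 / real m) / \<delta>\<^sup>2) \<le> Q * ((4 * \<theta> + 8 / real m) / \<delta>\<^sup>2)"
        by (rule mult_right_mono)
      also have "\<dots> = Q * 4 * \<theta> / \<delta>\<^sup>2 + 8 * Q / (real m * \<delta>\<^sup>2)" by (simp add: add_divide_distrib distrib_left mult_ac)
      also have "Q * 4 * \<theta> / \<delta>\<^sup>2 = \<epsilon> / 4" using Q \<delta>(1) by (simp add: \<theta>_def)
      also have "8 * Q / (real m * \<delta>\<^sup>2) \<le> \<epsilon> / 4" using m2(1,4) \<delta>(1) \<epsilon> by (simp add: field_simps)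
      finally show ?thesis by simp
    qed
    ultimately have "measure M B \<le> \<epsilon>" using B(3) by linarith
    then show "\<exists>B\<in>sets M. measure M B \<le> \<epsilon> \<and> (\<forall>x\<in>space M - B. linked n (E0 x) (E1 x) (H x))"
      using B(1,2) by blast
  qed
qed

section \<open>The shell construction\<close>

definition max_norm :: "int \<times> int \<Rightarrow> int" where
  "max_norm v = max \<bar>fst v\<bar> \<bar>snd v\<bar>"

definition lattice_adj :: "int \<times> int \<Rightarrow> int \<times> int \<Rightarrow> bool" where
  "lattice_adj u v \<longleftrightarrow> \<bar>fst u - fst v\<bar> + \<bar>snd u - snd v\<bar> = 1"

lemma lattice_adj_sym: "lattice_adj u v \<longleftrightarrow> lattice_adj v u"
  by (auto simp: lattice_adj_def abs_minus_commute)

lemma max_norm_adj: "lattice_adj u v \<Longrightarrow> \<bar>max_norm u - max_norm v\<bar> \<le> 1"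
  unfolding lattice_adj_def max_norm_def by linarith

text \<open>A vertex of shell k + 1 has an inner neighbour only across the side on which it lies,
  and a corner has none. So a path that has stepped outward onto such a vertex can step inward only
  to where it came from.\<close>

lemma inner_neighbour_unique:
  assumes "lattice_adj u w" "lattice_adj v w" "max_norm u = k" "max_norm v = k" "max_norm w = k + 1"
  shows "u = v"
proof -
  have *: "(\<bar>fst z\<bar> = k + 1 \<longrightarrow> False) \<and> (\<bar>snd z\<bar> = k + 1 \<longrightarrow> False) \<and> \<bar>fst z\<bar> \<le> k \<and> \<bar>snd z\<bar> \<le> k"
    if "max_norm z = k" for z using that unfolding max_norm_def by linarith
  note bu = *[OF assms(3)] and bv = *[OF assms(4)]
  have w: "fst w = k + 1 \<or> fst w = - k - 1 \<or> snd w = k + 1 \<or> snd w = - k - 1"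
    using assms(5) unfolding max_norm_def by linarith
  have "fst z = k \<and> snd z = snd w" if "fst w = k + 1" "\<bar>fst z\<bar> \<le> k" "lattice_adj z w" for z
    using that unfolding lattice_adj_def by linarith
  moreover have "fst z = - k \<and> snd z = snd w" if "fst w = - k - 1" "\<bar>fst z\<bar> \<le> k" "lattice_adj z w" for z
    using that unfolding lattice_adj_def by linarith
  moreover have "snd z = k \<and> fst z = fst w" if "snd w = k + 1" "\<bar>snd z\<bar> \<le> k" "lattice_adj z w" for z
    using that unfolding lattice_adj_def by linarith
  moreover have "snd z = - k \<and> fst z = fst w" if "snd w = - k - 1" "\<bar>snd z\<bar> \<le> k" "lattice_adj z w" for z
    using that unfolding lattice_adj_def by linarith
  ultimately have "fst u = fst v \<and> snd u = snd v"
    using w bu bv assms(1,2) by metis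
  then show ?thesis by (simp add: prod_eq_iff)
qed

text \<open>\<open>x\<close> is the inner endpoint. A path leaving a shell 0 modulo 3 outward enters
  the next shell only at vertices with bit True, stays on True there, and reaches only True vertices
  of the following shell; those have no open edge within their shell or outward. This is the whole
  barrier.\<close>

definition shell_open :: "((int \<times> int) \<times> nat \<Rightarrow> bool) \<Rightarrow> (int \<times> int) \<times> nat \<Rightarrow> (int \<times> int) \<times> nat \<Rightarrow> bool" where
  "shell_open \<omega> x y \<longleftrightarrow>
     (let a = max_norm (fst x); b = max_norm (fst y) in
       (a = b \<and> (a mod 3 = 0 \<or> a mod 3 = 1 \<and> \<omega> x = \<omega> y \<or> a mod 3 = 2 \<and> \<not> \<omega> x \<and> \<not> \<omega> y)) \<or>
       (b = a + 1 \<and> (a mod 3 = 0 \<and> \<omega> y \<or> a mod 3 = 1 \<and> (\<omega> x \<longrightarrow> \<omega> y) \<or> a mod 3 = 2 \<and> \<not> \<omega> x)))"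

definition shell_config :: "((int \<times> int) \<times> nat) set set \<Rightarrow> ((int \<times> int) \<times> nat \<Rightarrow> bool) \<Rightarrow> ((int \<times> int) \<times> nat) set set" where
  "shell_config E \<omega> = {e \<in> E. \<exists>x y. e = {x, y} \<and> shell_open \<omega> x y}"

text \<open>With t = (3 - sqrt 3) / 2 and r = 2 - sqrt 3, three probabilities equal 4 - 2 sqrt 3:
  equal bits in a shell 1 modulo 3, t^2 + (1 - t)^2; two False bits in a shell 2 modulo 3, (1 -
  r)^2; and an edge between these shells, 1 - t (1 - r). The value 1 / 2 is a default.\<close>

definition shell_param :: "(int \<times> int) \<times> nat \<Rightarrow> real" where
  "shell_param x = (if max_norm (fst x) mod 3 = 1 then (3 - sqrt 3) / 2
     else if max_norm (fst x) mod 3 = 2 then 2 - sqrt 3 else 1 / 2)"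

text \<open>The invariant that a path starting at norm at most 3 M preserves. The last clause
  remembers that the inner neighbour of a reached vertex of shell 3 M + 2 is True: the edge from a
  True outer to a False inner vertex is open, so without the clause a step back could land on
  False.\<close>

definition inside :: "((int \<times> int) \<times> nat \<Rightarrow> bool) \<Rightarrow> int \<Rightarrow> (int \<times> int) \<times> nat \<Rightarrow> bool" where
  "inside \<omega> M x \<longleftrightarrow> max_norm (fst x) \<le> 3 * M \<or> (max_norm (fst x) = 3 * M + 1 \<and> \<omega> x) \<or>
     (max_norm (fst x) = 3 * M + 2 \<and> \<omega> x \<and>
       (\<exists>u. lattice_adj u (fst x) \<and> max_norm u = 3 * M + 1 \<and> \<omega> (u, snd x)))"

lemma Z2K_E_iff:
  "{x, y} \<in> Z2K_E n \<longleftrightarrow> snd x < n \<and> snd y < n \<and>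
     (fst x = fst y \<and> snd x \<noteq> snd y \<or> snd x = snd y \<and> lattice_adj (fst x) (fst y))"
  (is "_ \<longleftrightarrow> ?R x y")
proof
  assume "{x, y} \<in> Z2K_E n"
  then obtain u v i j where e: "{x, y} = {(u, i), (v, j)}" and ij: "i < n" "j < n"
      and r: "u = v \<and> i \<noteq> j \<or> i = j \<and> lattice_adj u v"
    unfolding Z2K_E_def lattice_adj_def by blast
  from e consider "x = (u, i)" "y = (v, j)" | "x = (v, j)" "y = (u, i)" by (meson doubleton_eq_iff)
  then show "?R x y"
  proof cases
    case 1
    then show ?thesis using ij r by simp
  next
    case 2
    then show ?thesis using ij r lattice_adj_sym[of v u] by (metis fst_conv snd_conv)
  qed
next
  assume r: "?R x y"
  show "{x, y} \<in> Z2K_E n" unfolding Z2K_E_def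
  proof (intro CollectI exI conjI)
    show "{x, y} = {(fst x, snd x), (fst y, snd y)}" by simp
    show "(fst x = fst y \<and> snd x \<noteq> snd y) \<or> (snd x = snd y \<and>
        \<bar>fst (fst x) - fst (fst y)\<bar> + \<bar>snd (fst x) - snd (fst y)\<bar> = 1)"
      using r unfolding lattice_adj_def by blast
  qed (use r in blast)+
qed

lemma inside_closed:
  assumes "{x, y} \<in> shell_config (Z2K_E n) \<omega>" "inside \<omega> M x"
  shows "inside \<omega> M y"
proof -
  have E: "{x, y} \<in> Z2K_E n" using assms(1) by (simp add: shell_config_def)
  obtain x' y' where "{x, y} = {x', y'}" "shell_open \<omega> x' y'"
    using assms(1) unfolding shell_config_def by blast
  then have o: "shell_open \<omega> x y \<or> shell_open \<omega> y x" by (metis doubleton_eq_iff)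
  have cases: "fst x = fst y \<and> snd x \<noteq> snd y \<or> snd x = snd y \<and> lattice_adj (fst x) (fst y)"
    using E by (simp add: Z2K_E_iff)
  define a where "a = max_norm (fst x)"
  define b where "b = max_norm (fst y)"
  have o': "(a = b \<and> (a mod 3 = 0 \<or> a mod 3 = 1 \<and> \<omega> x = \<omega> y \<or> a mod 3 = 2 \<and> \<not> \<omega> x \<and> \<not> \<omega> y)) \<or>
       (b = a + 1 \<and> (a mod 3 = 0 \<and> \<omega> y \<or> a mod 3 = 1 \<and> (\<omega> x \<longrightarrow> \<omega> y) \<or> a mod 3 = 2 \<and> \<not> \<omega> x)) \<or>
       (a = b + 1 \<and> (b mod 3 = 0 \<and> \<omega> x \<or> b mod 3 = 1 \<and> (\<omega> y \<longrightarrow> \<omega> x) \<or> b mod 3 = 2 \<and> \<not> \<omega> y))"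
    using o unfolding shell_open_def Let_def a_def[symmetric] b_def[symmetric]
    by (elim disjE conjE) auto
  have in_x: "a \<le> 3 * M \<or> (a = 3 * M + 1 \<and> \<omega> x) \<or> (a = 3 * M + 2 \<and> \<omega> x \<and>
       (\<exists>u. lattice_adj u (fst x) \<and> max_norm u = 3 * M + 1 \<and> \<omega> (u, snd x)))"
    using assms(2) by (simp add: inside_def a_def)
  have goal: "inside \<omega> M y \<longleftrightarrow> b \<le> 3 * M \<or> (b = 3 * M + 1 \<and> \<omega> y) \<or> (b = 3 * M + 2 \<and> \<omega> y \<and>
       (\<exists>u. lattice_adj u (fst y) \<and> max_norm u = 3 * M + 1 \<and> \<omega> (u, snd y)))"
    by (simp add: inside_def b_def)
  have m: "(3 * M) mod 3 = 0" "(3 * M + 1) mod 3 = 1" "(3 * M + 2) mod 3 = 2" by presburger+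
  have near: "\<bar>a - b\<bar> \<le> 1" using o' by linarith
  from in_x consider "a \<le> 3 * M" | "a = 3 * M + 1" "\<omega> x"
    | "a = 3 * M + 2" "\<omega> x" "\<exists>u. lattice_adj u (fst x) \<and> max_norm u = 3 * M + 1 \<and> \<omega> (u, snd x)"
    by blast
  then show ?thesis
  proof cases
    case 1
    then consider "b \<le> 3 * M" | "a = 3 * M" "b = 3 * M + 1" using near by linarith
    then show ?thesis
    proof cases
      case 1
      then show ?thesis unfolding goal by simp
    next
      case 2
      then have "\<omega> y" using o' m(1) by simp
      then show ?thesis unfolding goal using 2 by simp
    qed
  next
    case 2
    consider "b = 3 * M" | "b = 3 * M + 1" | "b = 3 * M + 2" using near 2 by linarith
    then show ?thesis
    proof cases
      case 1
      then show ?thesis unfolding goal by simp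
    next
      case b: 2
      have "\<omega> x = \<omega> y" using o' unfolding b 2(1) m(2) by simp
      then show ?thesis unfolding goal using 2(2) b by simp
    next
      case b: 3
      have "\<omega> y" using o' 2(2) unfolding b 2(1) m(2) by simp
      moreover have "fst x \<noteq> fst y" using 2(1) b unfolding a_def b_def by auto
      then have "snd x = snd y" "lattice_adj (fst x) (fst y)" using cases by blast+
      then have "lattice_adj (fst x) (fst y) \<and> max_norm (fst x) = 3 * M + 1 \<and> \<omega> (fst x, snd y)"
        using 2 unfolding a_def by (metis prod.collapse)
      ultimately show ?thesis unfolding goal using b by blast
    qed
  next
    case 3
    then obtain u where u: "lattice_adj u (fst x)" "max_norm u = 3 * M + 1" "\<omega> (u, snd x)" by blast
    consider "b = 3 * M + 1" | "b = 3 * M + 2" | "b = 3 * M + 3" using near 3(1) by linarith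
    then have b: "b = 3 * M + 1"
    proof cases
      case b: 2
      then show ?thesis using o' 3(2) unfolding b 3(1) m(3) by simp
    next
      case b: 3
      then show ?thesis using o' 3(2) unfolding b 3(1) m(3) by simp
    qed
    then have "fst x \<noteq> fst y" using 3(1) unfolding a_def b_def by auto
    then have y: "snd x = snd y" "lattice_adj (fst y) (fst x)" using cases lattice_adj_sym by blast+
    \<comment> \<open>A True vertex of shell 3 M + 2 can be left only inward, and uniqueness
      identifies the vertex reached with the witness \<open>u\<close>.\<close>
    have "u = fst y" using inner_neighbour_unique[OF u(1) y(2) u(2)] b 3(1) unfolding a_def b_def by simp
    then have "\<omega> y" using u(3) y(1) by simp
    then show ?thesis unfolding goal using b by blast
  qed
qed

lemma shell_config_finite_components: "\<not> has_infinite_component (Z2K_V n) (shell_config (Z2K_E n) \<omega>)"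
proof
  assume "has_infinite_component (Z2K_V n) (shell_config (Z2K_E n) \<omega>)"
  then obtain v where v: "v \<in> Z2K_V n"
      and inf: "infinite {w. (\<lambda>x y. {x, y} \<in> shell_config (Z2K_E n) \<omega>)\<^sup>*\<^sup>* v w}"
    by (auto simp: has_infinite_component_def)
  define M where "M = max_norm (fst v)"
  define K where "K = 3 * M + 2"
  have "M \<ge> 0" by (simp add: M_def max_norm_def)
  then have "inside \<omega> M v" by (simp add: inside_def M_def)
  have reach: "inside \<omega> M w \<and> snd w < n" if "(\<lambda>x y. {x, y} \<in> shell_config (Z2K_E n) \<omega>)\<^sup>*\<^sup>* v w" for w
    using that
  proof (induction rule: rtranclp_induct)
    case base
    then show ?case using v \<open>inside \<omega> M v\<close> by (auto simp: Z2K_V_def)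
  next
    case (step y z)
    then have "{y, z} \<in> Z2K_E n" by (simp add: shell_config_def)
    then have "snd z < n" by (simp add: Z2K_E_iff)
    moreover have "inside \<omega> M z" using inside_closed[OF step.hyps(2)] step.IH by blast
    ultimately show ?case by blast
  qed
  have "w \<in> ({-K..K} \<times> {-K..K}) \<times> {..<n}" if "inside \<omega> M w" "snd w < n" for w
  proof -
    have "max_norm (fst w) \<le> K" using that(1) by (auto simp: inside_def K_def)
    then have "\<bar>fst (fst w)\<bar> \<le> K" "\<bar>snd (fst w)\<bar> \<le> K" by (simp_all add: max_norm_def)
    then show ?thesis using that(2) by (simp add: mem_Times_iff abs_le_iff)
  qed
  then have "{w. (\<lambda>x y. {x, y} \<in> shell_config (Z2K_E n) \<omega>)\<^sup>*\<^sup>* v w} \<subseteq> ({-K..K} \<times> {-K..K}) \<times> {..<n}"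
    using reach by blast
  then have "finite {w. (\<lambda>x y. {x, y} \<in> shell_config (Z2K_E n) \<omega>)\<^sup>*\<^sup>* v w}"
    by (rule finite_subset) simp
  with inf show False by contradiction
qed

section \<open>The shell model as a 1-independent measure\<close>

definition shell_space :: "((int \<times> int) \<times> nat) set \<Rightarrow> ((int \<times> int) \<times> nat \<Rightarrow> bool) measure" where
  "shell_space K = PiM K (\<lambda>x. measure_pmf (bernoulli_pmf (shell_param x)))"

definition shell_measure :: "nat \<Rightarrow> ((int \<times> int) \<times> nat) set set measure" where
  "shell_measure n = distr (shell_space (Z2K_V n)) (edge_space (Z2K_E n)) (shell_config (Z2K_E n))"

lemma space_edge_space: "space (edge_space E) = Pow E"
  by (simp add: edge_space_def space_measure_of_conv)

lemma sets_edge_space: "sets (edge_space E) = sigma_sets (Pow E) ((\<lambda>e. {S \<in> Pow E. e \<in> S}) ` E)"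
  unfolding edge_space_def by (rule sets_measure_of) auto

lemma edge_present_sets: "e \<in> E \<Longrightarrow> {S \<in> Pow E. e \<in> S} \<in> sets (edge_space E)"
  unfolding sets_edge_space by (rule sigma_sets.Basic) blast

lemma measurable_edge_space:
  assumes "\<And>x. x \<in> space M \<Longrightarrow> f x \<subseteq> E" "\<And>e. e \<in> E \<Longrightarrow> {x \<in> space M. e \<in> f x} \<in> sets M"
  shows "f \<in> M \<rightarrow>\<^sub>M edge_space E"
  unfolding edge_space_def
proof (rule measurable_measure_of)
  fix y assume "y \<in> (\<lambda>e. {S \<in> Pow E. e \<in> S}) ` E"
  then obtain e where e: "e \<in> E" "y = {S \<in> Pow E. e \<in> S}" by blast
  then have "f -` y \<inter> space M = {x \<in> space M. e \<in> f x}" using assms(1) by blast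
  then show "f -` y \<inter> space M \<in> sets M" using assms(2) e by simp
next
  show "(\<lambda>e. {S \<in> Pow E. e \<in> S}) ` E \<subseteq> Pow (Pow E)" by blast
  show "f \<in> space M \<rightarrow> Pow E" using assms(1) by blast
qed

lemma measurable_Int_edge_space:
  assumes "A \<subseteq> E"
  shows "(\<lambda>S. S \<inter> A) \<in> edge_space E \<rightarrow>\<^sub>M edge_space A"
proof (rule measurable_edge_space)
  fix e assume "e \<in> A"
  then have "{S \<in> space (edge_space E). e \<in> S \<inter> A} = {S \<in> Pow E. e \<in> S}"
    by (auto simp: space_edge_space)
  then show "{S \<in> space (edge_space E). e \<in> S \<inter> A} \<in> sets (edge_space E)"
    using edge_present_sets[OF subsetD[OF assms \<open>e \<in> A\<close>]] by (simp only:)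
qed simp

lemma prob_space_shell_space: "prob_space (shell_space K)"
  unfolding shell_space_def by (rule prob_space_PiM) (rule prob_space_measure_pmf)

lemma shell_space_atom:
  assumes "x \<in> K" "y \<in> K"
  shows "{\<omega> \<in> space (shell_space K). \<omega> x = b \<and> \<omega> y = b'} \<in> sets (shell_space K)"
proof -
  have *: "{\<omega> \<in> space (shell_space K). \<omega> z = c} \<in> sets (shell_space K)" if "z \<in> K" for z c
  proof -
    have "(\<lambda>\<omega>. \<omega> z) \<in> shell_space K \<rightarrow>\<^sub>M measure_pmf (bernoulli_pmf (shell_param z))"
      unfolding shell_space_def by (rule measurable_component_singleton[OF that])
    then have "(\<lambda>\<omega>. \<omega> z) -` {c} \<inter> space (shell_space K) \<in> sets (shell_space K)"
      by (rule measurable_sets) simp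
    moreover have "(\<lambda>\<omega>. \<omega> z) -` {c} \<inter> space (shell_space K) = {\<omega> \<in> space (shell_space K). \<omega> z = c}"
      by blast
    ultimately show ?thesis by simp
  qed
  have "{\<omega> \<in> space (shell_space K). \<omega> x = b \<and> \<omega> y = b'} =
      {\<omega> \<in> space (shell_space K). \<omega> x = b} \<inter> {\<omega> \<in> space (shell_space K). \<omega> y = b'}" by blast
  then show ?thesis using * assms by simp
qed

lemma shell_space_atom_prob:
  assumes "x \<in> K" "y \<in> K" "x \<noteq> y"
  shows "measure (shell_space K) {\<omega> \<in> space (shell_space K). \<omega> x = b \<and> \<omega> y = b'} =
    pmf (bernoulli_pmf (shell_param x)) b * pmf (bernoulli_pmf (shell_param y)) b'"
proof -
  let ?M = "\<lambda>x. measure_pmf (bernoulli_pmf (shell_param x))"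
  let ?X = "\<lambda>z. if z = x then {b} else {b'}"
  interpret product_prob_space ?M K by (rule product_prob_spaceI) (rule prob_space_measure_pmf)
  have "{\<omega> \<in> space (shell_space K). \<omega> x = b \<and> \<omega> y = b'} = prod_emb K ?M {x, y} (PiE {x, y} ?X)"
    unfolding prod_emb_def shell_space_def space_PiM vimage_def mem_Collect_eq restrict_PiE_iff
    using assms(3) by (intro set_eqI) (simp add: conj_ac)
  then have "measure (shell_space K) {\<omega> \<in> space (shell_space K). \<omega> x = b \<and> \<omega> y = b'} =
      (\<Prod>z\<in>{x, y}. measure (?M z) (?X z))"
    unfolding shell_space_def using assms by (simp add: measure_PiM_emb)
  also have "\<dots> = measure (?M x) {b} * measure (?M y) {b'}" using assms(3) by simp
  finally show ?thesis by (simp add: pmf.rep_eq)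
qed

lemma shell_space_event:
  assumes "x \<in> K" "y \<in> K"
  shows "{\<omega> \<in> space (shell_space K). Q (\<omega> x) (\<omega> y)} \<in> sets (shell_space K)"
proof -
  have "{\<omega> \<in> space (shell_space K). Q (\<omega> x) (\<omega> y)} =
      (\<Union>(b, b')\<in>{(b, b'). Q b b'}. {\<omega> \<in> space (shell_space K). \<omega> x = b \<and> \<omega> y = b'})" by blast
  also have "\<dots> \<in> sets (shell_space K)"
    by (rule sets.finite_UN) (use shell_space_atom[OF assms] in auto)
  finally show ?thesis .
qed

lemma shell_space_event_prob:
  assumes "x \<in> K" "y \<in> K" "x \<noteq> y" "0 \<le> shell_param x" "shell_param x \<le> 1" "0 \<le> shell_param y" "shell_param y \<le> 1"
  shows "measure (shell_space K) {\<omega> \<in> space (shell_space K). Q (\<omega> x) (\<omega> y)} =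
    (if Q True True then shell_param x * shell_param y else 0) +
    (if Q True False then shell_param x * (1 - shell_param y) else 0) +
    (if Q False True then (1 - shell_param x) * shell_param y else 0) +
    (if Q False False then (1 - shell_param x) * (1 - shell_param y) else 0)"
proof -
  interpret prob_space "shell_space K" by (rule prob_space_shell_space)
  let ?A = "\<lambda>(b, b'). {\<omega> \<in> space (shell_space K). \<omega> x = b \<and> \<omega> y = b'}"
  let ?S = "{(b, b'). Q b b'}"
  have "{\<omega> \<in> space (shell_space K). Q (\<omega> x) (\<omega> y)} = (\<Union>p\<in>?S. ?A p)" by blast
  then have "prob {\<omega> \<in> space (shell_space K). Q (\<omega> x) (\<omega> y)} = (\<Sum>p\<in>?S. prob (?A p))"
  proof (simp only:, intro finite_measure_finite_Union)
    show "finite ?S" by simp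
    show "?A ` ?S \<subseteq> events"
      using shell_space_atom[OF assms(1,2)] by (intro image_subsetI) (simp add: split_beta)
    show "disjoint_family_on ?A ?S" unfolding disjoint_family_on_def by blast
  qed
  also have "\<dots> = (\<Sum>p\<in>?S. pmf (bernoulli_pmf (shell_param x)) (fst p) * pmf (bernoulli_pmf (shell_param y)) (snd p))"
    using shell_space_atom_prob[OF assms(1-3)] by (intro sum.cong) auto
  also have "\<dots> = (\<Sum>p\<in>UNIV. if Q (fst p) (snd p) then
      pmf (bernoulli_pmf (shell_param x)) (fst p) * pmf (bernoulli_pmf (shell_param y)) (snd p) else 0)"
    by (subst sum.inter_filter[symmetric]) (auto intro!: sum.cong)
  also have "(UNIV :: (bool \<times> bool) set) = {(True, True), (True, False), (False, True), (False, False)}" by auto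
  finally show ?thesis using assms by simp
qed

text \<open>Orients an edge with the inner endpoint first, which is the order in which
  \<open>shell_open\<close> reads it.\<close>

lemma Z2K_E_cases:
  assumes "e \<in> Z2K_E n"
  obtains x y where "e = {x, y}" "x \<noteq> y" "x \<in> Z2K_V n" "y \<in> Z2K_V n"
    "max_norm (fst y) = max_norm (fst x) \<or> max_norm (fst y) = max_norm (fst x) + 1"
proof -
  obtain u v i j where "e = {(u, i), (v, j)}" using assms unfolding Z2K_E_def by blast
  then obtain x y where e: "e = {x, y}" by blast
  have r: "snd x < n" "snd y < n" "fst x = fst y \<and> snd x \<noteq> snd y \<or> snd x = snd y \<and> lattice_adj (fst x) (fst y)"
    using assms unfolding e Z2K_E_iff by blast+
  have ne: "x \<noteq> y" using r(3) by (auto simp: lattice_adj_def)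
  have V: "x \<in> Z2K_V n" "y \<in> Z2K_V n" using r(1,2) by (simp_all add: Z2K_V_def mem_Times_iff)
  have "\<bar>max_norm (fst x) - max_norm (fst y)\<bar> \<le> 1" using r(3) max_norm_adj[of "fst x" "fst y"] by auto
  then consider "max_norm (fst y) = max_norm (fst x) \<or> max_norm (fst y) = max_norm (fst x) + 1"
    | "max_norm (fst x) = max_norm (fst y) \<or> max_norm (fst x) = max_norm (fst y) + 1" by linarith
  then show ?thesis
  proof cases
    case 1
    then show ?thesis using that[OF e ne V] by blast
  next
    case 2
    have "e = {y, x}" using e by blast
    then show ?thesis using that[of y x] ne V 2 by blast
  qed
qed

lemma sqrt3_bounds: "17/10 < sqrt (3::real)" "sqrt (3::real) < 7/4"
proof -
  show "17/10 < sqrt (3::real)" by (rule real_less_rsqrt) (simp add: power2_eq_square)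
  show "sqrt (3::real) < 7/4" by (rule real_less_lsqrt) (simp_all add: power2_eq_square)
qed

lemma shell_param_range: "0 \<le> shell_param x" "shell_param x \<le> 1"
  using sqrt3_bounds by (auto simp: shell_param_def)

lemma shell_open_prob:
  assumes "x \<in> K" "y \<in> K" "x \<noteq> y"
    and near: "max_norm (fst y) = max_norm (fst x) \<or> max_norm (fst y) = max_norm (fst x) + 1"
  shows "4 - 2 * sqrt 3 \<le> measure (shell_space K) {\<omega> \<in> space (shell_space K). shell_open \<omega> x y}"
proof -
  define s :: real where "s = sqrt 3"
  have s: "s * s = 3" "17/10 < s" using sqrt3_bounds by (simp_all add: s_def)
  define a where "a = max_norm (fst x)"
  define b where "b = max_norm (fst y)"
  define Q where "Q p q \<longleftrightarrow> (a = b \<and> (a mod 3 = 0 \<or> a mod 3 = 1 \<and> p = q \<or> a mod 3 = 2 \<and> \<not> p \<and> \<not> q)) \<or>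
       (b = a + 1 \<and> (a mod 3 = 0 \<and> q \<or> a mod 3 = 1 \<and> (p \<longrightarrow> q) \<or> a mod 3 = 2 \<and> \<not> p))" for p q
  have "shell_open \<omega> x y \<longleftrightarrow> Q (\<omega> x) (\<omega> y)" for \<omega>
    unfolding shell_open_def Q_def Let_def a_def b_def ..
  then have eq: "measure (shell_space K) {\<omega> \<in> space (shell_space K). shell_open \<omega> x y} =
    (if Q True True then shell_param x * shell_param y else 0) +
    (if Q True False then shell_param x * (1 - shell_param y) else 0) +
    (if Q False True then (1 - shell_param x) * shell_param y else 0) +
    (if Q False False then (1 - shell_param x) * (1 - shell_param y) else 0)"
    using shell_space_event_prob[OF assms(1-3) shell_param_range shell_param_range, of Q] by simp
  have px: "shell_param x = (if a mod 3 = 1 then (3 - s) / 2 else if a mod 3 = 2 then 2 - s else 1 / 2)"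
    by (simp add: shell_param_def a_def s_def)
  have py: "shell_param y = (if b mod 3 = 1 then (3 - s) / 2 else if b mod 3 = 2 then 2 - s else 1 / 2)"
    by (simp add: shell_param_def b_def s_def)
  have "a mod 3 = 0 \<or> a mod 3 = 1 \<or> a mod 3 = 2" by presburger
  then consider "b = a" "a mod 3 = 0" | "b = a" "a mod 3 = 1" | "b = a" "a mod 3 = 2"
    | "b = a + 1" "a mod 3 = 0" "b mod 3 = 1" | "b = a + 1" "a mod 3 = 1" "b mod 3 = 2"
    | "b = a + 1" "a mod 3 = 2" "b mod 3 = 0"
  proof -
    have "(a + 1) mod 3 = 1" if "a mod 3 = 0" using that by presburger
    moreover have "(a + 1) mod 3 = 2" if "a mod 3 = 1" using that by presburger
    moreover have "(a + 1) mod 3 = 0" if "a mod 3 = 2" using that by presburger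
    moreover have "b = a \<or> b = a + 1" using near unfolding a_def b_def .
    ultimately show ?thesis using \<open>a mod 3 = 0 \<or> a mod 3 = 1 \<or> a mod 3 = 2\<close> that by metis
  qed
  then have "4 - 2 * s \<le> measure (shell_space K) {\<omega> \<in> space (shell_space K). shell_open \<omega> x y}"
  \<comment> \<open>Cases 2, 3 and 5 are equalities by the choice of the biases. The other three
    have slack, for which sqrt 3 \<ge> 5/3 suffices.\<close>
  proof cases
    case 1
    show ?thesis unfolding eq px py Q_def using 1 s by simp
  next
    case 2
    show ?thesis unfolding eq px py Q_def using 2 s by (simp add: field_simps)
  next
    case 3
    show ?thesis unfolding eq px py Q_def using 3 s by (simp add: field_simps)
  next
    case 4
    show ?thesis unfolding eq px py Q_def using 4 s by (simp add: field_simps)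
  next
    case 5
    show ?thesis unfolding eq px py Q_def using 5 s by (simp add: field_simps)
  next
    case 6
    show ?thesis unfolding eq px py Q_def using 6 s by (simp add: field_simps)
  qed
  then show ?thesis by (simp add: s_def)
qed

lemma edge_vertices_subset: "\<Union>(Z2K_E n) \<subseteq> Z2K_V n"
  using Z2K_E_cases by (metis (no_types, lifting) Union_least insert_subset empty_subsetI)

lemma shell_config_event:
  assumes "e \<in> Z2K_E n" "e \<subseteq> K"
  shows "{\<omega> \<in> space (shell_space K). \<exists>x y. e = {x, y} \<and> shell_open \<omega> x y} \<in> sets (shell_space K)"
proof -
  obtain x y where e: "e = {x, y}" using Z2K_E_cases[OF assms(1)] by blast
  have *: "(\<exists>x' y'. e = {x', y'} \<and> shell_open \<omega> x' y') \<longleftrightarrow> shell_open \<omega> x y \<or> shell_open \<omega> y x" for \<omega>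
    unfolding e by (metis doubleton_eq_iff)
  have K: "x \<in> K" "y \<in> K" using assms(2) e by blast+
  obtain Q where Q: "shell_open \<omega> x y \<or> shell_open \<omega> y x \<longleftrightarrow> Q (\<omega> x) (\<omega> y)" for \<omega>
  proof -
    define R where "R a b p q \<longleftrightarrow> (a = b \<and> (a mod 3 = 0 \<or> a mod 3 = 1 \<and> p = q \<or> a mod 3 = 2 \<and> \<not> p \<and> \<not> q)) \<or>
       (b = a + 1 \<and> (a mod 3 = 0 \<and> q \<or> a mod 3 = 1 \<and> (p \<longrightarrow> q) \<or> a mod 3 = 2 \<and> \<not> p))" for a b :: int and p q
    have R: "shell_open \<omega> z w \<longleftrightarrow> R (max_norm (fst z)) (max_norm (fst w)) (\<omega> z) (\<omega> w)" for \<omega> z w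
      unfolding shell_open_def R_def Let_def ..
    show thesis
      by (rule that[of "\<lambda>p q. R (max_norm (fst x)) (max_norm (fst y)) p q \<or> R (max_norm (fst y)) (max_norm (fst x)) q p"])
         (simp only: R)
  qed
  show ?thesis unfolding * Q by (rule shell_space_event[OF K])
qed

text \<open>Stated for any \<open>K\<close> containing the endpoints of \<open>A\<close>: with K =
  \<Union>A it makes the configuration on \<open>A\<close> a measurable function of the bits at its
  own vertices, the form needed for independence.\<close>

lemma measurable_shell_config:
  assumes "A \<subseteq> Z2K_E n" "\<Union>A \<subseteq> K"
  shows "shell_config A \<in> shell_space K \<rightarrow>\<^sub>M edge_space A"
proof (rule measurable_edge_space)
  fix e assume e: "e \<in> A"
  then have "{\<omega> \<in> space (shell_space K). e \<in> shell_config A \<omega>} =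
      {\<omega> \<in> space (shell_space K). \<exists>x y. e = {x, y} \<and> shell_open \<omega> x y}"
    unfolding shell_config_def by blast
  moreover have "e \<subseteq> K" using e assms(2) by blast
  ultimately show "{\<omega> \<in> space (shell_space K). e \<in> shell_config A \<omega>} \<in> sets (shell_space K)"
    using shell_config_event[of e n K] e assms(1) by (simp only: subsetD)
qed (simp add: shell_config_def)

lemma shell_config_restrict:
  assumes "\<Union>A \<subseteq> K"
  shows "shell_config A (restrict \<omega> K) = shell_config A \<omega>"
proof -
  have "shell_open (restrict \<omega> K) x y = shell_open \<omega> x y" if "{x, y} \<in> A" for x y
  proof -
    have "x \<in> K" "y \<in> K" using that assms by blast+
    then show ?thesis unfolding shell_open_def by simp
  qed
  then show ?thesis unfolding shell_config_def by blast
qed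

lemma shell_config_Int: "A \<subseteq> E \<Longrightarrow> shell_config E \<omega> \<inter> A = shell_config A \<omega>"
  unfolding shell_config_def by blast

lemma indep_vars_coordinates:
  assumes "K \<noteq> {}"
  shows "prob_space.indep_vars (shell_space K) (\<lambda>x. measure_pmf (bernoulli_pmf (shell_param x))) (\<lambda>x \<omega>. \<omega> x) K"
proof -
  let ?M = "\<lambda>x. measure_pmf (bernoulli_pmf (shell_param x))"
  interpret prob_space "shell_space K" by (rule prob_space_shell_space)
  have rv: "(\<lambda>\<omega>. \<omega> x) \<in> shell_space K \<rightarrow>\<^sub>M ?M x" if "x \<in> K" for x
    unfolding shell_space_def by (rule measurable_component_singleton[OF that])
  have "distr (shell_space K) (PiM K ?M) (\<lambda>\<omega>. \<lambda>x\<in>K. \<omega> x) = distr (shell_space K) (shell_space K) (\<lambda>\<omega>. \<omega>)"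
  proof (rule distr_cong)
    fix \<omega> assume "\<omega> \<in> space (shell_space K)"
    then show "(\<lambda>x\<in>K. \<omega> x) = \<omega>"
      unfolding shell_space_def space_PiM by (metis PiE_restrict restrict_def)
  qed (simp_all add: shell_space_def)
  also have "\<dots> = shell_space K" by (rule distr_id)
  also have "\<dots> = PiM K (\<lambda>x. distr (shell_space K) (?M x) (\<lambda>\<omega>. \<omega> x))"
    unfolding shell_space_def
    by (intro PiM_cong refl distr_PiM_component[symmetric]) (simp_all add: prob_space_measure_pmf)
  finally show ?thesis using indep_vars_iff_distr_eq_PiM'[OF assms, where X = "\<lambda>x \<omega>. \<omega> x", OF rv] by blast
qed

text \<open>Independence is a statement about joint laws, so it may be checked before the measure is
  pushed forward.\<close>

lemma indep_var_distr:
  assumes M: "prob_space M" and f: "f \<in> M \<rightarrow>\<^sub>M L" and X: "X \<in> L \<rightarrow>\<^sub>M S" and Y: "Y \<in> L \<rightarrow>\<^sub>M T"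
    and ind: "prob_space.indep_var M S (X \<circ> f) T (Y \<circ> f)"
  shows "prob_space.indep_var (distr M L f) S X T Y"
proof -
  interpret M: prob_space M by fact
  interpret D: prob_space "distr M L f" by (rule M.prob_space_distr[OF f])
  have XY: "(\<lambda>x. (X x, Y x)) \<in> L \<rightarrow>\<^sub>M S \<Otimes>\<^sub>M T" using X Y by measurable
  have "distr (distr M L f) S X \<Otimes>\<^sub>M distr (distr M L f) T Y = distr M S (X \<circ> f) \<Otimes>\<^sub>M distr M T (Y \<circ> f)"
    using f X Y by (simp add: distr_distr)
  also have "\<dots> = distr M (S \<Otimes>\<^sub>M T) (\<lambda>x. ((X \<circ> f) x, (Y \<circ> f) x))"
    using ind unfolding M.indep_var_distribution_eq by blast
  also have "\<dots> = distr (distr M L f) (S \<Otimes>\<^sub>M T) (\<lambda>x. (X x, Y x))"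
    using f XY by (simp add: distr_distr comp_def)
  finally show ?thesis unfolding D.indep_var_distribution_eq using X Y by simp
qed

text \<open>Edge sets spanning disjoint vertex sets read disjoint blocks of independent
  bits.\<close>

lemma shell_measure_one_independent:
  assumes "n \<ge> 1"
  shows "one_independent (Z2K_E n) (shell_measure n)"
  unfolding one_independent_def
proof (intro allI impI)
  fix A B assume AB: "A \<subseteq> Z2K_E n" "B \<subseteq> Z2K_E n" "\<Union>A \<inter> \<Union>B = {}"
  let ?V = "Z2K_V n" and ?E = "Z2K_E n"
  let ?M = "\<lambda>x. measure_pmf (bernoulli_pmf (shell_param x))"
  interpret prob_space "shell_space ?V" by (rule prob_space_shell_space)
  have ne: "?V \<noteq> {}" using assms by (auto simp: Z2K_V_def lessThan_empty_iff)
  have sub: "\<Union>A \<subseteq> ?V" "\<Union>B \<subseteq> ?V" using AB(1,2) edge_vertices_subset by blast+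
  let ?K = "case_bool (\<Union>A) (\<Union>B)"
  have "indep_vars (\<lambda>j. PiM (?K j) ?M) (\<lambda>j \<omega>. restrict (\<lambda>x. \<omega> x) (?K j)) UNIV"
  proof (rule indep_vars_restrict[OF indep_vars_coordinates[OF ne]])
    show "?K j \<subseteq> ?V" for j using sub by (cases j) simp_all
    show "disjoint_family_on ?K UNIV" using AB(3) unfolding disjoint_family_on_def
      by (auto split: bool.splits)
  qed
  then have "indep_vars (case_bool (PiM (\<Union>A) ?M) (PiM (\<Union>B) ?M))
      (case_bool (\<lambda>\<omega>. restrict \<omega> (\<Union>A)) (\<lambda>\<omega>. restrict \<omega> (\<Union>B))) UNIV"
    by (rule indep_vars_cong[THEN iffD1, rotated -1]) (simp_all split: bool.splits)
  then have "indep_var (shell_space (\<Union>A)) (\<lambda>\<omega>. restrict \<omega> (\<Union>A)) (shell_space (\<Union>B)) (\<lambda>\<omega>. restrict \<omega> (\<Union>B))"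
    unfolding indep_var_def by (simp only: shell_space_def)
  then have "indep_var (edge_space A) (shell_config A \<circ> (\<lambda>\<omega>. restrict \<omega> (\<Union>A)))
      (edge_space B) (shell_config B \<circ> (\<lambda>\<omega>. restrict \<omega> (\<Union>B)))"
    by (rule indep_var_compose) (use AB in \<open>auto intro: measurable_shell_config\<close>)
  moreover have "shell_config A \<circ> (\<lambda>\<omega>. restrict \<omega> (\<Union>A)) = (\<lambda>S. S \<inter> A) \<circ> shell_config ?E"
    by (simp add: fun_eq_iff shell_config_restrict shell_config_Int AB)
  moreover have "shell_config B \<circ> (\<lambda>\<omega>. restrict \<omega> (\<Union>B)) = (\<lambda>S. S \<inter> B) \<circ> shell_config ?E"
    by (simp add: fun_eq_iff shell_config_restrict shell_config_Int AB)
  ultimately have ind: "indep_var (edge_space A) ((\<lambda>S. S \<inter> A) \<circ> shell_config ?E)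
      (edge_space B) ((\<lambda>S. S \<inter> B) \<circ> shell_config ?E)" by simp
  show "prob_space.indep_var (shell_measure n) (edge_space A) (\<lambda>S. S \<inter> A) (edge_space B) (\<lambda>S. S \<inter> B)"
    unfolding shell_measure_def
    by (rule indep_var_distr[OF prob_space_shell_space
          measurable_shell_config[OF subset_refl edge_vertices_subset]
          measurable_Int_edge_space[OF AB(1)] measurable_Int_edge_space[OF AB(2)] ind])
qed

lemma shell_measure_M1:
  assumes "n \<ge> 1" "p \<le> 4 - 2 * sqrt 3"
  shows "shell_measure n \<in> M1 (Z2K_E n) p"
proof -
  let ?V = "Z2K_V n" and ?E = "Z2K_E n"
  interpret prob_space "shell_space ?V" by (rule prob_space_shell_space)
  have meas: "shell_config ?E \<in> shell_space ?V \<rightarrow>\<^sub>M edge_space ?E"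
    by (rule measurable_shell_config[OF subset_refl edge_vertices_subset])
  have "random_graph_model ?E (shell_measure n)"
    unfolding random_graph_model_def shell_measure_def using prob_space_distr[OF meas] by simp
  moreover have "p \<le> measure (shell_measure n) {S \<in> space (shell_measure n). e \<in> S}" if e: "e \<in> ?E" for e
  proof -
    obtain x y where xy: "e = {x, y}" "x \<noteq> y" "x \<in> ?V" "y \<in> ?V"
      "max_norm (fst y) = max_norm (fst x) \<or> max_norm (fst y) = max_norm (fst x) + 1"
      by (rule Z2K_E_cases[OF e])
    have "p \<le> prob {\<omega> \<in> space (shell_space ?V). shell_open \<omega> x y}"
      using shell_open_prob[OF xy(3,4,2,5)] assms(2) by linarith
    also have "\<dots> \<le> prob (shell_config ?E -` {S \<in> Pow ?E. e \<in> S} \<inter> space (shell_space ?V))"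
    proof (rule finite_measure_mono)
      show "{\<omega> \<in> space (shell_space ?V). shell_open \<omega> x y} \<subseteq>
          shell_config ?E -` {S \<in> Pow ?E. e \<in> S} \<inter> space (shell_space ?V)"
        using e xy(1) unfolding shell_config_def by blast
      show "shell_config ?E -` {S \<in> Pow ?E. e \<in> S} \<inter> space (shell_space ?V) \<in> events"
        by (rule measurable_sets[OF meas edge_present_sets[OF e]])
    qed
    also have "\<dots> = measure (shell_measure n) {S \<in> Pow ?E. e \<in> S}"
      unfolding shell_measure_def by (rule measure_distr[OF meas edge_present_sets[OF e], symmetric])
    also have "{S \<in> Pow ?E. e \<in> S} = {S \<in> space (shell_measure n). e \<in> S}"
      by (simp add: shell_measure_def space_edge_space)
    finally show ?thesis .
  qed
  ultimately show ?thesis unfolding M1_def using shell_measure_one_independent[OF assms(1)] by blast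
qed

lemma shell_measure_not_percolates: "\<not> percolates (Z2K_V n) (shell_measure n)"
proof
  let ?V = "Z2K_V n" and ?E = "Z2K_E n"
  interpret prob_space "shell_space ?V" by (rule prob_space_shell_space)
  have meas: "shell_config ?E \<in> shell_space ?V \<rightarrow>\<^sub>M edge_space ?E"
    by (rule measurable_shell_config[OF subset_refl edge_vertices_subset])
  assume "percolates ?V (shell_measure n)"
  then have "AE \<omega> in shell_space ?V. has_infinite_component ?V (shell_config ?E \<omega>)"
    unfolding percolates_def shell_measure_def by (rule AE_distrD[OF meas])
  then show False using shell_config_finite_components by simp
qed

text \<open>Provides an element of the set whose infimum is \<open>p1c\<close>, since the infimum of
  an empty set of reals would carry no information. The hypothesis on n supplies an edge.\<close>

lemma M1_gt_1_empty: "n \<ge> 1 \<Longrightarrow> p > 1 \<Longrightarrow> M1 (Z2K_E n) p = {}"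
proof (rule ccontr)
  assume n: "n \<ge> 1" and p: "p > 1" and "M1 (Z2K_E n) p \<noteq> {}"
  then obtain \<mu> where \<mu>: "\<mu> \<in> M1 (Z2K_E n) p" by blast
  have "{((0, 0), 0), ((1, 0), 0)} \<in> Z2K_E n" unfolding Z2K_E_iff using n by (simp add: lattice_adj_def)
  then have "p \<le> measure \<mu> {S \<in> space \<mu>. {((0, 0), 0), ((1, 0), 0)} \<in> S}" using \<mu> unfolding M1_def by blast
  also have "\<dots> \<le> 1"
    using \<mu> unfolding M1_def random_graph_model_def by (intro prob_space.prob_le_1) blast
  finally show False using p by simp
qed

lemma p1c_lower_bound:
  assumes "n \<ge> 1"
  shows "4 - 2 * sqrt 3 \<le> p1c (Z2K_V n) (Z2K_E n)"
  unfolding p1c_def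
proof (rule cInf_greatest)
  have "2 \<in> {p. 0 \<le> p \<and> (\<forall>\<mu>\<in>M1 (Z2K_E n) p. percolates (Z2K_V n) \<mu>)}"
    using M1_gt_1_empty[OF assms, of 2] by simp
  then show "{p. 0 \<le> p \<and> (\<forall>\<mu>\<in>M1 (Z2K_E n) p. percolates (Z2K_V n) \<mu>)} \<noteq> {}" by blast
next
  fix p assume p: "p \<in> {p. 0 \<le> p \<and> (\<forall>\<mu>\<in>M1 (Z2K_E n) p. percolates (Z2K_V n) \<mu>)}"
  show "4 - 2 * sqrt 3 \<le> p"
  proof (rule ccontr)
    assume "\<not> 4 - 2 * sqrt 3 \<le> p"
    then have "shell_measure n \<in> M1 (Z2K_E n) p" by (intro shell_measure_M1 assms) simp
    then show False using p shell_measure_not_percolates by blast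
  qed
qed

section \<open>Renormalisation by blocks\<close>

definition children :: "int \<times> int \<Rightarrow> (int \<times> int) set" where
  "children U = {w. fst w div 2 = fst U \<and> snd w div 2 = snd U}"

text \<open>The dyadic square of side 2^k for which the scale-k vertex \<open>U\<close> stands. As
  \<open>div\<close> rounds down for negative coordinates too, these squares tile the plane.\<close>

definition region :: "nat \<Rightarrow> int \<times> int \<Rightarrow> (int \<times> int) set" where
  "region k U = {w. fst w div 2 ^ k = fst U \<and> snd w div 2 ^ k = snd U}"

lemma region_0: "region 0 u = {u}"
  by (auto simp: region_def prod_eq_iff)

lemma region_Suc:
  assumes "u \<in> children U"
  shows "region k u \<subseteq> region (Suc k) U"
proof
  fix w assume "w \<in> region k u"
  moreover have "z div 2 ^ Suc k = z div 2 ^ k div 2" for z :: int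
    unfolding power_Suc2 by (rule zdiv_zmult2_eq) simp
  ultimately show "w \<in> region (Suc k) U" using assms unfolding region_def children_def by simp
qed

lemma region_disjoint: "u \<noteq> v \<Longrightarrow> region k u \<inter> region k v = {}"
  by (auto simp: region_def prod_eq_iff)

lemma finite_region: "finite (region k U)"
proof (rule finite_subset)
  let ?I = "\<lambda>a::int. {a * 2 ^ k..a * 2 ^ k + 2 ^ k}"
  show "region k U \<subseteq> ?I (fst U) \<times> ?I (snd U)"
  proof
    fix w assume "w \<in> region k U"
    then have w: "fst w div 2 ^ k = fst U" "snd w div 2 ^ k = snd U" by (simp_all add: region_def)
    have "z \<in> ?I (z div 2 ^ k)" for z :: int
    proof -
      have "z = z div 2 ^ k * 2 ^ k + z mod 2 ^ k" by (rule div_mult_mod_eq[symmetric])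
      moreover have "0 \<le> z mod 2 ^ k" "z mod 2 ^ k < 2 ^ k" by simp_all
      ultimately have "z div 2 ^ k * 2 ^ k \<le> z \<and> z \<le> z div 2 ^ k * 2 ^ k + 2 ^ k" by linarith
      then show ?thesis by simp
    qed
    from this[of "fst w"] this[of "snd w"] w show "w \<in> ?I (fst U) \<times> ?I (snd U)"
      by (simp add: mem_Times_iff)
  qed
qed simp

lemma children_eq: "children U = {2 * fst U..2 * fst U + 1} \<times> {2 * snd U..2 * snd U + 1}"
proof -
  have "z div 2 = a \<longleftrightarrow> z \<in> {2 * a..2 * a + 1}" for z a :: int by (simp, presburger)
  then show ?thesis unfolding children_def by (auto simp: mem_Times_iff)
qed

lemma finite_children: "finite (children U)"
  by (simp add: children_eq)

lemma card_children: "card (children U) = 4"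
  by (simp add: children_eq card_cartesian_product)

lemma lattice_adj_neq: "lattice_adj u v \<Longrightarrow> u \<noteq> v"
  by (auto simp: lattice_adj_def)

lemma lattice_adj_parity: "lattice_adj u v \<Longrightarrow> even (fst u + snd u) \<longleftrightarrow> odd (fst v + snd v)"
  unfolding lattice_adj_def by presburger

text \<open>A ladder with two rows stays connected when one vertex is removed: the row avoiding
  \<open>x\<close> is an intact path, and every other remaining vertex hangs on it by its transverse
  bond.\<close>

lemma ladder_connected:
  fixes f :: "int \<times> int \<Rightarrow> 'c"
  assumes f: "\<And>u v. u \<in> {A..A+3} \<times> {B..B+1} \<Longrightarrow> v \<in> {A..A+3} \<times> {B..B+1} \<Longrightarrow> lattice_adj u v \<Longrightarrow>
    u \<noteq> x \<Longrightarrow> v \<noteq> x \<Longrightarrow> f u = f v"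
  shows "\<exists>c. \<forall>w\<in>{A..A+3} \<times> {B..B+1}. w \<noteq> x \<longrightarrow> f w = c"
proof -
  define r where "r = (if snd x = B then B + 1 else B)"
  define r' where "r' = (if snd x = B then B else B + 1)"
  have r: "r \<in> {B..B+1}" "r' \<in> {B..B+1}" "snd x \<noteq> r" "\<bar>r' - r\<bar> = 1" by (simp_all add: r_def r'_def)
  have rr: "j = r \<or> j = r'" if "j \<in> {B..B+1}" for j
  proof -
    have "B \<le> j" "j \<le> B + 1" using that by simp_all
    then have "j = B \<or> j = B + 1" by linarith
    then show ?thesis unfolding r_def r'_def by presburger
  qed
  have free: "(i, r) \<noteq> x" for i
  proof
    assume "(i, r) = x"
    then have "snd x = r" by (rule subst) simp
    then show False using r(3) by contradiction
  qed
  have step: "f (i, r) = f (i', r)" if "A \<le> i" "i \<le> A + 2" "i' = i + 1" for i i'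
  proof (rule f)
    show "lattice_adj (i, r) (i', r)" using that(3) by (simp add: lattice_adj_def)
    show "(i, r) \<in> {A..A+3} \<times> {B..B+1}" "(i', r) \<in> {A..A+3} \<times> {B..B+1}" using that r(1) by simp_all
  qed (rule free)+
  have s1: "f (A, r) = f (A + 1, r)" by (rule step) simp_all
  have s2: "f (A + 1, r) = f (A + 2, r)" by (rule step) simp_all
  have s3: "f (A + 2, r) = f (A + 3, r)" by (rule step) simp_all
  have row: "f (i, r) = f (A, r)" if "i \<in> {A..A+3}" for i
  proof -
    have "A \<le> i" "i \<le> A + 3" using that by simp_all
    then consider "i = A" | "i = A + 1" | "i = A + 2" | "i = A + 3" by linarith
    then show ?thesis by cases (simp_all only: s1 s2 s3)
  qed
  have "f w = f (A, r)" if w: "w \<in> {A..A+3} \<times> {B..B+1}" "w \<noteq> x" for w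
  proof -
    obtain i j where ij: "w = (i, j)" "i \<in> {A..A+3}" "j \<in> {B..B+1}" using w(1) by blast
    show ?thesis
    proof (cases "j = r")
      case True
      show ?thesis unfolding ij(1) True by (rule row[OF ij(2)])
    next
      case False
      then have j: "j = r'" using rr ij(3) by blast
      have "f w = f (i, r)"
      proof (rule f)
        show "w \<in> {A..A+3} \<times> {B..B+1}" by (rule w(1))
        show "lattice_adj w (i, r)" unfolding ij(1) j lattice_adj_def using r(4) by simp
        show "(i, r) \<in> {A..A+3} \<times> {B..B+1}" using ij(2) r(1) by blast
      qed (rule w(2), rule free)
      also have "\<dots> = f (A, r)" by (rule row[OF ij(2)])
      finally show ?thesis .
    qed
  qed
  then show ?thesis by blast
qed

text \<open>Two adjacent 2 by 2 blocks form a ladder; the upright position is reduced to the lying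
  one by swapping coordinates.\<close>

lemma block_pair_connected:
  fixes f :: "int \<times> int \<Rightarrow> 'c"
  assumes UV: "lattice_adj U V"
    and f: "\<And>u v. u \<in> children U \<union> children V \<Longrightarrow> v \<in> children U \<union> children V \<Longrightarrow> lattice_adj u v \<Longrightarrow>
    u \<noteq> x \<Longrightarrow> v \<noteq> x \<Longrightarrow> f u = f v"
  shows "\<exists>c. \<forall>w\<in>children U \<union> children V. w \<noteq> x \<longrightarrow> f w = c"
proof -
  have horizontal: "children U \<union> children V = {2 * fst U..2 * fst U + 3} \<times> {2 * snd U..2 * snd U + 1}"
    if "fst V = fst U + 1" "snd V = snd U" for U V
    unfolding children_eq that by (auto simp: mem_Times_iff)
  have vertical: "children U \<union> children V = {2 * fst U..2 * fst U + 1} \<times> {2 * snd U..2 * snd U + 3}"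
    if "fst V = fst U" "snd V = snd U + 1" for U V
    unfolding children_eq that by (auto simp: mem_Times_iff)
  have H: ?thesis if "children U \<union> children V = {A..A+3} \<times> {B..B+1}" for A B
    using ladder_connected[of A B x f] f unfolding that by blast
  have V: ?thesis if W: "children U \<union> children V = {A..A+1} \<times> {B..B+3}" for A B
  proof -
    have "\<exists>c. \<forall>w\<in>{B..B+3} \<times> {A..A+1}. w \<noteq> prod.swap x \<longrightarrow> (f \<circ> prod.swap) w = c"
    proof (rule ladder_connected)
      fix u v assume uv: "u \<in> {B..B+3} \<times> {A..A+1}" "v \<in> {B..B+3} \<times> {A..A+1}" "lattice_adj u v"
        "u \<noteq> prod.swap x" "v \<noteq> prod.swap x"
      have "f (prod.swap u) = f (prod.swap v)"
      proof (rule f)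
        show "prod.swap u \<in> children U \<union> children V" "prod.swap v \<in> children U \<union> children V"
          unfolding W using uv(1,2) by (simp_all add: mem_Times_iff)
        show "lattice_adj (prod.swap u) (prod.swap v)" using uv(3) by (simp add: lattice_adj_def)
        show "prod.swap u \<noteq> x" "prod.swap v \<noteq> x" using uv(4,5) by auto
      qed
      then show "(f \<circ> prod.swap) u = (f \<circ> prod.swap) v" by simp
    qed
    then obtain c where c: "\<forall>w\<in>{B..B+3} \<times> {A..A+1}. w \<noteq> prod.swap x \<longrightarrow> (f \<circ> prod.swap) w = c" by blast
    have "f w = c" if "w \<in> {A..A+1} \<times> {B..B+3}" "w \<noteq> x" for w
    proof -
      have "prod.swap w \<in> {B..B+3} \<times> {A..A+1}" using that(1) by (simp add: mem_Times_iff)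
      moreover have "prod.swap w \<noteq> prod.swap x" using that(2) by (metis swap_swap)
      ultimately show ?thesis using c by (metis comp_apply swap_swap)
    qed
    then show ?thesis unfolding W by blast
  qed
  have "fst V = fst U + 1 \<and> snd V = snd U \<or> fst U = fst V + 1 \<and> snd U = snd V \<or>
      fst V = fst U \<and> snd V = snd U + 1 \<or> fst U = fst V \<and> snd U = snd V + 1"
    using UV unfolding lattice_adj_def by presburger
  then show ?thesis
    using H[OF horizontal] V[OF vertical] H[OF horizontal[of U V, unfolded Un_commute[of "children V"]]]
      H[OF trans[OF Un_commute horizontal]] V[OF trans[OF Un_commute vertical]] by metis
qed

section \<open>Hierarchy of good bonds and representatives\<close>

primrec coarse_bond :: "(int \<times> int \<Rightarrow> int \<times> int \<Rightarrow> bool) \<Rightarrow> nat \<Rightarrow> int \<times> int \<Rightarrow> int \<times> int \<Rightarrow> bool" where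
  "coarse_bond g 0 = g"
| "coarse_bond g (Suc k) = (\<lambda>U V. \<exists>x. \<forall>u\<in>children U \<union> children V. \<forall>v\<in>children U \<union> children V.
     lattice_adj u v \<and> \<not> coarse_bond g k u v \<longrightarrow> x = u \<or> x = v)"

text \<open>The child has to be chosen from \<open>U\<close> alone: the exceptional vertex of a bond
  depends on both of its blocks, but the representative of \<open>U\<close> must be the same for all
  bonds at \<open>U\<close>. Touching a good bond inside the block is enough, since at most one of
  its two ends is exceptional. The corner in the other branch is a default.\<close>

definition good_child :: "(int \<times> int \<Rightarrow> int \<times> int \<Rightarrow> bool) \<Rightarrow> int \<times> int \<Rightarrow> int \<times> int" where
  "good_child b U = (if \<exists>c\<in>children U. \<exists>c'\<in>children U. lattice_adj c c' \<and> b c c'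
     then SOME c. c \<in> children U \<and> (\<exists>c'\<in>children U. lattice_adj c c' \<and> b c c')
     else (2 * fst U, 2 * snd U))"

lemma good_child_in: "good_child b U \<in> children U"
proof (cases "\<exists>c\<in>children U. \<exists>c'\<in>children U. lattice_adj c c' \<and> b c c'")
  case True
  then have "\<exists>c. c \<in> children U \<and> (\<exists>c'\<in>children U. lattice_adj c c' \<and> b c c')" by blast
  from someI_ex[OF this] show ?thesis using True unfolding good_child_def by simp
next
  case False
  then have "good_child b U = (2 * fst U, 2 * snd U)" unfolding good_child_def by (rule if_not_P)
  then show ?thesis by (simp add: children_def)
qed

lemma good_child_bond:
  assumes "c \<in> children U" "c' \<in> children U" "lattice_adj c c'" "b c c'"
  shows "\<exists>c'\<in>children U. lattice_adj (good_child b U) c' \<and> b (good_child b U) c'"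
proof -
  have ex: "\<exists>c\<in>children U. \<exists>c'\<in>children U. lattice_adj c c' \<and> b c c'" using assms by blast
  then have "\<exists>c. c \<in> children U \<and> (\<exists>c'\<in>children U. lattice_adj c c' \<and> b c c')" by blast
  from someI_ex[OF this] show ?thesis using ex unfolding good_child_def by simp
qed

primrec representative :: "(int \<times> int \<Rightarrow> int \<times> int \<Rightarrow> bool) \<Rightarrow> nat \<Rightarrow> int \<times> int \<Rightarrow> int \<times> int" where
  "representative g 0 U = U"
| "representative g (Suc k) U = representative g k (good_child (coarse_bond g k) U)"

lemma representative_region: "representative g k U \<in> region k U"
proof (induction k arbitrary: U)
  case 0
  then show ?case by (simp add: region_0)
next
  case (Suc k)
  then show ?case using region_Suc[OF good_child_in] unfolding representative.simps by blast
qed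

lemma block_row_free:
  obtains c c' where "c \<in> children U" "c' \<in> children U" "lattice_adj c c'" "c \<noteq> x" "c' \<noteq> x"
proof -
  define r where "r = (if snd x = 2 * snd U then 2 * snd U + 1 else 2 * snd U)"
  have "snd x \<noteq> r" "r div 2 = snd U" by (simp_all add: r_def)
  then show ?thesis
    by (intro that[of "(2 * fst U, r)" "(2 * fst U + 1, r)"]) (auto simp: children_def lattice_adj_def)
qed

text \<open>A labelling \<open>D\<close> respected by good bonds at scale 0 is respected by
  representatives at every scale; percolation takes the open component as label. By the ladder
  argument all non-exceptional children carry one label; if the chosen child is exceptional, its
  partner along a good bond is not, and passes the label on.\<close>

lemma coarse_bond_representative:
  assumes base: "\<And>u v. lattice_adj u v \<Longrightarrow> g u v \<Longrightarrow> D u = D v"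
  shows "lattice_adj U V \<Longrightarrow> coarse_bond g k U V \<Longrightarrow> D (representative g k U) = D (representative g k V)"
proof (induction k arbitrary: U V)
  case 0
  then show ?case using base by simp
next
  case (Suc k)
  let ?W = "children U \<union> children V"
  let ?b = "coarse_bond g k"
  let ?f = "\<lambda>u. D (representative g k u)"
  obtain x where x: "\<forall>u\<in>?W. \<forall>v\<in>?W. lattice_adj u v \<and> \<not> ?b u v \<longrightarrow> x = u \<or> x = v"
    using Suc.prems(2) by auto
  have good: "?b u v" if "u \<in> ?W" "v \<in> ?W" "lattice_adj u v" "u \<noteq> x" "v \<noteq> x" for u v
    using x that by blast
  obtain c where c: "\<forall>w\<in>?W. w \<noteq> x \<longrightarrow> ?f w = c"
    using block_pair_connected[OF Suc.prems(1), of x ?f] Suc.IH good by blast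
  have rep: "?f (good_child ?b B) = c" if B: "children B \<subseteq> ?W" for B
  proof -
    obtain d d' where d: "d \<in> children B" "d' \<in> children B" "lattice_adj d d'" "d \<noteq> x" "d' \<noteq> x"
      by (rule block_row_free)
    \<comment> \<open>A row of the block avoiding \<open>x\<close> carries a good bond, so
      \<open>good_child\<close> does not fall back on its default.\<close>
    then have "?b d d'" using good B by blast
    then obtain e where e: "e \<in> children B" "lattice_adj (good_child ?b B) e" "?b (good_child ?b B) e"
      using good_child_bond[OF d(1-3)] by blast
    have eq: "?f (good_child ?b B) = ?f e" by (rule Suc.IH[OF e(2,3)])
    show ?thesis
    proof (cases "good_child ?b B = x")
      case True
      then have "e \<noteq> x" using lattice_adj_neq[OF e(2)] by blast
      then show ?thesis using eq c e(1) B by auto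
    next
      case False
      then show ?thesis using c good_child_in B by blast
    qed
  qed
  show ?case using rep[of U] rep[of V] by simp
qed

text \<open>Pairwise intersecting edges form a star or a triangle. No vertex covers the bad bonds,
  so they are not a star, and the lattice is bipartite, so they are not a triangle.\<close>

lemma disjoint_bad_bonds:
  assumes "\<not> coarse_bond g (Suc k) U V"
  obtains u v u' v' where "u \<in> children U \<union> children V" "v \<in> children U \<union> children V"
    "u' \<in> children U \<union> children V" "v' \<in> children U \<union> children V"
    "lattice_adj u v" "lattice_adj u' v'" "{u, v} \<inter> {u', v'} = {}"
    "\<not> coarse_bond g k u v" "\<not> coarse_bond g k u' v'"
proof -
  let ?W = "children U \<union> children V"
  define bad where "bad u v \<longleftrightarrow> u \<in> ?W \<and> v \<in> ?W \<and> lattice_adj u v \<and> \<not> coarse_bond g k u v" for u v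
  have ex: "\<exists>u v. bad u v \<and> x \<noteq> u \<and> x \<noteq> v" for x
    using assms unfolding bad_def coarse_bond.simps by blast
  obtain u v where uv: "bad u v" using ex by blast
  \<comment> \<open>One bad bond avoiding \<open>u\<close>, then one avoiding \<open>v\<close>. If
    both still meet the first bond, they extend it to a path z - v - u - w, whose outer bonds are
    disjoint because z and w have opposite parity.\<close>
  obtain u1 v1 where 1: "bad u1 v1" "u \<noteq> u1" "u \<noteq> v1" using ex by blast
  obtain u2 v2 where 2: "bad u2 v2" "v \<noteq> u2" "v \<noteq> v2" using ex by blast
  note bad = bad_def
  show ?thesis
  proof (cases "v \<in> {u1, v1}")
    case False
    then have "{u, v} \<inter> {u1, v1} = {}" using 1(2,3) by blast
    then show ?thesis using uv 1(1) unfolding bad by (intro that[of u v u1 v1]) blast+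
  next
    case v: True
    show ?thesis
    proof (cases "u \<in> {u2, v2}")
      case False
      then have "{u, v} \<inter> {u2, v2} = {}" using 2(2,3) by blast
      then show ?thesis using uv 2(1) unfolding bad by (intro that[of u v u2 v2]) blast+
    next
      case u: True
      obtain z where z: "{u1, v1} = {v, z}" "lattice_adj v z" "z \<noteq> u"
        using v 1 lattice_adj_sym unfolding bad by blast
      obtain w where w: "{u2, v2} = {u, w}" "lattice_adj u w" "w \<noteq> v"
        using u 2 lattice_adj_sym unfolding bad by blast
      have "lattice_adj u v" using uv unfolding bad by blast
      then have "z \<noteq> w" "u \<noteq> v"
        using lattice_adj_parity[of u v] lattice_adj_parity[of v z] lattice_adj_parity[of u w] z(2) w(2)
        by blast+
      then have "{u1, v1} \<inter> {u2, v2} = {}" unfolding z(1) w(1) using z(3) w(3) by blast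
      then show ?thesis using 1(1) 2(1) unfolding bad by (intro that[of u1 v1 u2 v2]) blast+
    qed
  qed
qed

text \<open>The block (1, 1) moves off to infinity with the scale, so a component that contains its
  representatives for all large k is infinite.\<close>

lemma region_unbounded:
  assumes "w \<in> region k (1, 1)"
  shows "2 ^ k \<le> fst w"
proof -
  have "fst w = fst w div 2 ^ k * 2 ^ k + fst w mod 2 ^ k" by (rule div_mult_mod_eq[symmetric])
  moreover have "fst w div 2 ^ k = 1" using assms by (simp add: region_def)
  ultimately have "fst w = 2 ^ k + fst w mod 2 ^ k" by (metis mult_1)
  moreover have "0 \<le> fst w mod 2 ^ k" by simp
  ultimately show ?thesis by linarith
qed

text \<open>Locality: the state of a bond is read off the dyadic squares of its two ends. Bonds
  without common end therefore use disjoint sets of vertices, and 1-independence persists at every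
  scale.\<close>

lemma coarse_bond_cong:
  assumes "\<And>u v. u \<in> W \<Longrightarrow> v \<in> W \<Longrightarrow> g u v = g' u v"
  shows "region k U \<union> region k V \<subseteq> W \<Longrightarrow> coarse_bond g k U V = coarse_bond g' k U V"
proof (induction k arbitrary: U V)
  case 0
  then show ?case using assms by (simp add: region_0)
next
  case (Suc k)
  have "coarse_bond g k u v = coarse_bond g' k u v" if "u \<in> children U \<union> children V" "v \<in> children U \<union> children V" for u v
  proof (rule Suc.IH)
    have "region k u \<subseteq> W" "region k v \<subseteq> W" using that region_Suc Suc.prems by blast+
    then show "region k u \<union> region k v \<subseteq> W" by blast
  qed
  then show ?case by (simp only: coarse_bond.simps) metis
qed

section \<open>Percolation\<close>

definition depends_on :: "'v set set \<Rightarrow> 'v set set \<Rightarrow> ('v set set \<Rightarrow> bool) \<Rightarrow> bool" where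
  "depends_on E F Q \<longleftrightarrow> (\<forall>S. S \<subseteq> E \<longrightarrow> Q S = Q (S \<inter> F))"

text \<open>Singletons are finite intersections of generators or their complements, so on finitely
  many edges nothing escapes the sigma-algebra. Local events then need no measurability argument of
  their own.\<close>

lemma sets_edge_space_finite:
  assumes "finite F"
  shows "sets (edge_space F) = Pow (Pow F)"
proof (rule antisym)
  show "sets (edge_space F) \<subseteq> Pow (Pow F)"
    using sets.sets_into_space[of _ "edge_space F"] by (auto simp: space_edge_space)
  have atom: "{T} \<in> sets (edge_space F)" if T: "T \<subseteq> F" for T
  proof -
    have "{S \<in> space (edge_space F). e \<in> S \<longleftrightarrow> e \<in> T} \<in> sets (edge_space F)" if "e \<in> F" for e
    proof (cases "e \<in> T")
      case True
      then show ?thesis using edge_present_sets[OF that] by (simp add: space_edge_space)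
    next
      case False
      then have "{S \<in> space (edge_space F). e \<in> S \<longleftrightarrow> e \<in> T} = space (edge_space F) - {S \<in> Pow F. e \<in> S}"
        unfolding space_edge_space by blast
      then show ?thesis using edge_present_sets[OF that] by simp
    qed
    then have "{S \<in> space (edge_space F). \<forall>e\<in>F. e \<in> S \<longleftrightarrow> e \<in> T} \<in> sets (edge_space F)"
      using assms by (rule sets.sets_Collect_finite_All)
    moreover have "{S \<in> space (edge_space F). \<forall>e\<in>F. e \<in> S \<longleftrightarrow> e \<in> T} = {T}"
      unfolding space_edge_space using T by blast
    ultimately show ?thesis by simp
  qed
  show "Pow (Pow F) \<subseteq> sets (edge_space F)"
  proof
    fix X assume X: "X \<in> Pow (Pow F)"
    then have "finite X" using assms by (meson PowD finite_Pow_iff finite_subset)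
    then have "(\<Union>T\<in>X. {T}) \<in> sets (edge_space F)" using X atom by (intro sets.finite_UN) blast+
    then show "X \<in> sets (edge_space F)" by simp
  qed
qed

section \<open>Local events under a 1-independent measure\<close>

locale one_independent_graph = prob_space \<mu> for \<mu> :: "'v set set measure" +
  fixes E :: "'v set set"
  assumes sets_model: "sets \<mu> = sets (edge_space E)" and indep: "one_independent E \<mu>"
begin

lemma space_model: "space \<mu> = Pow E"
  using sets_eq_imp_space_eq[OF sets_model] by (simp add: space_edge_space)

lemma restriction_measurable: "F \<subseteq> E \<Longrightarrow> (\<lambda>S. S \<inter> F) \<in> \<mu> \<rightarrow>\<^sub>M edge_space F"
  using measurable_Int_edge_space measurable_cong_sets[OF sets_model refl] by blast

lemma local_event_vimage:
  assumes "F \<subseteq> E" "depends_on E F Q"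
  shows "{S \<in> space \<mu>. Q S} = (\<lambda>S. S \<inter> F) -` {T \<in> Pow F. Q T} \<inter> space \<mu>"
  using assms unfolding depends_on_def space_model by blast

lemma local_event:
  assumes "finite F" "F \<subseteq> E" "depends_on E F Q"
  shows "{S \<in> space \<mu>. Q S} \<in> events"
  unfolding local_event_vimage[OF assms(2,3)]
  by (rule measurable_sets[OF restriction_measurable[OF assms(2)]]) (auto simp: sets_edge_space_finite[OF assms(1)])

lemma local_indep:
  assumes F: "finite F" "F \<subseteq> E" "depends_on E F Q" and G: "finite G" "G \<subseteq> E" "depends_on E G R"
    and disj: "\<Union>F \<inter> \<Union>G = {}"
  shows "prob ({S \<in> space \<mu>. Q S} \<inter> {S \<in> space \<mu>. R S}) = prob {S \<in> space \<mu>. Q S} * prob {S \<in> space \<mu>. R S}"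
proof -
  have iv: "indep_var (edge_space F) (\<lambda>S. S \<inter> F) (edge_space G) (\<lambda>S. S \<inter> G)"
    using indep F(2) G(2) disj unfolding one_independent_def by blast
  have "{T \<in> Pow F. Q T} \<in> sets (edge_space F)" "{T \<in> Pow G. R T} \<in> sets (edge_space G)"
    using sets_edge_space_finite F(1) G(1) by blast+
  from indep_varD[OF iv this]
  have "prob ((\<lambda>S. (S \<inter> F, S \<inter> G)) -` ({T \<in> Pow F. Q T} \<times> {T \<in> Pow G. R T}) \<inter> space \<mu>) =
      prob {S \<in> space \<mu>. Q S} * prob {S \<in> space \<mu>. R S}"
    unfolding local_event_vimage[OF F(2,3)] local_event_vimage[OF G(2,3)] .
  moreover have "(\<lambda>S. (S \<inter> F, S \<inter> G)) -` ({T \<in> Pow F. Q T} \<times> {T \<in> Pow G. R T}) \<inter> space \<mu> =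
      {S \<in> space \<mu>. Q S} \<inter> {S \<in> space \<mu>. R S}"
    unfolding local_event_vimage[OF F(2,3)] local_event_vimage[OF G(2,3)] by blast
  ultimately show ?thesis by simp
qed

lemma edge_event: "{S \<in> space \<mu>. e \<in> S} \<in> events"
proof (cases "e \<in> E")
  case True
  then show ?thesis by (intro local_event[of "{e}"]) (simp_all add: depends_on_def)
next
  case False
  then have "{S \<in> space \<mu>. e \<in> S} = {}" unfolding space_model by blast
  then show ?thesis by (simp only: sets.empty_sets)
qed

lemma edge_indep:
  assumes "e \<inter> f = {}"
  shows "prob ({S \<in> space \<mu>. e \<in> S} \<inter> {S \<in> space \<mu>. f \<in> S}) = prob {S \<in> space \<mu>. e \<in> S} * prob {S \<in> space \<mu>. f \<in> S}"
proof (cases "e \<in> E \<and> f \<in> E")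
  case True
  then show ?thesis using assms by (intro local_indep[of "{e}" _ "{f}"]) (simp_all add: depends_on_def)
next
  case False
  then have "{S \<in> space \<mu>. e \<in> S} = {} \<or> {S \<in> space \<mu>. f \<in> S} = {}" unfolding space_model by blast
  then show ?thesis
    by (elim disjE) (simp_all only: Int_empty_left Int_empty_right measure_empty mult_zero_left mult_zero_right)
qed

end

definition edges_within :: "nat \<Rightarrow> (int \<times> int) set \<Rightarrow> ((int \<times> int) \<times> nat) set set" where
  "edges_within n W = {e \<in> Z2K_E n. e \<subseteq> W \<times> UNIV}"

text \<open>The condition \<open>i \<noteq> j\<close> makes irreflexivity hold for every
  \<open>S\<close>, as the locale \<open>random_layer\<close> demands, and not just for
  \<open>S\<close> inside \<open>Z2K_E n\<close>.\<close>

definition fibre :: "((int \<times> int) \<times> nat) set set \<Rightarrow> int \<times> int \<Rightarrow> nat \<Rightarrow> nat \<Rightarrow> bool" where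
  "fibre S u i j \<longleftrightarrow> i \<noteq> j \<and> {(u, i), (u, j)} \<in> S"

definition rung :: "((int \<times> int) \<times> nat) set set \<Rightarrow> int \<times> int \<Rightarrow> int \<times> int \<Rightarrow> nat \<Rightarrow> bool" where
  "rung S u v i \<longleftrightarrow> {(u, i), (v, i)} \<in> S"

definition joined :: "nat \<Rightarrow> ((int \<times> int) \<times> nat) set set \<Rightarrow> int \<times> int \<Rightarrow> int \<times> int \<Rightarrow> bool" where
  "joined n S u v = linked n (fibre S u) (fibre S v) (rung S u v)"

lemma within_subset: "edges_within n W \<subseteq> Z2K_E n"
  by (auto simp: edges_within_def)

lemma finite_within:
  assumes "finite W"
  shows "finite (edges_within n W)"
proof (rule finite_subset)
  show "edges_within n W \<subseteq> Pow (W \<times> {..<n})"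
  proof
    fix e assume "e \<in> edges_within n W"
    then have e: "e \<in> Z2K_E n" "e \<subseteq> W \<times> UNIV" by (simp_all add: edges_within_def)
    then have "e \<subseteq> Z2K_V n" using edge_vertices_subset by blast
    then show "e \<in> Pow (W \<times> {..<n})" using e(2) unfolding Z2K_V_def by blast
  qed
qed (use assms in simp)

lemma within_disjoint: "W \<inter> W' = {} \<Longrightarrow> \<Union>(edges_within n W) \<inter> \<Union>(edges_within n W') = {}"
  unfolding edges_within_def by blast

lemma fibre_within: "S \<subseteq> Z2K_E n \<Longrightarrow> u \<in> W \<Longrightarrow> fibre (S \<inter> edges_within n W) u = fibre S u"
  unfolding fibre_def edges_within_def by (intro ext) blast

lemma rung_within: "S \<subseteq> Z2K_E n \<Longrightarrow> u \<in> W \<Longrightarrow> v \<in> W \<Longrightarrow> rung (S \<inter> edges_within n W) u v = rung S u v"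
  unfolding rung_def edges_within_def by (intro ext) blast

lemma joined_within: "S \<subseteq> Z2K_E n \<Longrightarrow> u \<in> W \<Longrightarrow> v \<in> W \<Longrightarrow> joined n (S \<inter> edges_within n W) u v = joined n S u v"
  unfolding joined_def by (simp only: fibre_within rung_within)

lemma coarse_bond_depends:
  assumes "region k U \<union> region k V \<subseteq> W"
  shows "depends_on (Z2K_E n) (edges_within n W) (\<lambda>S. coarse_bond (joined n S) k U V)"
  unfolding depends_on_def
proof (intro allI impI)
  fix S assume "S \<subseteq> Z2K_E n"
  then show "coarse_bond (joined n S) k U V = coarse_bond (joined n (S \<inter> edges_within n W)) k U V"
    by (intro coarse_bond_cong[OF _ assms]) (simp only: joined_within)
qed

locale lattice_model = one_independent_graph \<mu> "Z2K_E n" for \<mu> n +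
  fixes p :: real
  assumes edge_probability: "e \<in> Z2K_E n \<Longrightarrow> p \<le> prob {S \<in> space \<mu>. e \<in> S}"
begin

lemma fibre_event_eq: "{S \<in> space \<mu>. fibre S u i j} = (if i = j then {} else {S \<in> space \<mu>. {(u, i), (u, j)} \<in> S})"
  by (auto simp: fibre_def)

lemma random_layer_fibre: "random_layer \<mu> n p (\<lambda>S. fibre S u)"
proof (intro random_layer.intro random_layer_axioms.intro prob_space_axioms)
  show "symp (fibre S u)" for S by (auto simp: symp_def fibre_def insert_commute)
  show "\<not> fibre S u i i" for S i by (simp add: fibre_def)
  show "{S \<in> space \<mu>. fibre S u i j} \<in> events" for i j
    unfolding fibre_event_eq using edge_event by simp
  show "p \<le> prob {S \<in> space \<mu>. fibre S u i j}" if "i < n" "j < n" "i \<noteq> j" for i j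
  proof -
    have "{(u, i), (u, j)} \<in> Z2K_E n" using that by (simp add: Z2K_E_iff)
    then show ?thesis unfolding fibre_event_eq using edge_probability that(3) by simp
  qed
  show "prob ({S \<in> space \<mu>. fibre S u i j} \<inter> {S \<in> space \<mu>. fibre S u k l}) =
      prob {S \<in> space \<mu>. fibre S u i j} * prob {S \<in> space \<mu>. fibre S u k l}"
    if "{i, j} \<inter> {k, l} = {}" for i j k l
  proof (cases "i = j \<or> k = l")
    case True
    then show ?thesis unfolding fibre_event_eq by (elim disjE) simp_all
  next
    case False
    have "{(u, i), (u, j)} \<inter> {(u, k), (u, l)} = {}" using that by blast
    from edge_indep[OF this] show ?thesis unfolding fibre_event_eq using False by simp
  qed
qed

text \<open>Fibres over distinct base points span disjoint vertex sets, and so do two distinct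
  rungs; 1-independence applies to both.\<close>

lemma layer_pair_fibres:
  assumes uv: "lattice_adj u v"
  shows "layer_pair \<mu> n p (\<lambda>S. fibre S u) (\<lambda>S. fibre S v) (\<lambda>S. rung S u v)"
proof (intro layer_pair.intro layer_pair_axioms.intro random_layer_fibre)
  have ne: "u \<noteq> v" by (rule lattice_adj_neq[OF uv])
  show "{S \<in> space \<mu>. rung S u v i} \<in> events" for i unfolding rung_def by (rule edge_event)
  show "p \<le> prob {S \<in> space \<mu>. rung S u v i}" if "i < n" for i
    unfolding rung_def using uv that by (intro edge_probability) (simp add: Z2K_E_iff)
  show "prob ({S \<in> space \<mu>. rung S u v i} \<inter> {S \<in> space \<mu>. rung S u v j}) =
      prob {S \<in> space \<mu>. rung S u v i} * prob {S \<in> space \<mu>. rung S u v j}" if "i \<noteq> j" for i j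
    unfolding rung_def by (rule edge_indep) (use that in blast)
  fix T T' i j k l
  have dep: "depends_on (Z2K_E n) (edges_within n {w}) (\<lambda>S. (\<exists>t\<in>A. fibre S w a t) \<and> (\<exists>t\<in>A. fibre S w b t))" for w A a b
    unfolding depends_on_def by (intro allI impI) (simp only: fibre_within[OF _ singletonI])
  have eq: "{S \<in> space \<mu>. \<exists>t\<in>A. fibre S w a t} \<inter> {S \<in> space \<mu>. \<exists>t\<in>A. fibre S w b t} =
      {S \<in> space \<mu>. (\<exists>t\<in>A. fibre S w a t) \<and> (\<exists>t\<in>A. fibre S w b t)}" for w A a b by blast
  show "prob (({S \<in> space \<mu>. \<exists>t\<in>T. fibre S u i t} \<inter> {S \<in> space \<mu>. \<exists>t\<in>T. fibre S u j t}) \<inter>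
        ({S \<in> space \<mu>. \<exists>t\<in>T'. fibre S v k t} \<inter> {S \<in> space \<mu>. \<exists>t\<in>T'. fibre S v l t})) =
      prob ({S \<in> space \<mu>. \<exists>t\<in>T. fibre S u i t} \<inter> {S \<in> space \<mu>. \<exists>t\<in>T. fibre S u j t}) *
      prob ({S \<in> space \<mu>. \<exists>t\<in>T'. fibre S v k t} \<inter> {S \<in> space \<mu>. \<exists>t\<in>T'. fibre S v l t})"
    unfolding eq
    by (rule local_indep[OF finite_within within_subset dep finite_within within_subset dep within_disjoint])
       (use ne in simp_all)
qed

lemma coarse_bond_event: "{S \<in> space \<mu>. \<not> coarse_bond (joined n S) k U V} \<in> events"
proof -
  have "{S \<in> space \<mu>. coarse_bond (joined n S) k U V} \<in> events"
    by (rule local_event[OF finite_within within_subset coarse_bond_depends[OF subset_refl]])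
       (simp add: finite_region)
  moreover have "{S \<in> space \<mu>. \<not> coarse_bond (joined n S) k U V} = space \<mu> - {S \<in> space \<mu>. coarse_bond (joined n S) k U V}"
    by blast
  ultimately show ?thesis by simp
qed

lemma coarse_bond_indep:
  assumes "{u, v} \<inter> {u', v'} = {}"
  shows "prob ({S \<in> space \<mu>. \<not> coarse_bond (joined n S) k u v} \<inter> {S \<in> space \<mu>. \<not> coarse_bond (joined n S) k u' v'}) =
    prob {S \<in> space \<mu>. \<not> coarse_bond (joined n S) k u v} * prob {S \<in> space \<mu>. \<not> coarse_bond (joined n S) k u' v'}"
proof (rule local_indep)
  have dep: "depends_on (Z2K_E n) (edges_within n (region k a \<union> region k b)) (\<lambda>S. \<not> coarse_bond (joined n S) k a b)" for a b
    using coarse_bond_depends[OF subset_refl, where k = k and U = a and V = b and n = n] unfolding depends_on_def by blast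
  show "depends_on (Z2K_E n) (edges_within n (region k u \<union> region k v)) (\<lambda>S. \<not> coarse_bond (joined n S) k u v)"
    "depends_on (Z2K_E n) (edges_within n (region k u' \<union> region k v')) (\<lambda>S. \<not> coarse_bond (joined n S) k u' v')"
    by (rule dep)+
  have "region k a \<inter> region k b = {}" if "a \<in> {u, v}" "b \<in> {u', v'}" for a b
    using region_disjoint that assms by blast
  then have "(region k u \<union> region k v) \<inter> (region k u' \<union> region k v') = {}" by blast
  then show "\<Union>(edges_within n (region k u \<union> region k v)) \<inter> \<Union>(edges_within n (region k u' \<union> region k v')) = {}"
    by (rule within_disjoint)
qed (simp_all add: finite_within finite_region within_subset)

text \<open>If bonds fail with probability at most e at one scale, they fail with at most 4096 e^2
  at the next, where 4096 = 8^4 bounds the quadruples of children carrying two disjoint bonds. The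
  start 1 / 8192 = 1 / (2 * 4096) makes every step at least halve the bound.\<close>

lemma coarse_bond_failure:
  assumes base: "\<And>u v. lattice_adj u v \<Longrightarrow> prob {S \<in> space \<mu>. \<not> joined n S u v} \<le> 1 / 8192"
  shows "lattice_adj U V \<Longrightarrow> prob {S \<in> space \<mu>. \<not> coarse_bond (joined n S) k U V} \<le> 1 / 8192 * (1 / 2) ^ k"
proof (induction k arbitrary: U V)
  case 0
  then show ?case using base by simp
next
  case (Suc k)
  let ?W = "children U \<union> children V"
  let ?B = "\<lambda>u v. {S \<in> space \<mu>. \<not> coarse_bond (joined n S) k u v}"
  define e :: real where "e = 1 / 8192 * (1 / 2) ^ k"
  define I where "I = {(u, v, u', v') \<in> ?W \<times> ?W \<times> ?W \<times> ?W. lattice_adj u v \<and> lattice_adj u' v' \<and> {u, v} \<inter> {u', v'} = {}}"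
  have finW: "finite ?W" by (simp add: finite_children)
  have sub: "I \<subseteq> ?W \<times> ?W \<times> ?W \<times> ?W" unfolding I_def by blast
  then have finI: "finite I" by (rule finite_subset) (use finW in simp)
  have "card I \<le> card (?W \<times> ?W \<times> ?W \<times> ?W)" using finW sub by (intro card_mono) auto
  also have "\<dots> = card ?W * (card ?W * (card ?W * card ?W))" by (simp only: card_cartesian_product)
  also have "\<dots> \<le> 8 * (8 * (8 * 8))"
  proof -
    have "card ?W \<le> 8" using card_Un_le[of "children U" "children V"] by (simp add: card_children)
    then show ?thesis by (intro mult_le_mono)
  qed
  finally have cardI: "real (card I) \<le> 4096" by simp
  let ?C = "\<lambda>(u, v, u', v'). ?B u v \<inter> ?B u' v'"
  have "{S \<in> space \<mu>. \<not> coarse_bond (joined n S) (Suc k) U V} \<subseteq> (\<Union>q\<in>I. ?C q)"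
  proof
    fix S assume S: "S \<in> {S \<in> space \<mu>. \<not> coarse_bond (joined n S) (Suc k) U V}"
    then have "\<not> coarse_bond (joined n S) (Suc k) U V" by blast
    then obtain u v u' v' where q: "u \<in> ?W" "v \<in> ?W" "u' \<in> ?W" "v' \<in> ?W" "lattice_adj u v" "lattice_adj u' v'"
        "{u, v} \<inter> {u', v'} = {}" "\<not> coarse_bond (joined n S) k u v" "\<not> coarse_bond (joined n S) k u' v'"
      by (rule disjoint_bad_bonds)
    have "(u, v, u', v') \<in> I" unfolding I_def using q(1-7) by blast
    moreover have "S \<in> ?C (u, v, u', v')" using q(8,9) S by simp
    ultimately show "S \<in> (\<Union>q\<in>I. ?C q)" by blast
  qed
  moreover have ev: "?C q \<in> events" for q using coarse_bond_event by (cases q) simp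
  then have "(\<Union>q\<in>I. ?C q) \<in> events" using finI by (intro sets.finite_UN)
  ultimately have "prob {S \<in> space \<mu>. \<not> coarse_bond (joined n S) (Suc k) U V} \<le> prob (\<Union>q\<in>I. ?C q)"
    by (rule finite_measure_mono)
  also have "\<dots> \<le> (\<Sum>q\<in>I. prob (?C q))"
    using finI ev by (intro finite_measure_subadditive_finite) auto
  also have "\<dots> \<le> (\<Sum>q\<in>I. e * e)"
  proof (rule sum_mono)
    fix q assume "q \<in> I"
    then obtain u v u' v' where q: "q = (u, v, u', v')" "lattice_adj u v" "lattice_adj u' v'" "{u, v} \<inter> {u', v'} = {}"
      unfolding I_def by blast
    have "prob (?C q) = prob (?B u v) * prob (?B u' v')"
      unfolding q(1) prod.case by (rule coarse_bond_indep[OF q(4)])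
    also have "\<dots> \<le> e * e"
      using Suc.IH[OF q(2)] Suc.IH[OF q(3)] unfolding e_def by (intro mult_mono) simp_all
    finally show "prob (?C q) \<le> e * e" .
  qed
  also have "\<dots> = real (card I) * (e * e)" by simp
  also have "\<dots> \<le> 4096 * (e * e)" using cardI by (intro mult_right_mono) simp_all
  also have "\<dots> = 1 / 2 * (1 / 2) ^ k * e" by (simp add: e_def)
  also have "\<dots> \<le> 1 / 2 * 1 * e"
    unfolding e_def by (intro mult_right_mono mult_left_mono power_le_one) simp_all
  also have "\<dots> = 1 / 8192 * (1 / 2) ^ Suc k" by (simp add: e_def)
  finally show ?case .
qed

end

section \<open>From good bonds to an infinite component\<close>

definition fibre_component :: "nat \<Rightarrow> ((int \<times> int) \<times> nat) set set \<Rightarrow> int \<times> int \<Rightarrow> ((int \<times> int) \<times> nat) set" where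
  "fibre_component n S u = {y. (\<lambda>x y. {x, y} \<in> S)\<^sup>*\<^sup>* (u, SOME i. giant n (fibre S u) i) y}"

text \<open>The colouring plugged into \<open>linked\<close> is reachability in \<open>S\<close>
  from the chosen giant vertex over \<open>u\<close>. It is constant along all open edges, hence
  also true at the giant vertex over \<open>v\<close>.\<close>

lemma joined_component:
  assumes "joined n S u v"
  shows "fibre_component n S u = fibre_component n S v"
proof -
  let ?R = "(\<lambda>x y. {x, y} \<in> S)\<^sup>*\<^sup>*"
  define a where "a = (SOME i. giant n (fibre S u) i)"
  define b where "b = (SOME i. giant n (fibre S v) i)"
  have link: "linked n (fibre S u) (fibre S v) (rung S u v)" using assms by (simp add: joined_def)
  then have "\<exists>i. giant n (fibre S u) i" "\<exists>i. giant n (fibre S v) i" unfolding linked_def by blast+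
  then have ga: "giant n (fibre S u) a" and gb: "giant n (fibre S v) b"
    unfolding a_def b_def by (auto intro: someI_ex)
  have R_step: "?R z x \<longleftrightarrow> ?R z y" if "{x, y} \<in> S" for x y z
  proof -
    have "{y, x} \<in> S" using that by (simp add: insert_commute)
    then show ?thesis using that by (meson rtranclp.rtrancl_into_rtrancl)
  qed
  have "?R (u, a) (u, a) \<longleftrightarrow> ?R (u, a) (v, b)"
  proof -
    have "edge_constant n (fibre S u) (\<lambda>k. ?R (u, a) (u, k))" "edge_constant n (fibre S v) (\<lambda>k. ?R (u, a) (v, k))"
      "\<forall>k<n. rung S u v k \<longrightarrow> ?R (u, a) (u, k) = ?R (u, a) (v, k)"
      unfolding edge_constant_def fibre_def rung_def using R_step by blast+
    then show ?thesis using link ga gb unfolding linked_def by blast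
  qed
  then have ab: "?R (u, a) (v, b)" by simp
  have "symp ?R" by (rule symp_rtranclp) (simp add: symp_def insert_commute)
  then have "?R (v, b) (u, a)" using ab by (rule sympD)
  with ab have "?R (u, a) y \<longleftrightarrow> ?R (v, b) y" for y by (meson rtranclp_trans)
  then show ?thesis unfolding fibre_component_def a_def[symmetric] b_def[symmetric] by blast
qed

text \<open>For all large k the four scale-k blocks (0, 0), (1, 0), (0, 1), (1, 1) carry one common
  component. The representative of (0, 0) at the next scale is that of one of these four, so the
  component does not change with k, while the block (1, 1) forces it to contain vertices with first
  coordinate at least 2^k.\<close>

lemma infinite_component_of_coarse_bonds:
  assumes S: "S \<subseteq> Z2K_E n"
    and good: "\<And>k u v. K \<le> k \<Longrightarrow> u \<in> children (0, 0) \<Longrightarrow> v \<in> children (0, 0) \<Longrightarrow> lattice_adj u v \<Longrightarrow>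
      coarse_bond (joined n S) k u v"
  shows "has_infinite_component (Z2K_V n) S"
proof -
  let ?R = "(\<lambda>x y. {x, y} \<in> S)\<^sup>*\<^sup>*"
  define F where "F k u = fibre_component n S (representative (joined n S) k u)" for k u
  have ch: "u = (0, 0) \<or> u = (1, 0) \<or> u = (0, 1) \<or> u = (1, 1)" if u: "u \<in> children (0, 0)" for u
  proof -
    obtain a b where ab: "u = (a, b)" by (cases u)
    then have "0 \<le> a" "a \<le> 1" "0 \<le> b" "b \<le> 1" using u by (simp_all add: children_eq)
    then have "a = 0 \<or> a = 1" "b = 0 \<or> b = 1" by linarith+
    then show ?thesis unfolding ab by blast
  qed
  have adj: "F k u = F k v" if "K \<le> k" "u \<in> children (0, 0)" "v \<in> children (0, 0)" "lattice_adj u v" for k u v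
    unfolding F_def
    by (rule coarse_bond_representative[where D = "fibre_component n S", OF joined_component that(4) good[OF that]])
  have same: "F k u = F k (0, 0)" if k: "K \<le> k" and u: "u \<in> children (0, 0)" for k u
  proof -
    have "F k (1, 0) = F k (0, 0)" "F k (0, 1) = F k (0, 0)" "F k (1, 1) = F k (1, 0)"
      by (rule adj[OF k]; simp add: children_def lattice_adj_def)+
    then show ?thesis using ch[OF u] by metis
  qed
  have stable: "F k (0, 0) = F K (0, 0)" if "K \<le> k" for k
    using that
  proof (induction k rule: dec_induct)
    case base
    then show ?case ..
  next
    case (step k)
    have "F (Suc k) (0, 0) = F k (good_child (coarse_bond (joined n S) k) (0, 0))" by (simp add: F_def)
    also have "\<dots> = F k (0, 0)" by (rule same[OF step.hyps(1) good_child_in])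
    finally show ?case using step.IH by simp
  qed
  define C where "C = F K (0, 0)"
  define v where "v = (representative (joined n S) K (0, 0), SOME i. giant n (fibre S (representative (joined n S) K (0, 0))) i)"
  have C: "C = {w. ?R v w}" unfolding C_def F_def fibre_component_def v_def ..
  have far: "\<exists>y\<in>C. 2 ^ k \<le> fst (fst y)" if "K \<le> k" for k
  proof -
    let ?w = "representative (joined n S) k (1, 1)"
    have "C = F k (1, 1)" unfolding C_def using stable[OF that] same[OF that, of "(1, 1)"]
      by (simp add: children_def)
    then have "(?w, SOME i. giant n (fibre S ?w) i) \<in> C" unfolding F_def fibre_component_def by simp
    moreover have "2 ^ k \<le> fst ?w" by (rule region_unbounded[OF representative_region])
    ultimately show ?thesis by (metis fst_conv)
  qed
  have inf: "infinite C"
  proof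
    assume "finite C"
    then have fin: "finite ((\<lambda>y. fst (fst y)) ` C)" by simp
    define B where "B = Max ((\<lambda>y. fst (fst y)) ` C)"
    \<comment> \<open>2^k > k \<ge> B contradicts the maximality of \<open>B\<close>.\<close>
    define k where "k = max K (nat B)"
    obtain y where y: "y \<in> C" "2 ^ k \<le> fst (fst y)" using far[of k] by (auto simp: k_def)
    then have "2 ^ k \<le> B" unfolding B_def using Max_ge[OF fin] by (metis image_eqI order_trans)
    moreover have "int k < 2 ^ k" using less_exp[of k] by (metis of_nat_less_iff of_nat_numeral of_nat_power)
    moreover have "B \<le> int k" unfolding k_def by linarith
    ultimately show False by linarith
  qed
  have "v \<in> Z2K_V n"
  proof -
    \<comment> \<open>The second coordinate of \<open>v\<close> is a \<open>SOME\<close>, not known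
      here to pick a giant vertex. That \<open>v\<close> is a vertex of the graph is deduced from an
      open edge at \<open>v\<close>, which an infinite component must have.\<close>
    have "infinite (C - {v})" using inf by simp
    then have "C - {v} \<noteq> {}" by (rule infinite_imp_nonempty)
    then obtain y where y: "?R v y" "y \<noteq> v" unfolding C by blast
    from y(1) obtain z where "{v, z} \<in> S"
      by (rule converse_rtranclpE) (use y(2) in blast)+
    then have "{v, z} \<in> Z2K_E n" using S by blast
    then show ?thesis unfolding Z2K_E_iff by (simp add: Z2K_V_def mem_Times_iff)
  qed
  then show ?thesis unfolding has_infinite_component_def using inf unfolding C by blast
qed

context lattice_model begin

text \<open>Only the finitely many bonds among the four blocks at the origin are watched; their
  failure probabilities are summable over the scales, so almost surely all of them are good from
  some scale on.\<close>

lemma percolates_of_joined: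
  assumes base: "\<And>u v. lattice_adj u v \<Longrightarrow> prob {S \<in> space \<mu>. \<not> joined n S u v} \<le> 1 / 8192"
  shows "percolates (Z2K_V n) \<mu>"
proof -
  let ?ch = "children (0, 0)"
  let ?I = "{(u, v) \<in> ?ch \<times> ?ch. lattice_adj u v}"
  let ?B = "\<lambda>k (u, v). {S \<in> space \<mu>. \<not> coarse_bond (joined n S) k u v}"
  let ?A = "\<lambda>k. \<Union>q\<in>?I. ?B k q"
  have finI: "finite ?I" by (rule finite_subset[of _ "?ch \<times> ?ch"]) (auto simp: finite_children)
  have ev: "?B k q \<in> events" for k q using coarse_bond_event by (cases q) simp
  have A: "?A k \<in> events" for k using finI ev by (intro sets.finite_UN)
  have PA: "prob (?A k) \<le> real (card ?I) * (1 / 8192 * (1 / 2) ^ k)" for k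
  proof -
    have "prob (?A k) \<le> (\<Sum>q\<in>?I. prob (?B k q))"
      using finI ev by (intro finite_measure_subadditive_finite) auto
    also have "\<dots> \<le> (\<Sum>q\<in>?I. 1 / 8192 * (1 / 2) ^ k)"
    proof (rule sum_mono)
      fix q assume "q \<in> ?I"
      then obtain u v where "q = (u, v)" "lattice_adj u v" by blast
      then show "prob (?B k q) \<le> 1 / 8192 * (1 / 2) ^ k" using coarse_bond_failure[OF base] by simp
    qed
    finally show ?thesis by simp
  qed
  have "summable (\<lambda>k. prob (?A k))"
  proof (rule summable_comparison_test')
    show "summable (\<lambda>k. real (card ?I) * (1 / 8192 * (1 / 2 :: real) ^ k))"
      by (intro summable_mult summable_geometric) simp
    show "norm (prob (?A k)) \<le> real (card ?I) * (1 / 8192 * (1 / 2) ^ k)" for k using PA by simp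
  qed
  then have "AE S in \<mu>. \<forall>\<^sub>F k in sequentially. S \<in> space \<mu> - ?A k"
    by (intro borel_cantelli_AE1[OF A]) (simp_all add: emeasure_eq_measure)
  then show ?thesis unfolding percolates_def
  proof (rule AE_mp, intro AE_I2 impI)
    fix S assume S: "S \<in> space \<mu>" "\<forall>\<^sub>F k in sequentially. S \<in> space \<mu> - ?A k"
    then obtain K where K: "\<forall>k\<ge>K. S \<in> space \<mu> - ?A k" unfolding eventually_sequentially by blast
    show "has_infinite_component (Z2K_V n) S"
    proof (rule infinite_component_of_coarse_bonds)
      show "S \<subseteq> Z2K_E n" using S(1) unfolding space_model by blast
      show "coarse_bond (joined n S) k u v" if "K \<le> k" "u \<in> ?ch" "v \<in> ?ch" "lattice_adj u v" for k u v
      proof (rule ccontr)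
        assume "\<not> coarse_bond (joined n S) k u v"
        then have "S \<in> ?B k (u, v)" using S(1) by simp
        moreover have "(u, v) \<in> ?I" using that by simp
        ultimately have "S \<in> ?A k" by blast
        then show False using K that(1) by blast
      qed
    qed
  qed
qed

end

section \<open>Bounds for the critical probability\<close>

lemma percolation_above_threshold:
  assumes p: "p > 4 - 2 * sqrt 3"
  shows "\<exists>N. \<forall>n\<ge>N. \<forall>\<mu>\<in>M1 (Z2K_E n) p. percolates (Z2K_V n) \<mu>"
proof -
  obtain N where N: "\<forall>n\<ge>N. \<forall>(M::((int \<times> int) \<times> nat) set set measure) E0 E1 H. layer_pair M n p E0 E1 H \<longrightarrow>
    (\<exists>B\<in>sets M. measure M B \<le> 1 / 8192 \<and> (\<forall>x\<in>space M - B. linked n (E0 x) (E1 x) (H x)))"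
    using layer_pair_linked[OF p, of "1 / 8192"] by auto
  show ?thesis
  proof (intro exI[of _ N] allI impI ballI)
    fix n \<mu> assume n: "N \<le> n" and \<mu>: "\<mu> \<in> M1 (Z2K_E n) p"
    interpret lattice_model \<mu> n p
      using \<mu> unfolding M1_def random_graph_model_def
      by (intro lattice_model.intro lattice_model_axioms.intro one_independent_graph.intro
          one_independent_graph_axioms.intro) blast+
    show "percolates (Z2K_V n) \<mu>"
    proof (rule percolates_of_joined)
      fix u v :: "int \<times> int" assume "lattice_adj u v"
      from N[rule_format, OF n layer_pair_fibres[OF this]] obtain B where B: "B \<in> events" "prob B \<le> 1 / 8192"
          "\<forall>S\<in>space \<mu> - B. linked n (fibre S u) (fibre S v) (rung S u v)"
        by blast
      have "prob {S \<in> space \<mu>. \<not> joined n S u v} \<le> prob B"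
        using B(1,3) unfolding joined_def by (intro finite_measure_mono) blast+
      then show "prob {S \<in> space \<mu>. \<not> joined n S u v} \<le> 1 / 8192" using B(2) by linarith
    qed
  qed
qed

text \<open>The bound holds for all large n at once, so the limit can be taken without knowing that
  \<open>p1c\<close> is monotone in n.\<close>

lemma p1c_upper_bound:
  assumes p: "p > 4 - 2 * sqrt 3"
  shows "\<exists>N. \<forall>n\<ge>N. p1c (Z2K_V n) (Z2K_E n) \<le> p"
proof -
  obtain N where N: "\<forall>n\<ge>N. \<forall>\<mu>\<in>M1 (Z2K_E n) p. percolates (Z2K_V n) \<mu>"
    using percolation_above_threshold[OF p] ..
  have "0 \<le> p" using p sqrt3_bounds by linarith
  have "p1c (Z2K_V n) (Z2K_E n) \<le> p" if "N \<le> n" for n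
    unfolding p1c_def
  proof (rule cInf_lower)
    show "p \<in> {p. 0 \<le> p \<and> (\<forall>\<mu>\<in>M1 (Z2K_E n) p. percolates (Z2K_V n) \<mu>)}" using N that \<open>0 \<le> p\<close> by blast
    show "bdd_below {p. 0 \<le> p \<and> (\<forall>\<mu>\<in>M1 (Z2K_E n) p. percolates (Z2K_V n) \<mu>)}"
      by (rule bdd_belowI[of _ 0]) blast
  qed
  then show ?thesis by blast
qed

theorem theorem8:
  shows "(\<forall>p::real. p > 4 - 2 * sqrt 3 \<longrightarrow>
            (\<exists>N::nat. N \<ge> 1 \<and> p1c (Z2K_V N) (Z2K_E N) \<le> p))
       \<and> (\<forall>n::nat. n \<ge> 1 \<longrightarrow> p1c (Z2K_V n) (Z2K_E n) \<ge> 4 - 2 * sqrt 3)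
       \<and> (\<lambda>n. p1c (Z2K_V n) (Z2K_E n)) \<longlonglongrightarrow> 4 - 2 * sqrt 3"
proof (intro conjI allI impI)
  fix p :: real assume "p > 4 - 2 * sqrt 3"
  then obtain N where "\<forall>n\<ge>N. p1c (Z2K_V n) (Z2K_E n) \<le> p" using p1c_upper_bound by blast
  then show "\<exists>N::nat. N \<ge> 1 \<and> p1c (Z2K_V N) (Z2K_E N) \<le> p" by (intro exI[of _ "max 1 N"]) simp
next
  fix n :: nat assume "n \<ge> 1"
  then show "p1c (Z2K_V n) (Z2K_E n) \<ge> 4 - 2 * sqrt 3" by (rule p1c_lower_bound)
next
  show "(\<lambda>n. p1c (Z2K_V n) (Z2K_E n)) \<longlonglongrightarrow> 4 - 2 * sqrt 3"
  proof (rule order_tendstoI)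
    fix a assume "a < 4 - 2 * sqrt (3::real)"
    then have "a < p1c (Z2K_V n) (Z2K_E n)" if "n \<ge> 1" for n
      using p1c_lower_bound[OF that] by linarith
    then show "\<forall>\<^sub>F n in sequentially. a < p1c (Z2K_V n) (Z2K_E n)"
      unfolding eventually_sequentially by blast
  next
    fix a assume a: "4 - 2 * sqrt (3::real) < a"
    \<comment> \<open>The upper bound is a weak inequality; passing through the midpoint makes it
      strict.\<close>
    define b where "b = (a + (4 - 2 * sqrt 3)) / 2"
    have b: "4 - 2 * sqrt 3 < b" "b < a" using a by (simp_all add: b_def)
    obtain N where N: "\<forall>n\<ge>N. p1c (Z2K_V n) (Z2K_E n) \<le> b" using p1c_upper_bound[OF b(1)] by blast
    then have "p1c (Z2K_V n) (Z2K_E n) < a" if "N \<le> n" for n using that b(2) by (meson le_less_trans)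
    then show "\<forall>\<^sub>F n in sequentially. p1c (Z2K_V n) (Z2K_E n) < a"
      unfolding eventually_sequentially by blast
  qed
qed

end
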